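(* Let $\xi(t)$, $t\ge 0$, be the continuous-time birth-and-death process on $\mathbb{Z}^+=\{0,1,2,\dots\}$ with $\xi(0)=0$, birth rates $\lambda(x)>0$ ($x\in\mathbb{Z}^+$), death rates $\mu(x)>0$ ($x\in\mathbb{N}$) and $\mu(0)=0$. Let $l,m\ge 0$ with $l\ne m$, let $y,z$ be slowly varying functions at infinity, and put $Y(x)=y(x)x^l$, $Z(x)=z(x)x^m$, $V(x)=\max(Y(x),Z(x))$. Assume $$\lim_{x\to\infty}\frac{\lambda(x)}{Y(x)}=\lim_{x\to\infty}\frac{\mu(x)}{Z(x)}=1 .$$ Let $\varphi:(0,\infty)\to(0,\infty)$ satisfy $$\lim_{T\to\infty}\varphi(T)=\infty\quad\text{and}\quad \lim_{T\to\infty}\frac{\varphi(T)\ln(\varphi(T))}{T\,V(\varphi(T))}=0 ,$$ and let $\xi_{\varphi,T}(t)=\xi(tT)/\varphi(T)$, $0\le t\le 1$. Then the family $\{\xi_{\varphi,T}(t),\,0\le t\le 1\}$ satisfies the local large deviation principle on $F$ with normalizing function $\psi(T)=T\,V(\varphi(T))$ and rate function $I(f)=\int_0^1 f^{\,l\vee m}(t)\,dt$; that is, for every $f\in F$, $$\lim_{\varepsilon\to0}\limsup_{T\to\infty}\frac{1}{T\,V(\varphi(T))}\ln\mathbf{P}\big(\xi_{\varphi,T}\in U_\varepsilon(f)\big)=\lim_{\varepsilon\to0}\liminf_{T\to\infty}\frac{1}{T\,V(\varphi(T))}\ln\mathbf{P}\big(\xi_{\varphi,T}\in U_\varepsilon(f)\big)=-\int_0^1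 f^{\,l\vee m}(t)\,dt .$$
   Context: The process $\xi$ is the continuous-time Markov chain on $\mathbb{Z}^+$ which jumps $x\to x+1$ at rate $\lambda(x)$ and $x\to x-1$ at rate $\mu(x)$. The process may explode in finite time; the event $\{\xi_{\varphi,T}\in U_\varepsilon(f)\}$ is understood as an event excluding explosion during $[0,T]$. A (positive, measurable) function $a$ on $(0,\infty)$ is slowly varying at infinity if $\lim_{x\to\infty}a(\beta x)/a(x)=1$ for all $\beta>0$. The limits $\lambda(x)/Y(x)\to1$ and $\mu(x)/Z(x)\to1$ are over integers $x\to\infty$. $F=\{f\in\mathbb{C}[0,1]: f(0)=0 \text{ and } f(t)>0 \text{ for } 0<t\le 1\}$, where $\mathbb{C}[0,1]$ is the space of real continuous functions on $[0,1]$. $\mathbb{D}[0,1]$ is the space of right-continuous functions on $[0,1]$ with left limits, $\rho(f,g)=\sup_{t\in[0,1]}|f(t)-g(t)|$, and $U_\varepsilon(f)=\{g\in\mathbb{D}[0,1]:\rho(f,g)<\varepsilon\}$. $v\vee w$ denotes $\max(v,w)$. $\ln 0=-\infty$. *)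

theory Defs
  imports "HOL-Probability.Probability"
begin

definition bd_trans :: "(nat \<Rightarrow> real) \<Rightarrow> (nat \<Rightarrow> real) \<Rightarrow> nat \<Rightarrow> nat \<Rightarrow> real" where
  "bd_trans lam mu i j =
     (if j = Suc i then lam i / (lam i + mu i)
      else if i = Suc j then mu i / (lam i + mu i)
      else 0)"

text \<open>
  \<open>X\<close> is a Markov chain with transition probabilities \<^term>\<open>bd_trans lam mu\<close>
  started in \<open>x0\<close> and, conditionally on \<open>X\<close>, the holding times \<open>S n\<close> are independent and
  exponentially distributed with parameters \<open>lam (X n) + mu (X n)\<close>.
  The displayed probabilities are the finite-dimensional distributions of
  \<open>(X, S)\<close>, so they determine its joint law.
\<close>

definition jump_chain_holding_times ::
    "'a measure \<Rightarrow> (nat \<Rightarrow> real) \<Rightarrow> (nat \<Rightarrow> real) \<Rightarrow> nat \<Rightarrow> (nat \<Rightarrow> 'a \<Rightarrow> nat) \<Rightarrow> (nat \<Rightarrow> 'a \<Rightarrow> real) \<Rightarrow> bool" where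
  "jump_chain_holding_times M lam mu x0 X S \<longleftrightarrow>
     (\<forall>n. X n \<in> measurable M (count_space UNIV)) \<and>
     (\<forall>n. S n \<in> borel_measurable M) \<and>
     (\<forall>n. \<forall>\<omega>\<in>space M. S n \<omega> > 0) \<and>
     (\<forall>n (x :: nat \<Rightarrow> nat) (s :: nat \<Rightarrow> real). (\<forall>i\<le>n. s i \<ge> 0) \<longrightarrow>
        measure M {\<omega> \<in> space M. \<forall>i\<le>n. X i \<omega> = x i \<and> S i \<omega> > s i} =
          (if x 0 = x0 then 1 else 0) *
          (\<Prod>i<n. bd_trans lam mu (x i) (x (Suc i))) *
          (\<Prod>i\<le>n. exp (- ((lam (x i) + mu (x i)) * s i))))"

text \<open>
  The continuous-time Markov chain jumping from \<open>x\<close> to \<open>x + 1\<close> at rate \<open>lam x\<close> and from \<open>x\<close>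
  to \<open>x - 1\<close> at rate \<open>mu x\<close>, started in \<open>x0\<close>: it occupies the state \<open>X n\<close> during
  \<open>[S 0 + ... + S (n - 1), S 0 + ... + S n)\<close>.  The value \<^term>\<open>None\<close> stands for the
  times from the explosion time \<open>S 0 + S 1 + ...\<close> onwards (if this sum is finite).
\<close>

definition birth_death_process ::
    "'a measure \<Rightarrow> (nat \<Rightarrow> real) \<Rightarrow> (nat \<Rightarrow> real) \<Rightarrow> nat \<Rightarrow> (real \<Rightarrow> 'a \<Rightarrow> nat option) \<Rightarrow> bool" where
  "birth_death_process M lam mu x0 \<xi> \<longleftrightarrow>
     prob_space M \<and>
     (\<exists>X S. jump_chain_holding_times M lam mu x0 X S \<and>
        (\<forall>\<omega>\<in>space M. \<forall>t\<ge>0. \<forall>x.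
           \<xi> t \<omega> = Some x \<longleftrightarrow>
             (\<exists>n. (\<Sum>k<n. S k \<omega>) \<le> t \<and> t < (\<Sum>k<Suc n. S k \<omega>) \<and> X n \<omega> = x)))"

definition scaled_process ::
    "(real \<Rightarrow> 'a \<Rightarrow> nat option) \<Rightarrow> (real \<Rightarrow> real) \<Rightarrow> real \<Rightarrow> real \<Rightarrow> 'a \<Rightarrow> real option" where
  "scaled_process \<xi> \<phi> T t \<omega> = map_option (\<lambda>x. real x / \<phi> T) (\<xi> (t * T) \<omega>)"

definition slowly_varying :: "(real \<Rightarrow> real) \<Rightarrow> bool" where
  "slowly_varying a \<longleftrightarrow>
     (\<forall>x>0. a x > 0) \<and>
     a \<in> borel_measurable (restrict_space borel {0<..}) \<and>
     (\<forall>\<beta>>0. ((\<lambda>x. a (\<beta> * x) / a x) \<longlongrightarrow> 1) at_top)"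

text \<open>
  Functions on \<open>[0,1]\<close> are represented by functions on the whole real line
  whose values outside \<open>[0,1]\<close> are irrelevant.
\<close>

definition D01 :: "(real \<Rightarrow> real) set" where
  "D01 = {g. (\<forall>t\<in>{0..<1}. (g \<longlongrightarrow> g t) (at_right t)) \<and>
             (\<forall>t\<in>{0<..1}. \<exists>L. (g \<longlongrightarrow> L) (at_left t))}"

definition unif_dist :: "(real \<Rightarrow> real) \<Rightarrow> (real \<Rightarrow> real) \<Rightarrow> real" where
  "unif_dist f g = (SUP t\<in>{0..1}. \<bar>f t - g t\<bar>)"

definition unif_nbhd :: "real \<Rightarrow> (real \<Rightarrow> real) \<Rightarrow> (real \<Rightarrow> real) set" where
  "unif_nbhd \<epsilon> f = {g \<in> D01. unif_dist f g < \<epsilon>}"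

definition positive_paths :: "(real \<Rightarrow> real) set" where
  "positive_paths = {f. continuous_on {0..1} f \<and> f 0 = 0 \<and> (\<forall>t. 0 < t \<and> t \<le> 1 \<longrightarrow> f t > 0)}"

definition ln_prob :: "real \<Rightarrow> ereal" where
  "ln_prob p = (if p = 0 then - \<infinity> else ereal (ln p))"

text \<open>
  A process on \<open>[0,1]\<close> with possible explosion belongs to a set of paths only if
  it has not exploded during \<open>[0,1]\<close>.
\<close>

definition path_event :: "'a measure \<Rightarrow> (real \<Rightarrow> 'a \<Rightarrow> real option) \<Rightarrow> (real \<Rightarrow> real) set \<Rightarrow> 'a set" where
  "path_event M \<eta> U = {\<omega> \<in> space M. \<exists>g\<in>U. \<forall>t\<in>{0..1}. \<eta> t \<omega> = Some (g t)}"

definition local_ldp ::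
    "'a measure \<Rightarrow> (real \<Rightarrow> real \<Rightarrow> 'a \<Rightarrow> real option) \<Rightarrow> (real \<Rightarrow> real) set \<Rightarrow>
     (real \<Rightarrow> real) \<Rightarrow> ((real \<Rightarrow> real) \<Rightarrow> real) \<Rightarrow> bool" where
  "local_ldp M \<eta> F \<psi> I \<longleftrightarrow>
     (\<forall>f\<in>F.
        ((\<lambda>\<epsilon>. Limsup at_top (\<lambda>T. ln_prob (measure M (path_event M (\<eta> T) (unif_nbhd \<epsilon> f))) / ereal (\<psi> T)))
           \<longlongrightarrow> ereal (- I f)) (at_right 0) \<and>
        ((\<lambda>\<epsilon>. Liminf at_top (\<lambda>T. ln_prob (measure M (path_event M (\<eta> T) (unif_nbhd \<epsilon> f))) / ereal (\<psi> T)))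
           \<longlongrightarrow> ereal (- I f)) (at_right 0))"

end

theory Submission
  imports Defs
begin

text \<open>
  Write \<open>v = max l m\<close>.  Since \<open>l \<noteq> m\<close>, the total jump rate \<open>h = lam + mu\<close> is asymptotic to \<open>V\<close>, whereas
  \<open>w x = sqrt (lam x * mu (x + 1)) + sqrt (lam (x - 1) * mu x)\<close> is negligible against \<open>V\<close>.
  With \<open>g (x + 1) / g x = sqrt (mu (x + 1) / lam x)\<close> the generator \<open>L\<close> of the process satisfies
  \<open>L g = - (h - w) g\<close>, so \<open>g (\<xi> t) * exp (\<integral>\<^sub>0\<^sup>t (h - w) (\<xi> s) ds)\<close> is a supermartingale started in 1.
  On the event that the scaled path stays close to \<open>f\<close> the integral is
  close to \<open>T * V (\<phi> T) * \<integral> f\<^sup>v\<close>, and \<open>g (\<xi> T)\<close> is at least \<open>exp (- O (\<phi> ln \<phi>))\<close>; this gives the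
  upper bound.  For the lower bound it suffices to follow one lattice path with \<open>O (\<phi>)\<close> jumps that
  tracks \<open>f\<close>: the waiting costs \<open>T * V (\<phi> T) * \<integral> f\<^sup>v\<close>, and each jump, performed in a time window of
  length \<open>T / \<phi>\<^sup>2\<close>, costs a factor that is polynomial in \<open>\<phi>\<close>.
\<close>

section \<open>Slowly varying functions\<close>

text \<open>The jump chain and its holding times are known only through finite-dimensional joint
  tails, and explosion is allowed, so no filtration or optional stopping is used. The
  supermartingale enters as one inequality at the fixed time \<open>T\<close>: its value is split by
  the number of jumps made so far, each summand is an explicit integral against a product of
  exponential laws, and explosion merely loses mass, which is harmless for an upper bound. The
  smallness of \<open>w\<close> is a matter of exponents: a geometric mean of a birth and a death
  rate has exponent (l + m)/2, which is below max l m because l and m differ. The growth condition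
  on \<open>\<phi>\<close> pays for two costs of the same order: the weight at the terminal state
  and the probability of the prescribed jumps are both products of O(\<phi>) factors polynomial in
  \<phi>, hence exp(-O(\<phi> ln \<phi>)). The obstacle is the start at 0: states of bounded size
  lie outside the asymptotic range, and relative errors cannot be controlled there. The rates are
  therefore compared with \<open>V\<close> up to an additive error \<open>d * V\<close>, uniformly
  over all states up to a multiple of \<phi>, and polynomial bounds are proved for every
  state.\<close>

text \<open>
  A Steinhaus argument: if uniformity fails along \<open>u n\<close> and \<open>t n\<close>, then the sets of shifts \<open>s\<close> that
  are good for the base points \<open>u n\<close> and for the base points \<open>u n + t n\<close> both have measure above
  \<open>3/2\<close>, so after translation by \<open>t n\<close> they meet inside \<open>[0,3]\<close>.
\<close>

lemma slowly_varying_ln_uniform: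
  fixes a :: "real \<Rightarrow> real"
  assumes a: "slowly_varying a" and e: "e > 0"
  shows "\<exists>U. \<forall>u\<ge>U. \<forall>t\<in>{0..1}. \<bar>ln (a (exp (u + t))) - ln (a (exp u))\<bar> < e"
proof (rule ccontr)
  assume neg: "\<not> ?thesis"
  define k where "k = (\<lambda>u. ln (a (exp u)))"
  have k_lim: "((\<lambda>u. k (u + t) - k u) \<longlongrightarrow> 0) at_top" for t
  proof -
    have "((\<lambda>x. a (exp t * x) / a x) \<longlongrightarrow> 1) at_top"
      using a by (auto simp: slowly_varying_def)
    then have "((\<lambda>u. a (exp t * exp u) / a (exp u)) \<longlongrightarrow> 1) at_top"
      by (rule filterlim_compose[OF _ exp_at_top])
    then have "((\<lambda>u. ln (a (exp t * exp u) / a (exp u))) \<longlongrightarrow> ln 1) at_top"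
      by (rule tendsto_ln) auto
    moreover have "ln (a (exp t * exp u) / a (exp u)) = k (u + t) - k u" for u
    proof -
      have "a (exp t * exp u) > 0" "a (exp u) > 0"
        using a by (auto simp: slowly_varying_def)
      then show ?thesis
        unfolding k_def by (simp add: ln_div exp_add mult.commute)
    qed
    ultimately show ?thesis by simp
  qed
  have k_meas [measurable]: "k \<in> borel_measurable borel"
  proof -
    have "a \<in> borel_measurable (restrict_space borel {0<..})"
      using a by (auto simp: slowly_varying_def)
    moreover have "exp \<in> borel \<rightarrow>\<^sub>M restrict_space borel {0::real<..}"
      by (rule measurable_restrict_space2) auto
    ultimately have "(\<lambda>u. a (exp u)) \<in> borel_measurable borel"
      by (rule measurable_compose[rotated])
    then show ?thesis unfolding k_def by simp
  qed
  have "\<forall>n::nat. \<exists>u t. u \<ge> real n \<and> t \<in> {0..1} \<and> \<bar>k (u + t) - k u\<bar> \<ge> e"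
    using neg unfolding k_def by (meson not_less)
  then obtain u t where u: "\<And>n::nat. u n \<ge> real n" and t: "\<And>n. t n \<in> {0..1}"
    and ut: "\<And>n. \<bar>k (u n + t n) - k (u n)\<bar> \<ge> e" by metis
  have u_lim: "filterlim u at_top sequentially"
    using u by (intro filterlim_at_top_mono[OF filterlim_real_sequentially]) auto
  have key: "\<forall>\<^sub>F m in sequentially. emeasure lborel {s\<in>{0..2}. \<forall>n\<ge>m. \<bar>k (v n + s) - k (v n)\<bar> < e/2} > ennreal (3/2)"
    if v: "filterlim v at_top sequentially" for v :: "nat \<Rightarrow> real"
  proof -
    let ?A = "\<lambda>m. {s\<in>{0..2}. \<forall>n\<ge>m. \<bar>k (v n + s) - k (v n)\<bar> < e/2}"
    have "(\<lambda>m. emeasure lborel (?A m)) \<longlonglongrightarrow> emeasure lborel (\<Union>m. ?A m)"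
    proof (rule Lim_emeasure_incseq)
      show "range ?A \<subseteq> sets lborel" by auto
      show "incseq ?A" by (auto simp: incseq_def)
    qed
    also have "(\<Union>m. ?A m) = {0..2}"
    proof -
      have "\<exists>m. \<forall>n\<ge>m. \<bar>k (v n + s) - k (v n)\<bar> < e/2" for s
      proof -
        have "(\<lambda>n. k (v n + s) - k (v n)) \<longlonglongrightarrow> 0"
          by (rule filterlim_compose[OF k_lim v])
        then show ?thesis
          using e unfolding LIMSEQ_def dist_real_def
          by (metis diff_zero half_gt_zero)
      qed
      then show ?thesis by auto
    qed
    finally have "(\<lambda>m. emeasure lborel (?A m)) \<longlonglongrightarrow> ennreal 2" by simp
    then show ?thesis
      by (rule order_tendstoD) (simp add: ennreal_less_iff)
  qed
  have "filterlim (\<lambda>n. u n + t n) at_top sequentially"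
    using t by (intro filterlim_at_top_mono[OF u_lim]) auto
  from eventually_conj[OF key[OF u_lim] key[OF this]] obtain m where
    A: "emeasure lborel {s\<in>{0..2}. \<forall>n\<ge>m. \<bar>k (u n + s) - k (u n)\<bar> < e/2} > ennreal (3/2)" (is "emeasure _ ?A > _") and
    B: "emeasure lborel {s\<in>{0..2}. \<forall>n\<ge>m. \<bar>k (u n + t n + s) - k (u n + t n)\<bar> < e/2} > ennreal (3/2)" (is "emeasure _ ?B > _")
    unfolding eventually_sequentially by auto
  define B' where "B' = {s. s - t m \<in> ?B}"
  have [measurable]: "?A \<in> sets borel" "?B \<in> sets borel" by measurable
  have [measurable]: "B' \<in> sets borel" unfolding B'_def by measurable
  have eB: "emeasure lborel B' = emeasure lborel ?B"
  proof -
    have "emeasure lborel B' = emeasure (distr lborel borel ((+) (t m))) B'"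
      by (subst lborel_distr_plus) simp
    also have "\<dots> = emeasure lborel ((+) (t m) -` B' \<inter> space lborel)"
      by (rule emeasure_distr) auto
    also have "(+) (t m) -` B' \<inter> space lborel = ?B"
      unfolding B'_def by auto
    finally show ?thesis .
  qed
  have "?A \<inter> B' = {}"
  proof (rule ccontr)
    assume "?A \<inter> B' \<noteq> {}"
    then obtain s where s: "s \<in> ?A" "s - t m \<in> ?B" unfolding B'_def by blast
    have 1: "\<bar>k (u m + s) - k (u m)\<bar> < e/2" using s(1) by auto
    have "\<bar>k (u m + t m + (s - t m)) - k (u m + t m)\<bar> < e/2" using s(2) by blast
    moreover have "u m + t m + (s - t m) = u m + s" by simp
    ultimately have "\<bar>k (u m + s) - k (u m + t m)\<bar> < e/2" by (simp only:)
    with 1 have "\<bar>k (u m + t m) - k (u m)\<bar> < e" by linarith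
    with ut[of m] show False by simp
  qed
  then have "emeasure lborel ?A + emeasure lborel B' = emeasure lborel (?A \<union> B')"
    by (intro plus_emeasure) auto
  also have "\<dots> \<le> emeasure lborel {0..3::real}"
    using t[of m] unfolding B'_def by (intro emeasure_mono) auto
  also have "\<dots> = ennreal (3/2) + ennreal (3/2)" by (simp flip: ennreal_plus)
  also have "\<dots> < emeasure lborel ?A + emeasure lborel B'"
    using A B unfolding eB by (intro add_strict_mono)
  finally show False by simp
qed

text \<open>Potter's bound in logarithmic form: in the variable \<open>ln x\<close> the uniform
  estimate costs at most \<open>e\<close> per unit step, and chaining the steps gives an error
  linear in the logarithmic distance.\<close>

lemma slowly_varying_ln_diff_bound:
  fixes a :: "real \<Rightarrow> real"
  assumes a: "slowly_varying a" and e: "e > 0"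
  shows "\<exists>X0\<ge>1. \<forall>x\<ge>X0. \<forall>w\<ge>X0. \<bar>ln (a w) - ln (a x)\<bar> \<le> e * (1 + \<bar>ln w - ln x\<bar>)"
proof -
  obtain U where U: "\<And>u t. u \<ge> U \<Longrightarrow> 0 \<le> t \<Longrightarrow> t \<le> 1 \<Longrightarrow> \<bar>ln (a (exp (u + t))) - ln (a (exp u))\<bar> < e"
    using slowly_varying_ln_uniform[OF a e] by force
  have N: "\<bar>ln (a (exp (u + real n))) - ln (a (exp u))\<bar> \<le> real n * e" if "u \<ge> U" for u n
  proof (induction n)
    case (Suc n)
    have "\<bar>ln (a (exp (u + real n + 1))) - ln (a (exp (u + real n)))\<bar> < e"
      using that by (intro U) auto
    with Suc show ?case by (simp add: algebra_simps)
  qed simp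
  have T: "\<bar>ln (a (exp (u + t))) - ln (a (exp u))\<bar> \<le> e * (1 + t)" if "u \<ge> U" "t \<ge> 0" for u t
  proof -
    define n where "n = nat \<lfloor>t\<rfloor>"
    have n: "real n \<le> t" "t \<le> real n + 1" using that unfolding n_def by linarith+
    have "\<bar>ln (a (exp (u + real n + (t - real n)))) - ln (a (exp (u + real n)))\<bar> < e"
      using that n by (intro U) auto
    with N[OF that(1), of n] have "\<bar>ln (a (exp (u + t))) - ln (a (exp u))\<bar> \<le> real n * e + e" by simp
    also have "\<dots> \<le> t * e + e" using n e by simp
    finally show ?thesis by (simp add: algebra_simps)
  qed
  have W: "\<bar>ln (a w) - ln (a x)\<bar> \<le> e * (1 + (ln w - ln x))" if "x \<ge> exp (max U 0)" "w \<ge> x" for x w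
  proof -
    have pos: "x > 0" "w > 0" using that exp_gt_zero[of "max U 0"] by linarith+
    have "ln (exp (max U 0)) \<le> ln x" using that pos by (subst ln_le_cancel_iff) auto
    then have "ln x \<ge> U" by simp
    moreover have "ln w - ln x \<ge> 0" using that pos by simp
    ultimately show ?thesis using T[of "ln x" "ln w - ln x"] pos by simp
  qed
  show ?thesis
  \<comment> \<open>The maximum with 0 makes the threshold at least 1.\<close>
  proof (intro exI[of _ "exp (max U 0)"] conjI allI impI)
    fix x w assume xw: "x \<ge> exp (max U 0)" "w \<ge> exp (max U 0)"
    have pos: "x > 0" "w > 0" using xw exp_gt_zero[of "max U 0"] by linarith+
    show "\<bar>ln (a w) - ln (a x)\<bar> \<le> e * (1 + \<bar>ln w - ln x\<bar>)"
    proof (cases "w \<ge> x")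
      case True
      then have "ln w \<ge> ln x" using pos by simp
      with W[OF xw(1) True] show ?thesis by simp
    next
      case False
      then have "ln w \<le> ln x" using pos by simp
      with W[OF xw(2), of x] False show ?thesis by (simp add: abs_minus_commute)
    qed
  qed simp
qed

section \<open>Regular variation and polynomial bounds\<close>

lemma regularly_varying_ln_diff_bound:
  fixes a :: "real \<Rightarrow> real" and p :: real
  assumes a: "slowly_varying a" and e: "e > 0"
  defines "R \<equiv> \<lambda>x. a x * x powr p"
  shows "\<exists>X0\<ge>1. \<forall>x\<ge>X0. \<forall>w\<ge>X0. \<bar>ln (R w) - ln (R x) - p * (ln w - ln x)\<bar> \<le> e * (1 + \<bar>ln w - ln x\<bar>)"
proof -
  obtain X0 where X0: "X0 \<ge> 1" and
    b: "\<And>x w. x \<ge> X0 \<Longrightarrow> w \<ge> X0 \<Longrightarrow> \<bar>ln (a w) - ln (a x)\<bar> \<le> e * (1 + \<bar>ln w - ln x\<bar>)"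
    using slowly_varying_ln_diff_bound[OF a e] by blast
  have lnR: "ln (R x) = ln (a x) + p * ln x" if "x \<ge> X0" for x
  proof -
    have "x > 0" "a x > 0" using that X0 a by (auto simp: slowly_varying_def)
    then show ?thesis unfolding R_def by (simp add: ln_mult ln_powr)
  qed
  show ?thesis
    using b X0 by (intro exI[of _ X0]) (auto simp: lnR algebra_simps)
qed

lemma regularly_varying_power_bounds:
  fixes a :: "real \<Rightarrow> real"
  assumes a: "slowly_varying a" and e: "e > 0"
  shows "\<exists>c>0. \<exists>C>0. \<forall>\<^sub>F x in at_top. c * x powr (p - e) \<le> a x * x powr p \<and> a x * x powr p \<le> C * x powr (p + e)"
proof -
  define R where "R = (\<lambda>x. a x * x powr p)"
  obtain X0 where X0: "X0 \<ge> 1" and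
    b: "\<And>x w. x \<ge> X0 \<Longrightarrow> w \<ge> X0 \<Longrightarrow> \<bar>ln (R w) - ln (R x) - p * (ln w - ln x)\<bar> \<le> e * (1 + \<bar>ln w - ln x\<bar>)"
    using regularly_varying_ln_diff_bound[OF a e, of p] unfolding R_def by blast
  define k where "k = ln (R X0) - p * ln X0"
  show ?thesis
  \<comment> \<open>The two constants gather the terms free of \<open>ln x\<close> in Potter's bound
    between the fixed point \<open>X0\<close> and \<open>x\<close>.\<close>
  proof (rule exI[of _ "exp (k - e + e * ln X0)"], intro conjI, simp, rule exI[of _ "exp (k + e - e * ln X0)"], intro conjI, simp)
    show "\<forall>\<^sub>F x in at_top. exp (k - e + e * ln X0) * x powr (p - e) \<le> a x * x powr p \<and>
       a x * x powr p \<le> exp (k + e - e * ln X0) * x powr (p + e)"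
      using eventually_ge_at_top[of X0]
    proof eventually_elim
      case (elim x)
      have pos: "x > 0" "a x > 0" using elim X0 a by (auto simp: slowly_varying_def)
      have "ln x \<ge> ln X0" using elim X0 by simp
      then have "\<bar>ln (R x) - p * ln x - k\<bar> \<le> e * (1 + (ln x - ln X0))"
        using b[of X0 x] elim unfolding k_def by (simp add: algebra_simps)
      then have 1: "k - e + e * ln X0 + (p - e) * ln x \<le> ln (R x)" "ln (R x) \<le> k + e - e * ln X0 + (p + e) * ln x"
        by (auto simp: abs_le_iff algebra_simps)
      have R: "R x = exp (ln (R x))" using pos by (simp add: R_def)
      have "exp (k - e + e * ln X0) * x powr (p - e) \<le> R x"
        using pos 1 by (subst R) (simp add: powr_def flip: exp_add)
      moreover have "R x \<le> exp (k + e - e * ln X0) * x powr (p + e)"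
        using pos 1 by (subst R) (simp add: powr_def flip: exp_add)
      ultimately show ?case by (simp add: R_def)
    qed
  qed
qed

lemma tendsto_powr_neg_at_top: "r < 0 \<Longrightarrow> ((\<lambda>x::real. x powr r) \<longlongrightarrow> 0) at_top"
  by (intro tendsto_neg_powr filterlim_ident)

lemma regularly_varying_quotient_tendsto_0:
  fixes a b :: "real \<Rightarrow> real"
  assumes a: "slowly_varying a" and b: "slowly_varying b" and pq: "p < q"
  shows "((\<lambda>x. (b x * x powr p) / (a x * x powr q)) \<longlongrightarrow> 0) at_top"
proof -
  \<comment> \<open>Each of the two slowly varying factors may cost an exponent \<open>e\<close>, so
    half of the gap survives.\<close>
  define e where "e = (q - p) / 4"
  have e: "e > 0" using pq by (simp add: e_def)
  obtain c where c: "c > 0" "\<forall>\<^sub>F x in at_top. c * x powr (q - e) \<le> a x * x powr q"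
    using regularly_varying_power_bounds[OF a e, of q] by (auto simp: eventually_conj_iff)
  obtain C where C: "C > 0" "\<forall>\<^sub>F x in at_top. b x * x powr p \<le> C * x powr (p + e)"
    using regularly_varying_power_bounds[OF b e, of p] by (auto simp: eventually_conj_iff)
  show ?thesis
  proof (rule tendsto_sandwich)
    show "\<forall>\<^sub>F x in at_top. 0 \<le> (b x * x powr p) / (a x * x powr q)"
      using eventually_gt_at_top[of 0]
      by eventually_elim (use a b in \<open>auto simp: slowly_varying_def less_imp_le\<close>)
    show "\<forall>\<^sub>F x in at_top. (b x * x powr p) / (a x * x powr q) \<le> C / c * x powr (- (q - p) / 2)"
      using eventually_gt_at_top[of 0] c(2) C(2)
    proof eventually_elim
      case (elim x)
      have "(b x * x powr p) / (a x * x powr q) \<le> (C * x powr (p + e)) / (c * x powr (q - e))"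
        using elim c C a b by (intro frac_le) (auto simp: slowly_varying_def less_imp_le)
      also have "\<dots> = C / c * x powr ((p + e) - (q - e))"
        by (simp only: powr_diff) simp
      also have "(p + e) - (q - e) = - (q - p) / 2" by (simp add: e_def field_simps)
      finally show ?case .
    qed
    show "((\<lambda>x. C / c * x powr (- (q - p) / 2)) \<longlongrightarrow> 0) at_top"
      using pq by (intro tendsto_mult_right_zero tendsto_powr_neg_at_top) auto
  qed simp
qed

section \<open>Polynomial bounds valid at every state\<close>

text \<open>No constant appears because the base is at least 2, so that a larger exponent absorbs
  any constant. The bounds concern all states, since the paths also visit those outside the
  asymptotic range of the rates.\<close>

definition poly_above :: "(nat \<Rightarrow> real) \<Rightarrow> bool" where
  "poly_above q \<longleftrightarrow> (\<exists>k::nat. \<forall>x. q x \<le> (real x + 2) ^ k)"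

definition poly_below :: "(nat \<Rightarrow> real) \<Rightarrow> bool" where
  "poly_below q \<longleftrightarrow> (\<exists>k::nat. \<forall>x. 1 / (real x + 2) ^ k \<le> q x)"

text \<open>The constant and the finitely many exceptional states are absorbed in \<open>D\<close>,
  and \<open>D\<close> in a power of 2. The shift \<open>d\<close> serves rates evaluated at a later
  state, such as \<open>mu (Suc x)\<close>.\<close>

lemma poly_above_eventually:
  assumes "\<forall>\<^sub>F x in sequentially. q x \<le> C * real (x + d) powr p" and d: "d \<le> 2"
  shows "poly_above q"
proof -
  obtain N where N: "\<And>x. x \<ge> N \<Longrightarrow> q x \<le> C * real (x + d) powr p"
    using assms(1) by (auto simp: eventually_sequentially)
  define D where "D = \<bar>C\<bar> + (\<Sum>x<N. \<bar>q x\<bar>)"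
  have D: "D \<ge> 0" unfolding D_def by (simp add: sum_nonneg)
  obtain j :: nat where j: "D < 2 ^ j" using real_arch_pow[of 2 D] by auto
  obtain i :: nat where i: "p \<le> real i" using real_arch_simple by blast
  have "q x \<le> (real x + 2) ^ (j + i)" for x
  proof -
    have one: "(real x + 2) ^ i \<ge> 1" by simp
    have "q x \<le> D * (real x + 2) ^ i"
    proof (cases "x < N")
      case True
      have "q x \<le> \<bar>q x\<bar>" by simp
      also have "\<dots> \<le> (\<Sum>x<N. \<bar>q x\<bar>)" using True by (intro member_le_sum) auto
      also have "\<dots> \<le> D" by (simp add: D_def)
      also have "\<dots> \<le> D * (real x + 2) ^ i" using mult_left_mono[OF one D] by simp
      finally show ?thesis .
    next
      case False
      have "q x \<le> C * real (x + d) powr p" using False N by simp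
      also have "\<dots> \<le> D * (real x + 2) ^ i"
      proof (rule mult_mono)
        show "C \<le> D" unfolding D_def by (rule order_trans[OF abs_ge_self]) (simp add: sum_nonneg)
        show "real (x + d) powr p \<le> (real x + 2) ^ i"
        \<comment> \<open>\<open>0 powr p\<close> is 0; any other base is at least 1, so raising the
          exponent to \<open>i\<close> only increases the power.\<close>
        proof (cases "x + d = 0")
          case False
          then have "real (x + d) powr p \<le> real (x + d) powr real i" using i by (intro powr_mono) linarith+
          also have "\<dots> \<le> (real x + 2) powr real i" using d by (intro powr_mono2) auto
          finally show ?thesis by (simp add: powr_realpow)
        qed simp
      qed (use D in auto)
      finally show ?thesis .
    qed
    also have "\<dots> \<le> (real x + 2) ^ j * (real x + 2) ^ i"
    proof (rule mult_right_mono)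
      have "(2::real) ^ j \<le> (real x + 2) ^ j" by (rule power_mono) auto
      then show "D \<le> (real x + 2) ^ j" using j by linarith
    qed simp
    finally show ?thesis by (simp add: power_add)
  qed
  then show ?thesis unfolding poly_above_def by blast
qed

lemma poly_below_iff_inverse:
  assumes "\<And>x. q x > 0"
  shows "poly_below q \<longleftrightarrow> poly_above (\<lambda>x. 1 / q x)"
  unfolding poly_below_def poly_above_def using assms
  by (simp add: divide_le_eq pos_divide_le_eq mult.commute)

lemma poly_above_add:
  assumes "poly_above p" "poly_above q"
  shows "poly_above (\<lambda>x. p x + q x)"
proof -
  obtain i j where i: "\<And>x. p x \<le> (real x + 2) ^ i" and j: "\<And>x. q x \<le> (real x + 2) ^ j"
    using assms unfolding poly_above_def by blast
  have "p x + q x \<le> (real x + 2) ^ Suc (i + j)" for x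
  proof -
    have "(real x + 2) ^ i \<le> (real x + 2) ^ (i + j)" "(real x + 2) ^ j \<le> (real x + 2) ^ (i + j)"
      by (intro power_increasing; simp)+
    then have "p x + q x \<le> 2 * (real x + 2) ^ (i + j)" using i[of x] j[of x] by linarith
    also have "\<dots> \<le> (real x + 2) * (real x + 2) ^ (i + j)" by (intro mult_right_mono) auto
    finally show ?thesis by simp
  qed
  then show ?thesis unfolding poly_above_def by blast
qed

lemma poly_below_divide:
  assumes "poly_below p" "poly_above q" "\<And>x. q x > 0"
  shows "poly_below (\<lambda>x. p x / q x)"
proof -
  obtain i j where i: "\<And>x. 1 / (real x + 2) ^ i \<le> p x" and j: "\<And>x. q x \<le> (real x + 2) ^ j"
    using assms unfolding poly_above_def poly_below_def by blast
  have "1 / (real x + 2) ^ (i + j) \<le> p x / q x" for x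
  proof -
    have "1 / (real x + 2) ^ (i + j) = (1 / (real x + 2) ^ i) / (real x + 2) ^ j"
      by (simp add: power_add)
    also have "\<dots> \<le> p x / q x"
      using i[of x] j[of x] assms(3)[of x] by (intro frac_le) (auto intro: order_trans[rotated])
    finally show ?thesis .
  qed
  then show ?thesis unfolding poly_below_def by blast
qed

lemma poly_below_sqrt:
  assumes "poly_below p"
  shows "poly_below (\<lambda>x. sqrt (p x))"
proof -
  obtain i where i: "\<And>x. 1 / (real x + 2) ^ i \<le> p x"
    using assms unfolding poly_below_def by blast
  have "1 / (real x + 2) ^ i \<le> sqrt (p x)" for x
  proof -
    \<comment> \<open>The lower bound is at most 1 and so dominates its own square; the exponent
      \<open>i\<close> serves for the root as well.\<close>
    have "(1 / (real x + 2) ^ i)\<^sup>2 \<le> 1 / (real x + 2) ^ i"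
      unfolding power2_eq_square by (rule mult_left_le) (auto simp: divide_le_eq)
    also have "\<dots> \<le> p x" by (rule i)
    finally show ?thesis by (rule real_le_rsqrt)
  qed
  then show ?thesis unfolding poly_below_def by blast
qed

lemma poly_below_mono: "poly_below p \<Longrightarrow> (\<And>x. p x \<le> q x) \<Longrightarrow> poly_below q"
  unfolding poly_below_def by (meson order_trans)

text \<open>For states up to C \<rho> and large \<rho> one has x + 2 \<le> \<rho> * \<rho>, so twice
  the original exponent works whatever \<open>C\<close> is. Allowing every larger \<open>k\<close>
  lets several bounds share one exponent.\<close>

lemma poly_below_le_scale:
  assumes "poly_below q"
  shows "\<exists>K. \<forall>k\<ge>K. \<forall>C. \<forall>\<^sub>F \<rho> in at_top. \<forall>x. real x \<le> C * \<rho> \<longrightarrow> 1 / \<rho> ^ k \<le> q x"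
proof -
  obtain i where i: "\<And>x. 1 / (real x + 2) ^ i \<le> q x"
    using assms unfolding poly_below_def by blast
  show ?thesis
  proof (intro exI[of _ "2 * i"] allI impI)
    fix k C assume k: "2 * i \<le> k"
    show "\<forall>\<^sub>F \<rho> in at_top. \<forall>x. real x \<le> C * \<rho> \<longrightarrow> 1 / \<rho> ^ k \<le> q x"
      using eventually_ge_at_top[of 1] eventually_ge_at_top[of "C + 2"]
    proof eventually_elim
      case (elim \<rho>)
      show ?case
      proof (intro allI impI)
        fix x :: nat assume x: "real x \<le> C * \<rho>"
        have "real x + 2 \<le> C * \<rho> + 2 * \<rho>" using x elim by linarith
        also have "\<dots> = (C + 2) * \<rho>" by (simp add: algebra_simps)
        also have "\<dots> \<le> \<rho> * \<rho>" using elim by (intro mult_right_mono) auto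
        finally have "(real x + 2) ^ i \<le> (\<rho> * \<rho>) ^ i" by (intro power_mono) auto
        also have "\<dots> = \<rho> ^ (2 * i)" by (simp add: power_mult power2_eq_square)
        also have "\<dots> \<le> \<rho> ^ k" using elim k by (intro power_increasing) auto
        finally have "1 / \<rho> ^ k \<le> 1 / (real x + 2) ^ i"
          using elim by (intro divide_left_mono) auto
        with i[of x] show "1 / \<rho> ^ k \<le> q x" by linarith
      qed
    qed
  qed
qed

section \<open>Asymptotics of the rates\<close>

locale birth_death_rates =
  fixes lam mu :: "nat \<Rightarrow> real" and l m :: real and y z Y Z V :: "real \<Rightarrow> real"
  assumes lam_pos: "\<And>x. lam x > 0"
    and mu_pos: "\<And>x. x > 0 \<Longrightarrow> mu x > 0"
    and mu_0: "mu 0 = 0"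
    and exponents: "l \<ge> 0" "m \<ge> 0" "l \<noteq> m"
    and slow: "slowly_varying y" "slowly_varying z"
    and Y_def: "\<And>x. x > 0 \<Longrightarrow> Y x = y x * x powr l"
    and Z_def: "\<And>x. x > 0 \<Longrightarrow> Z x = z x * x powr m"
    and V_def: "\<And>x. x > 0 \<Longrightarrow> V x = max (Y x) (Z x)"
    and lam_lim: "(\<lambda>x::nat. lam x / Y (real x)) \<longlonglongrightarrow> 1"
    and mu_lim: "(\<lambda>x::nat. mu x / Z (real x)) \<longlonglongrightarrow> 1"
begin

lemma rate_power_bounds:
  fixes a R :: "real \<Rightarrow> real" and r :: "nat \<Rightarrow> real"
  assumes a: "slowly_varying a" and R: "\<And>x. x > 0 \<Longrightarrow> R x = a x * x powr p"
    and r: "(\<lambda>x::nat. r x / R (real x)) \<longlonglongrightarrow> 1" and e: "e > 0"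
  shows "\<exists>c>0. \<exists>C>0. \<forall>\<^sub>F x in sequentially. c * real x powr (p - e) \<le> r x \<and> r x \<le> C * real x powr (p + e)"
proof -
  obtain c C where c: "c > 0" "C > 0"
    and cC: "\<forall>\<^sub>F x in at_top. c * x powr (p - e) \<le> a x * x powr p \<and> a x * x powr p \<le> C * x powr (p + e)"
    using regularly_varying_power_bounds[OF a e, of p] by blast
  have "\<forall>\<^sub>F x in sequentially. r x / R (real x) > 1/2" "\<forall>\<^sub>F x in sequentially. r x / R (real x) < 2"
    using order_tendstoD(1)[OF r, of "1/2"] order_tendstoD(2)[OF r, of 2] by simp_all
  then have "\<forall>\<^sub>F x in sequentially. c / 2 * real x powr (p - e) \<le> r x \<and> r x \<le> 2 * C * real x powr (p + e)"
    using eventually_gt_at_top[of 0] eventually_compose_filterlim[OF cC filterlim_real_sequentially]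
  proof eventually_elim
    case (elim x)
    have pos: "R (real x) > 0" using elim a by (simp add: R slowly_varying_def)
    have "r x > R (real x) / 2" "r x < 2 * R (real x)"
      using elim pos by (auto simp: field_simps)
    moreover have "c * real x powr (p - e) \<le> R (real x)" "R (real x) \<le> C * real x powr (p + e)"
      using elim by (auto simp: R)
    ultimately show ?case by linarith
  qed
  then show ?thesis using c by (intro exI[of _ "c / 2"] exI[of _ "2 * C"] conjI) auto
qed

text \<open>The lower bound is an upper bound for the reciprocal, which needs positivity at every
  state; the shift \<open>d\<close> provides it for death rates.\<close>

lemma poly_bounds_Suc:
  fixes a R :: "real \<Rightarrow> real" and r :: "nat \<Rightarrow> real"
  assumes a: "slowly_varying a" and R: "\<And>x. x > 0 \<Longrightarrow> R x = a x * x powr p"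
    and r: "(\<lambda>x::nat. r x / R (real x)) \<longlonglongrightarrow> 1" and pos: "\<And>x. r (x + d) > 0" and d: "d \<le> 2"
  shows "poly_above (\<lambda>x. r (x + d))" "poly_below (\<lambda>x. r (x + d))"
proof -
  obtain c C where c: "c > 0"
    and ev: "\<forall>\<^sub>F x in sequentially. c * real x powr (p - 1) \<le> r x \<and> r x \<le> C * real x powr (p + 1)"
    using rate_power_bounds[OF a R r, of 1] by auto
  have ev': "\<forall>\<^sub>F x in sequentially. c * real (x + d) powr (p - 1) \<le> r (x + d) \<and> r (x + d) \<le> C * real (x + d) powr (p + 1)"
    using ev by (subst eventually_sequentially_seg)
  show "poly_above (\<lambda>x. r (x + d))"
    by (rule poly_above_eventually[OF _ d]) (use ev' in \<open>auto elim: eventually_mono\<close>)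
  show "poly_below (\<lambda>x. r (x + d))"
    unfolding poly_below_iff_inverse[of "\<lambda>x. r (x + d)", OF pos]
  proof (rule poly_above_eventually[OF _ d])
    show "\<forall>\<^sub>F x in sequentially. 1 / r (x + d) \<le> 1 / c * real (x + d) powr (- (p - 1))"
      using ev' eventually_gt_at_top[of 0]
    proof eventually_elim
      case (elim x)
      have "1 / r (x + d) \<le> 1 / (c * real (x + d) powr (p - 1))"
        using elim c by (intro divide_left_mono mult_pos_pos pos) auto
      also have "\<dots> = 1 / c * real (x + d) powr (- (p - 1))"
        by (subst powr_minus) (simp add: divide_simps)
      finally show ?case .
    qed
  qed
qed

lemma poly_lam: "poly_above lam" "poly_below lam"
  using poly_bounds_Suc[OF slow(1) Y_def lam_lim, of 0] lam_pos by auto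

lemma poly_mu_Suc: "poly_above (\<lambda>x. mu (Suc x))" "poly_below (\<lambda>x. mu (Suc x))"
  using poly_bounds_Suc[OF slow(2) Z_def mu_lim, of 1] mu_pos by auto

text \<open>\<open>poly_bounds_Suc\<close> without shift asks for positive rates, and
  \<open>mu 0 = 0\<close>; the upper bound is derived directly.\<close>

lemma poly_above_mu: "poly_above mu"
proof -
  obtain C where "\<forall>\<^sub>F x in sequentially. mu x \<le> C * real x powr (m + 1)"
    using rate_power_bounds[OF slow(2) Z_def mu_lim, of 1] by (auto simp: eventually_conj_iff)
  then show ?thesis by (intro poly_above_eventually[of _ C 0 "m + 1"]) auto
qed

lemma mu_nonneg: "mu x \<ge> 0"
  using mu_pos[of x] mu_0 by (cases "x = 0") auto

lemma total_pos: "lam x + mu x > 0"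
  using lam_pos[of x] mu_nonneg[of x] by simp

lemma poly_total: "poly_above (\<lambda>x. lam x + mu x)" "poly_below (\<lambda>x. lam x + mu x)"
  using poly_above_add[OF poly_lam(1) poly_above_mu] poly_below_mono[OF poly_lam(2)] mu_nonneg by auto

lemma poly_below_up: "poly_below (\<lambda>x. lam x / (lam x + mu x))"
  by (rule poly_below_divide[OF poly_lam(2) poly_total(1) total_pos])

text \<open>Downward steps are indexed by their target state, because no positive lower bound holds
  for a step down from 0.\<close>

lemma poly_below_down: "poly_below (\<lambda>x. mu (Suc x) / (lam (Suc x) + mu (Suc x)))"
proof (rule poly_below_divide[OF poly_mu_Suc(2)])
  have "poly_above (\<lambda>x. lam (Suc x))"
    using poly_bounds_Suc[OF slow(1) Y_def lam_lim, of 1] lam_pos by auto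
  then show "poly_above (\<lambda>x. lam (Suc x) + mu (Suc x))"
    by (rule poly_above_add[OF _ poly_mu_Suc(1)])
qed (rule total_pos)

lemma poly_below_ratio: "poly_below (\<lambda>x. sqrt (mu (Suc x) / lam x))"
  by (intro poly_below_sqrt poly_below_divide poly_mu_Suc poly_lam lam_pos)

text \<open>The exponents differ, so the smaller rate is negligible against the larger one. From
  here on both orders of \<open>l\<close> and \<open>m\<close> are handled through one slowly
  varying function.\<close>

lemma dominating_rate:
  "\<exists>a. slowly_varying a \<and> (\<forall>\<^sub>F x in at_top. V x = a x * x powr (max l m)) \<and>
     (\<lambda>x. (lam x + mu x) / (a (real x) * real x powr (max l m))) \<longlonglongrightarrow> 1"
proof -
  have aux: "\<exists>a. slowly_varying a \<and> (\<forall>\<^sub>F x in at_top. max (b x * x powr p) (d x * x powr q) = a x * x powr (max p q)) \<and>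
     (\<lambda>x. (r x + s x) / (a (real x) * real x powr (max p q))) \<longlonglongrightarrow> 1"
    if pq: "p < q" and b: "slowly_varying b" and d: "slowly_varying d"
      and r: "(\<lambda>x::nat. r x / (b (real x) * real x powr p)) \<longlonglongrightarrow> 1"
      and s: "(\<lambda>x::nat. s x / (d (real x) * real x powr q)) \<longlonglongrightarrow> 1"
    for p q :: real and b d and r s :: "nat \<Rightarrow> real"
  proof (intro exI[of _ d] conjI d)
    note q0 = regularly_varying_quotient_tendsto_0[OF d b pq]
    have "\<forall>\<^sub>F x in at_top. (b x * x powr p) / (d x * x powr q) < 1"
      using order_tendstoD(2)[OF q0, of 1] by simp
    then show "\<forall>\<^sub>F x in at_top. max (b x * x powr p) (d x * x powr q) = d x * x powr (max p q)"
      using eventually_gt_at_top[of 0]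
    proof eventually_elim
      case (elim x)
      have "d x * x powr q > 0" using elim d by (simp add: slowly_varying_def)
      then show ?case using elim pq by (simp add: max_def)
    qed
    \<comment> \<open>The smaller rate is compared with its own asymptotic form, and that form with
      the dominating one.\<close>
    have "(\<lambda>x. r x / (b (real x) * real x powr p) * ((b (real x) * real x powr p) / (d (real x) * real x powr q)) +
       s x / (d (real x) * real x powr q)) \<longlonglongrightarrow> 1 * 0 + 1"
      by (intro tendsto_add tendsto_mult r s filterlim_compose[OF q0 filterlim_real_sequentially])
    moreover have "\<forall>\<^sub>F x in sequentially. r x / (b (real x) * real x powr p) * ((b (real x) * real x powr p) / (d (real x) * real x powr q)) +
       s x / (d (real x) * real x powr q) = (r x + s x) / (d (real x) * real x powr (max p q))"
      using eventually_gt_at_top[of 0]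
    proof eventually_elim
      case (elim x)
      have "b (real x) > 0" using elim b by (simp add: slowly_varying_def)
      then show ?case using elim pq by (simp add: max_def add_divide_distrib)
    qed
    ultimately show "(\<lambda>x. (r x + s x) / (d (real x) * real x powr (max p q))) \<longlonglongrightarrow> 1"
      by (simp add: tendsto_cong)
  qed
  have lam': "(\<lambda>x::nat. lam x / (y (real x) * real x powr l)) \<longlonglongrightarrow> 1"
    using lam_lim by (rule Lim_transform_eventually) (auto simp: Y_def intro!: eventually_mono[OF eventually_gt_at_top[of 0]])
  have mu': "(\<lambda>x::nat. mu x / (z (real x) * real x powr m)) \<longlonglongrightarrow> 1"
    using mu_lim by (rule Lim_transform_eventually) (auto simp: Z_def intro!: eventually_mono[OF eventually_gt_at_top[of 0]])
  have V: "\<forall>\<^sub>F x in at_top. V x = max (y x * x powr l) (z x * x powr m)"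
    using eventually_gt_at_top[of 0] by eventually_elim (simp add: V_def Y_def Z_def)
  show ?thesis
  proof (cases "l < m")
    case True
    from aux[OF True slow lam' mu'] obtain a where a: "slowly_varying a"
      "\<forall>\<^sub>F x in at_top. max (y x * x powr l) (z x * x powr m) = a x * x powr (max l m)"
      "(\<lambda>x. (lam x + mu x) / (a (real x) * real x powr (max l m))) \<longlonglongrightarrow> 1" by blast
    have "\<forall>\<^sub>F x in at_top. V x = a x * x powr (max l m)"
      using V a(2) by eventually_elim simp
    with a show ?thesis by blast
  next
    case False
    with exponents have "m < l" by simp
    from aux[OF this slow(2,1) mu' lam'] obtain a where a: "slowly_varying a"
      "\<forall>\<^sub>F x in at_top. max (z x * x powr m) (y x * x powr l) = a x * x powr (max m l)"
      "(\<lambda>x. (mu x + lam x) / (a (real x) * real x powr (max m l))) \<longlonglongrightarrow> 1" by blast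
    have "\<forall>\<^sub>F x in at_top. V x = a x * x powr (max l m)"
      using V a(2) by eventually_elim (simp add: max.commute)
    with a show ?thesis by (auto simp: max.commute add.commute)
  qed
qed

lemma max_exponent_pos: "max l m > 0"
  using exponents by auto

lemma V_pos: "x > 0 \<Longrightarrow> V x > 0"
  using slow by (simp add: V_def Y_def slowly_varying_def less_max_iff_disj)

lemma V_power_bounds:
  assumes "e > 0"
  shows "\<exists>c>0. \<exists>C>0. \<forall>\<^sub>F x in at_top. c * x powr (max l m - e) \<le> V x \<and> V x \<le> C * x powr (max l m + e)"
proof -
  obtain a where a: "slowly_varying a" and V: "\<forall>\<^sub>F x in at_top. V x = a x * x powr (max l m)"
    using dominating_rate by blast
  obtain c C where c: "c > 0" "C > 0" and
    ev: "\<forall>\<^sub>F x in at_top. c * x powr (max l m - e) \<le> a x * x powr (max l m) \<and> a x * x powr (max l m) \<le> C * x powr (max l m + e)"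
    using regularly_varying_power_bounds[OF a assms] by blast
  have "\<forall>\<^sub>F x in at_top. c * x powr (max l m - e) \<le> V x \<and> V x \<le> C * x powr (max l m + e)"
    using V ev by eventually_elim simp
  with c show ?thesis by blast
qed

lemma V_at_top: "filterlim V at_top at_top"
proof -
  let ?v = "max l m"
  obtain c where c: "c > 0" and ev: "\<forall>\<^sub>F x in at_top. c * x powr (?v - ?v / 2) \<le> V x"
    using V_power_bounds[of "?v / 2"] max_exponent_pos by (auto simp: eventually_conj_iff)
  have "filterlim (\<lambda>x. c * x powr (?v - ?v / 2)) at_top at_top"
    using c max_exponent_pos by real_asymp
  then show ?thesis by (rule filterlim_at_top_mono) (rule ev)
qed

text \<open>Potter's bound with error 1 leaves a constant \<open>C\<close>, which one further factor
  \<rho> absorbs.\<close>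

lemma V_le_power: "\<exists>K. \<forall>k\<ge>K. \<forall>\<^sub>F \<rho> in at_top. V \<rho> \<le> \<rho> ^ k"
proof -
  let ?v = "max l m"
  obtain C where C: "C > 0" and ev: "\<forall>\<^sub>F x in at_top. V x \<le> C * x powr (?v + 1)"
    using V_power_bounds[of 1] by (auto simp: eventually_conj_iff)
  obtain i :: nat where i: "?v + 2 \<le> real i" using real_arch_simple by blast
  show ?thesis
  proof (intro exI[of _ i] allI impI)
    fix k assume k: "i \<le> k"
    show "\<forall>\<^sub>F \<rho> in at_top. V \<rho> \<le> \<rho> ^ k"
      using ev eventually_ge_at_top[of 1] eventually_ge_at_top[of C]
    proof eventually_elim
      case (elim \<rho>)
      have "V \<rho> \<le> \<rho> * \<rho> powr (?v + 1)"
        using elim by (intro order_trans[OF elim(1)] mult_right_mono) auto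
      also have "\<dots> = \<rho> powr (?v + 2)" using elim by (simp add: powr_mult_base algebra_simps)
      also have "\<dots> \<le> \<rho> powr real k" using elim i k by (intro powr_mono) auto
      finally show ?case using elim by (simp add: powr_realpow)
    qed
  qed
qed

section \<open>Uniform comparison of the rates with V\<close>

text \<open>At \<open>x = 0\<close> the truncated \<open>x - 1\<close> is harmless:
  \<open>mu 0 = 0\<close> makes the second root vanish.\<close>

definition tilt :: "nat \<Rightarrow> real" where
  "tilt x = sqrt (lam x * mu (Suc x)) + sqrt (lam (x - 1) * mu x)"

lemma tilt_pos: "tilt x > 0"
  unfolding tilt_def using lam_pos mu_pos mu_nonneg
  by (intro add_pos_nonneg) (auto simp: less_imp_le)

text \<open>A geometric mean has exponent (l + m)/2, which is max l m - \<bar>l - m\<bar>/2. An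
  error \<open>e\<close> in each rate adds \<open>e\<close> to it after taking the root, so 3/8 of
  \<bar>l - m\<bar> remains; the claimed gap of 1/8 is what the lower power bound for
  \<open>V\<close> gives away in \<open>tilt_negligible\<close>.\<close>

lemma tilt_le: "\<exists>K>0. \<exists>s<max l m - \<bar>l - m\<bar> / 8. s > 0 \<and> (\<forall>x. tilt x \<le> K * (real x + 2) powr s)"
proof -
  define e where "e = \<bar>l - m\<bar> / 8"
  have e: "e > 0" using exponents by (simp add: e_def)
  \<comment> \<open>Turns eventual bounds into bounds at all states: the base
    \<open>real x + 1\<close> is at least 1, so the finitely many exceptions go into the
    constant.\<close>
  have bound: "\<exists>C>0. \<forall>x. r x \<le> C * (real x + 1) powr p"
    if ev: "\<forall>\<^sub>F x in sequentially. r x \<le> C * real x powr p" and "p \<ge> 0" "C > 0" for C p and r :: "nat \<Rightarrow> real"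
  proof -
    obtain N where N: "\<And>x. x \<ge> N \<Longrightarrow> r x \<le> C * real x powr p"
      using ev unfolding eventually_sequentially by blast
    define D where "D = C + (\<Sum>x<N. \<bar>r x\<bar>)"
    have s0: "(\<Sum>x<N. \<bar>r x\<bar>) \<ge> 0" by (simp add: sum_nonneg)
    have D: "D > 0" "C \<le> D" using \<open>C > 0\<close> s0 unfolding D_def by linarith+
    have "r x \<le> D * (real x + 1) powr p" for x
    proof (cases "x < N")
      case True
      have "r x \<le> \<bar>r x\<bar>" by simp
      also have "\<dots> \<le> (\<Sum>x<N. \<bar>r x\<bar>)" using True by (intro member_le_sum) auto
      also have "\<dots> \<le> D * 1" using that by (simp add: D_def)
      also have "\<dots> \<le> D * (real x + 1) powr p" using D that by (intro mult_left_mono ge_one_powr_ge_zero) auto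
      finally show ?thesis .
    next
      case False
      have "r x \<le> C * real x powr p" using N False by simp
      also have "\<dots> \<le> D * (real x + 1) powr p" using D that by (intro mult_mono powr_mono2) auto
      finally show ?thesis .
    qed
    then show ?thesis using D by blast
  qed
  obtain A where A: "A > 0" "\<And>x. lam x \<le> A * (real x + 1) powr (l + e)"
  proof -
    obtain C where "C > 0" "\<forall>\<^sub>F x in sequentially. lam x \<le> C * real x powr (l + e)"
      using rate_power_bounds[OF slow(1) Y_def lam_lim e] by (auto simp: eventually_conj_iff)
    then show ?thesis using bound[of lam C "l + e"] exponents e that by auto
  qed
  obtain B where B: "B > 0" "\<And>x. mu x \<le> B * (real x + 1) powr (m + e)"
  proof -
    obtain C where "C > 0" "\<forall>\<^sub>F x in sequentially. mu x \<le> C * real x powr (m + e)"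
      using rate_power_bounds[OF slow(2) Z_def mu_lim e] by (auto simp: eventually_conj_iff)
    then show ?thesis using bound[of mu C "m + e"] exponents e that by auto
  qed
  define s where "s = (l + m) / 2 + e"
  have prod: "sqrt (lam i * mu j) \<le> sqrt (A * B) * (real x + 2) powr s" if "i \<le> x + 1" "j \<le> x + 1" for i j x
  proof -
    have "lam i \<le> A * (real x + 2) powr (l + e)"
      using that exponents e A(1) by (intro order_trans[OF A(2)] mult_left_mono powr_mono2) auto
    moreover have "mu j \<le> B * (real x + 2) powr (m + e)"
      using that exponents e B(1) by (intro order_trans[OF B(2)] mult_left_mono powr_mono2) auto
    ultimately have "lam i * mu j \<le> (A * (real x + 2) powr (l + e)) * (B * (real x + 2) powr (m + e))"
      using A(1) mu_nonneg by (intro mult_mono) auto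
    also have "\<dots> = (A * B) * (real x + 2) powr (s + s)"
      by (simp add: s_def powr_add[symmetric] algebra_simps)
    also have "\<dots> = (A * B) * ((real x + 2) powr s)\<^sup>2"
      by (simp only: powr_add power2_eq_square)
    finally have "sqrt (lam i * mu j) \<le> sqrt ((A * B) * ((real x + 2) powr s)\<^sup>2)"
      by (rule real_sqrt_le_mono)
    then show ?thesis by (simp add: real_sqrt_mult)
  qed
  have "tilt x \<le> (2 * sqrt (A * B)) * (real x + 2) powr s" for x
  proof -
    have "sqrt (lam x * mu (Suc x)) \<le> sqrt (A * B) * (real x + 2) powr s"
      by (rule prod) auto
    moreover have "sqrt (lam (x - 1) * mu x) \<le> sqrt (A * B) * (real x + 2) powr s"
      by (rule prod) auto
    ultimately show ?thesis unfolding tilt_def by linarith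
  qed
  moreover have "s < max l m - \<bar>l - m\<bar> / 8" unfolding s_def e_def using exponents by (auto simp: max_def abs_if field_simps)
  moreover have "s > 0" unfolding s_def using exponents(1,2) e by (intro add_nonneg_pos) auto
  ultimately show ?thesis
    using A(1) B(1) by (intro exI[of _ "2 * sqrt (A * B)"] exI[of _ s] conjI) auto
qed

lemma tilt_negligible:
  assumes C: "C > 0" and d: "d > 0"
  shows "\<forall>\<^sub>F \<rho> in at_top. \<forall>x. real x \<le> C * \<rho> \<longrightarrow> tilt x \<le> d * V \<rho>"
proof -
  obtain K s where K: "K > 0" and s: "s > 0" "s < max l m - \<bar>l - m\<bar> / 8"
    and t: "\<And>x. tilt x \<le> K * (real x + 2) powr s"
    using tilt_le by blast
  \<comment> \<open>This is the exponent that the power bound guarantees for \<open>V\<close> from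
    below; it lies strictly above \<open>s\<close>.\<close>
  define q where "q = max l m - \<bar>l - m\<bar> / 8"
  have "\<bar>l - m\<bar> / 8 > 0" using exponents by simp
  then obtain c where c: "c > 0" and V: "\<forall>\<^sub>F x in at_top. c * x powr q \<le> V x"
    using V_power_bounds[of "\<bar>l - m\<bar> / 8"] unfolding q_def by (auto simp: eventually_conj_iff)
  have "((\<lambda>\<rho>. \<rho> powr (s - q)) \<longlongrightarrow> 0) at_top"
    using s by (intro tendsto_powr_neg_at_top) (simp add: q_def)
  then have "\<forall>\<^sub>F \<rho> in at_top. \<rho> powr (s - q) < d * c / (K * (C + 2) powr s)"
    by (rule order_tendstoD) (use d c K C in auto)
  then show ?thesis
    using V eventually_ge_at_top[of 1]
  proof eventually_elim
    case (elim \<rho>)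
    show ?case
    proof (intro allI impI)
      fix x :: nat assume x: "real x \<le> C * \<rho>"
      have "tilt x \<le> K * (real x + 2) powr s" by (rule t)
      also have "\<dots> \<le> K * ((C + 2) * \<rho>) powr s"
        using K s x elim C by (intro mult_left_mono powr_mono2) (auto simp: algebra_simps)
      also have "\<dots> = K * (C + 2) powr s * \<rho> powr (s - q) * \<rho> powr q"
        using elim C by (simp add: powr_mult powr_diff)
      also have "\<dots> \<le> d * c * \<rho> powr q"
      proof (rule mult_right_mono)
        show "K * (C + 2) powr s * \<rho> powr (s - q) \<le> d * c"
          using elim(1) K C by (simp add: field_simps)
      qed simp
      also have "\<dots> \<le> d * V \<rho>" using elim d by simp
      finally show "tilt x \<le> d * V \<rho>" .
    qed
  qed
qed

text \<open>With q = x / \<rho>, Potter's bound controls the relative error for q between \<kappa>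
  and \<open>C\<close>. For q up to \<kappa> the relative error is not controlled, but both terms
  are nonnegative and at most \<open>d * V \<rho>\<close>, which suffices for an additive
  error.\<close>

lemma total_uniform:
  assumes C: "C > 0" and d: "d > 0"
  shows "\<forall>\<^sub>F \<rho> in at_top. \<forall>x. real x \<le> C * \<rho> \<longrightarrow>
    \<bar>lam x + mu x - V \<rho> * (real x / \<rho>) powr (max l m)\<bar> \<le> d * V \<rho>"
proof -
  define v where "v = max l m"
  have v: "v > 0" using max_exponent_pos by (simp add: v_def)
  obtain a where a: "slowly_varying a" and V: "\<forall>\<^sub>F x in at_top. V x = a x * x powr v"
    and lim: "(\<lambda>x. (lam x + mu x) / (a (real x) * real x powr v)) \<longlonglongrightarrow> 1"
    using dominating_rate unfolding v_def by blast
  define R where "R = (\<lambda>x. a x * x powr v)"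
  have R_pos: "R x > 0" if "x > 0" for x
    using a that by (simp add: R_def slowly_varying_def)
  \<comment> \<open>The exponent is v/2 rather than v because Potter's error may consume half of the
    power of q.\<close>
  define \<kappa> where "\<kappa> = min 1 ((d / 16) powr (2 / v))"
  have \<kappa>: "\<kappa> > 0" "\<kappa> \<le> 1" using d by (auto simp: \<kappa>_def)
  have \<kappa>_small: "\<kappa> powr (v / 2) \<le> d / 16"
  proof -
    have "\<kappa> powr (v / 2) \<le> ((d / 16) powr (2 / v)) powr (v / 2)"
      using \<kappa> v by (intro powr_mono2) (auto simp: \<kappa>_def)
    also have "\<dots> = d / 16" using v d by (simp add: powr_powr)
    finally show ?thesis .
  qed
  \<comment> \<open>\<open>L\<close> bounds 1 + \<bar>ln q\<bar> for q between \<kappa> and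
    \<open>C\<close>; \<open>b\<close> below bounds \<open>q powr v\<close> there.\<close>
  define L where "L = 1 + \<bar>ln \<kappa>\<bar> + \<bar>ln C\<bar>"
  have L: "L \<ge> 1" by (simp add: L_def)
  define b where "b = max 1 (C powr v)"
  have b: "b \<ge> 1" by (simp add: b_def)
  define \<theta> where "\<theta> = min 1 (ln (1 + d / (4 * b)))"
  have \<theta>: "\<theta> > 0" "\<theta> \<le> 1" "exp \<theta> \<le> 1 + d / (4 * b)"
  proof -
    have p: "d / (4 * b) > 0" using d b by simp
    then show "\<theta> > 0" "\<theta> \<le> 1" by (auto simp: \<theta>_def)
    have "exp \<theta> \<le> exp (ln (1 + d / (4 * b)))" by (simp add: \<theta>_def)
    then show "exp \<theta> \<le> 1 + d / (4 * b)" using p by simp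
  qed
  \<comment> \<open>The bounds v/2 and 1/2 serve small q: they keep half of the power and limit the
    constant term. The bound \<theta> / (2 L) serves q between \<kappa> and
    \<open>C\<close>.\<close>
  define e where "e = min (v / 2) (min (1/2) (\<theta> / (2 * L)))"
  have e: "e > 0" "e \<le> v / 2" "e \<le> 1/2" "e * L \<le> \<theta> / 2"
  proof -
    show "e > 0" "e \<le> v / 2" using v \<theta> L by (auto simp: e_def)
    show "e \<le> 1/2" unfolding e_def by (meson min.cobounded1 min.coboundedI2)
    have "e * L \<le> \<theta> / (2 * L) * L" using L by (intro mult_right_mono) (auto simp: e_def)
    then show "e * L \<le> \<theta> / 2" using L by simp
  qed
  obtain X0 where X0: "X0 \<ge> 1" and
    pot: "\<And>x w. x \<ge> X0 \<Longrightarrow> w \<ge> X0 \<Longrightarrow> \<bar>ln (R w) - ln (R x) - v * (ln w - ln x)\<bar> \<le> e * (1 + \<bar>ln w - ln x\<bar>)"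
    using regularly_varying_ln_diff_bound[OF a e(1), of v] unfolding R_def by blast
  have "((\<lambda>x. ln ((lam x + mu x) / R (real x))) \<longlongrightarrow> ln 1) sequentially"
    using lim unfolding R_def by (intro tendsto_ln) auto
  then have "\<forall>\<^sub>F x in sequentially. \<bar>ln ((lam x + mu x) / R (real x))\<bar> < \<theta> / 2"
    unfolding tendsto_iff dist_real_def ln_one diff_0_right using \<theta>(1) half_gt_zero by blast
  then obtain N where N: "\<And>x. x \<ge> N \<Longrightarrow> \<bar>ln ((lam x + mu x) / R (real x))\<bar> < \<theta> / 2"
    unfolding eventually_sequentially by blast
  define N0 where "N0 = max N (nat \<lceil>X0\<rceil>)"
  have log_est: "\<bar>ln (lam x + mu x) - ln (R \<rho>) - v * ln (real x / \<rho>)\<bar> \<le> \<theta> / 2 + e * (1 + \<bar>ln (real x / \<rho>)\<bar>)"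
    if "x \<ge> N0" "\<rho> \<ge> X0" for x \<rho>
  proof -
    have x: "real x \<ge> X0" "x \<ge> N" using that unfolding N0_def by linarith+
    have pos: "real x > 0" "\<rho> > 0" using x that X0 by linarith+
    have l1: "ln ((lam x + mu x) / R (real x)) = ln (lam x + mu x) - ln (R (real x))"
      using total_pos[of x] R_pos[OF pos(1)] by (simp add: ln_div)
    have l2: "ln (real x / \<rho>) = ln (real x) - ln \<rho>" using pos by (simp add: ln_div)
    show ?thesis using N[OF x(2)] pot[OF that(2) x(1)] unfolding l1 l2 by linarith
  qed
  \<comment> \<open>Bounds the rates before the asymptotic range; since \<open>V\<close> tends to
    infinity they eventually drop below \<open>d * V \<rho>\<close>.\<close>
  define B where "B = (\<Sum>x<N0. lam x + mu x)"
  have B: "lam x + mu x \<le> B" if "x < N0" for x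
    unfolding B_def using that total_pos by (intro member_le_sum) (auto simp: less_imp_le)
  have B0: "B \<ge> 0" unfolding B_def using total_pos by (intro sum_nonneg) (auto simp: less_imp_le)
  have "\<forall>\<^sub>F \<rho> in at_top. V \<rho> \<ge> B / d"
    using V_at_top by (simp add: filterlim_at_top)
  then show ?thesis
    \<comment> \<open>The threshold \<open>real N0 / \<kappa>\<close> makes every state with q >
      \<kappa> lie in the asymptotic range.\<close>
    using V eventually_ge_at_top[of X0] eventually_ge_at_top[of "real N0 / \<kappa>"]
  proof eventually_elim
    case (elim \<rho>)
    have \<rho>: "\<rho> > 0" using elim X0 by linarith
    have VR: "V \<rho> = R \<rho>" using elim by (simp add: R_def)
    have VP: "V \<rho> > 0" using \<rho> R_pos VR by simp
    have BV: "B \<le> d * V \<rho>" using elim d by (simp add: field_simps)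
    show ?case
    proof (intro allI impI)
      fix x :: nat assume x: "real x \<le> C * \<rho>"
      define q where "q = real x / \<rho>"
      have q: "q \<ge> 0" "q \<le> C" using x \<rho> by (auto simp: q_def field_simps)
      show "\<bar>lam x + mu x - V \<rho> * (real x / \<rho>) powr (max l m)\<bar> \<le> d * V \<rho>"
        unfolding v_def[symmetric] q_def[symmetric]
      proof (cases "q \<le> \<kappa>")
        case True
        have "q powr v \<le> \<kappa> powr v" using True q v by (intro powr_mono2) auto
        also have "\<dots> = \<kappa> powr (v / 2) * \<kappa> powr (v / 2)" by (simp flip: powr_add)
        also have "\<dots> \<le> \<kappa> powr (v / 2) * 1" using \<kappa> v by (intro mult_left_mono powr_le1) auto
        also have "\<dots> \<le> d" using \<kappa>_small d by simp
        finally have 1: "V \<rho> * q powr v \<le> d * V \<rho>" using VP by (simp add: mult.commute)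
        have 2: "lam x + mu x \<le> d * V \<rho>"
        proof (cases "x < N0")
          case True
          then show ?thesis using B[of x] BV by linarith
        next
          case False
          show ?thesis
          proof (cases "x = 0")
            case True
            \<comment> \<open>State 0 never lies in the asymptotic range, because \<open>N0\<close>
              is at least \<open>X0\<close>, hence at least 1.\<close>
            then have "N0 = 0" using False by simp
            then have "X0 \<le> 0" unfolding N0_def by simp
            with X0 show ?thesis by simp
          next
            case x0: False
            have qp: "q > 0" using x0 \<rho> by (simp add: q_def)
            have lq: "ln q \<le> 0" using True qp \<kappa> by simp
            have "\<bar>ln (lam x + mu x) - ln (R \<rho>) - v * ln q\<bar> \<le> \<theta> / 2 + e * (1 - ln q)"
              using log_est[of x \<rho>] False elim lq unfolding q_def by simp
            moreover have "e * (1 - ln q) \<le> 1/2 - v / 2 * ln q"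
            proof -
              have "e * (- ln q) \<le> v / 2 * (- ln q)" using e lq by (intro mult_right_mono) auto
              then show ?thesis using e(3) by (simp add: algebra_simps)
            qed
            ultimately have "ln (lam x + mu x) \<le> ln (R \<rho>) + v * ln q + (1 - v / 2 * ln q)"
              using \<theta>(2) unfolding abs_le_iff by linarith
            then have "ln (lam x + mu x) \<le> ln (R \<rho>) + 1 + v / 2 * ln q" by (simp add: algebra_simps)
            then have "exp (ln (lam x + mu x)) \<le> exp (ln (R \<rho>) + 1 + v / 2 * ln q)" by simp
            also have "\<dots> = R \<rho> * exp 1 * q powr (v / 2)"
              using qp R_pos[OF \<rho>] by (simp add: exp_add powr_def)
            \<comment> \<open>The denominator 16 in the choice of \<kappa> leaves room for the
              factor \<open>exp 1\<close>.\<close>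
            also have "\<dots> \<le> R \<rho> * 3 * (d / 16)"
            proof (intro mult_mono)
              have "q powr (v / 2) \<le> \<kappa> powr (v / 2)" using True q v by (intro powr_mono2) auto
              then show "q powr (v / 2) \<le> d / 16" using \<kappa>_small by simp
              show "exp 1 \<le> (3::real)" by (rule exp_le)
            qed (use R_pos[OF \<rho>] in auto)
            also have "\<dots> \<le> d * V \<rho>" using VR VP d by simp
            finally show ?thesis using total_pos[of x] by simp
          qed
        qed
        have "V \<rho> * q powr v \<ge> 0" using VP by simp
        with 1 2 total_pos[of x] show "\<bar>lam x + mu x - V \<rho> * q powr v\<bar> \<le> d * V \<rho>" by linarith
      next
        case False
        have qp: "q > 0" using False \<kappa> by linarith
        have "real N0 \<le> \<kappa> * \<rho>" using elim \<kappa> by (simp add: field_simps)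
        also have "\<dots> \<le> q * \<rho>" using False \<rho> by simp
        also have "\<dots> = real x" using \<rho> by (simp add: q_def)
        finally have xN: "x \<ge> N0" by simp
        have "ln \<kappa> \<le> ln q" "ln q \<le> ln C" using False qp \<kappa> q C by auto
        then have "1 + \<bar>ln q\<bar> \<le> L" unfolding L_def by linarith
        then have "e * (1 + \<bar>ln q\<bar>) \<le> \<theta> / 2" using e(1,4) mult_left_mono[of "1 + \<bar>ln q\<bar>" L e] by linarith
        then have est: "\<bar>ln (lam x + mu x) - ln (R \<rho>) - v * ln q\<bar> \<le> \<theta>"
          using log_est[OF xN, of \<rho>] elim unfolding q_def by linarith
        define \<beta> where "\<beta> = ln (lam x + mu x) - ln (R \<rho>) - v * ln q"
        have "lam x + mu x = exp (ln (R \<rho>) + v * ln q + \<beta>)"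
          using total_pos[of x] by (simp add: \<beta>_def)
        also have "\<dots> = V \<rho> * q powr v * exp \<beta>"
          using qp R_pos[OF \<rho>] by (simp add: exp_add powr_def VR)
        finally have h: "lam x + mu x = V \<rho> * q powr v * exp \<beta>" .
        have "\<bar>exp \<beta> - 1\<bar> \<le> d / b"
        proof -
          have "exp \<beta> \<le> exp \<theta>" "exp (- \<theta>) \<le> exp \<beta>" using est unfolding \<beta>_def[symmetric] by auto
          moreover have "exp \<theta> - 1 \<le> d / (4 * b)" using \<theta>(3) by simp
          \<comment> \<open>The downward deviation is no larger than the upward one, so bounding
            \<open>exp \<theta> - 1\<close> is enough.\<close>
          moreover have "1 - exp (- \<theta>) \<le> exp \<theta> - 1"
          proof -
            have "2 \<le> (1 + \<theta>) + (1 + - \<theta>)" by simp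
            also have "\<dots> \<le> exp \<theta> + exp (- \<theta>)" by (intro add_mono exp_ge_add_one_self)
            finally show ?thesis by simp
          qed
          moreover have "d / (4 * b) \<le> d / b" using d b by (simp add: field_simps)
          ultimately show ?thesis by linarith
        qed
        moreover have "q powr v \<le> b"
          using powr_mono2[of v q C] q v by (simp add: b_def)
        ultimately have "q powr v * \<bar>exp \<beta> - 1\<bar> \<le> b * (d / b)"
          using b by (intro mult_mono) auto
        then have "q powr v * \<bar>exp \<beta> - 1\<bar> \<le> d" using b by simp
        then have "V \<rho> * (q powr v * \<bar>exp \<beta> - 1\<bar>) \<le> V \<rho> * d" using VP by simp
        moreover have "lam x + mu x - V \<rho> * q powr v = V \<rho> * (q powr v * (exp \<beta> - 1))"
          unfolding h by (simp add: algebra_simps)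
        ultimately show "\<bar>lam x + mu x - V \<rho> * q powr v\<bar> \<le> d * V \<rho>"
          using VP by (simp add: abs_mult mult.commute)
      qed
    qed
  qed
qed

end

section \<open>Joint law of jump chain and holding times\<close>

abbreviation exp_dist :: "real \<Rightarrow> real measure" where
  "exp_dist r \<equiv> density lborel (\<lambda>x. ennreal (exponential_density r x))"

lemma emeasure_exp_dist_greaterThan:
  assumes "r > 0"
  shows "emeasure (exp_dist r) {a<..} = ennreal (exp (- (r * max a 0)))"
proof -
  interpret E: prob_space "exp_dist r" by (rule prob_space_exponential_density[OF assms])
  have "{a<..} = space (exp_dist r) - {..a}" by auto
  then have "E.prob {a<..} = 1 - E.prob {..a}"
    by (metis E.prob_compl atMost_borel sets_density sets_lborel)
  also have "E.prob {..a} = erlang_CDF 0 r a"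
    using assms by (simp add: measure_def emeasure_erlang_density erlang_CDF_0 mult_nonneg_nonneg)
  finally show ?thesis
    using assms by (simp add: E.emeasure_eq_measure erlang_CDF_0 max_def)
qed

text \<open>Upper orthants are the sets whose probabilities \<open>jump_chain_holding_times\<close>
  prescribes. The line is a countable union of rays, so boxes that constrain every coordinate
  already generate the product.\<close>

lemma sets_PiM_borel_greaterThan:
  assumes "finite I"
  shows "sets (\<Pi>\<^sub>M i\<in>I. (borel :: real measure)) =
    sigma_sets (\<Pi>\<^sub>E i\<in>I. UNIV) (range (\<lambda>s. {f\<in>\<Pi>\<^sub>E i\<in>I. UNIV. \<forall>i\<in>I. s i < f i}))"
proof -
  have cov: "\<exists>S\<subseteq>range greaterThan. countable S \<and> (UNIV :: real set) = \<Union>S"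
    by (rule exI[of _ "range (\<lambda>n::nat. {- real n<..})"])
       (auto, metis minus_less_iff reals_Archimedean2)
  have "sets (\<Pi>\<^sub>M i\<in>I. (borel :: real measure)) = sets (\<Pi>\<^sub>M i\<in>I. sigma UNIV (range greaterThan))"
    by (intro sets_PiM_cong) (simp_all add: borel_Ioi)
  also have "\<dots> = sets (sigma (\<Pi>\<^sub>E i\<in>I. UNIV)
      {{f\<in>(\<Pi>\<^sub>E i\<in>I. UNIV). \<forall>i\<in>j. f i \<in> A i} | A j. j \<in> {I} \<and> A \<in> Pi j (\<lambda>_. range (greaterThan :: real \<Rightarrow> _))})"
    using assms cov by (intro sets_PiM_sigma) auto
  also have "{{f\<in>(\<Pi>\<^sub>E i\<in>I. UNIV). \<forall>i\<in>j. f i \<in> A i} | A j. j \<in> {I} \<and> A \<in> Pi j (\<lambda>_. range (greaterThan :: real \<Rightarrow> _))}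
      = range (\<lambda>s. {f\<in>\<Pi>\<^sub>E i\<in>I. UNIV. \<forall>i\<in>I. s i < f i})" (is "?L = ?R")
  proof (intro set_eqI iffI)
    fix B assume "B \<in> ?L"
    then obtain A where A: "A \<in> Pi I (\<lambda>_. range greaterThan)" "B = {f\<in>(\<Pi>\<^sub>E i\<in>I. UNIV). \<forall>i\<in>I. f i \<in> A i}"
      by auto
    have "\<forall>i\<in>I. \<exists>s. A i = {s<..}" using A(1) by auto
    then obtain s where "\<forall>i\<in>I. A i = {s i<..}" by metis
    then have "B = {f\<in>\<Pi>\<^sub>E i\<in>I. UNIV. \<forall>i\<in>I. s i < f i}" using A(2) by auto
    then show "B \<in> ?R" by blast
  next
    fix B assume "B \<in> ?R"
    then obtain s where "B = {f\<in>\<Pi>\<^sub>E i\<in>I. UNIV. \<forall>i\<in>I. s i < f i}" by auto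
    then show "B \<in> ?L" by (auto intro!: exI[of _ "\<lambda>i. {s i<..}"])
  qed
  finally show ?thesis by (subst (asm) sets_measure_of) auto
qed

locale jump_chain = prob_space M for M :: "'a measure" +
  fixes lam mu :: "nat \<Rightarrow> real" and x0 :: nat and X :: "nat \<Rightarrow> 'a \<Rightarrow> nat" and S :: "nat \<Rightarrow> 'a \<Rightarrow> real"
  assumes chain: "jump_chain_holding_times M lam mu x0 X S"
    and lam_pos: "\<And>x. lam x > 0" and mu_pos: "\<And>x. x > 0 \<Longrightarrow> mu x > 0" and mu_0: "mu 0 = 0"
begin

definition h :: "nat \<Rightarrow> real" where "h x = lam x + mu x"

definition cyl :: "nat \<Rightarrow> (nat \<Rightarrow> nat) \<Rightarrow> 'a set" where
  "cyl n x = {\<omega>\<in>space M. \<forall>i\<le>n. X i \<omega> = x i}"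

definition path_prob :: "nat \<Rightarrow> (nat \<Rightarrow> nat) \<Rightarrow> real" where
  "path_prob n x = (if x 0 = x0 then 1 else 0) * (\<Prod>i<n. bd_trans lam mu (x i) (x (Suc i)))"

lemma mu_nonneg: "mu x \<ge> 0"
  using mu_pos[of x] mu_0 by (cases "x = 0") auto

lemma h_pos: "h x > 0"
  unfolding h_def using lam_pos[of x] mu_nonneg[of x] by simp

lemma X_measurable [measurable]: "X n \<in> M \<rightarrow>\<^sub>M count_space UNIV"
  and S_measurable [measurable]: "S n \<in> borel_measurable M"
  and S_pos: "\<omega> \<in> space M \<Longrightarrow> S n \<omega> > 0"
  using chain unfolding jump_chain_holding_times_def by auto

lemma cyl_sets [measurable]: "cyl n x \<in> sets M"
  unfolding cyl_def by measurable

lemma bd_trans_nonneg: "bd_trans lam mu i j \<ge> 0"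
  unfolding bd_trans_def using lam_pos mu_nonneg by (simp add: add_nonneg_nonneg less_imp_le)

lemma path_prob_nonneg: "path_prob n x \<ge> 0"
  unfolding path_prob_def by (auto intro!: prod_nonneg bd_trans_nonneg)

text \<open>Holding times are positive, so a negative level acts like level 0. Negative levels are
  included because the orthants with such corners exhaust the space in
  \<open>joint_law\<close>.\<close>

lemma prob_cyl_holding:
  "prob {\<omega>\<in>space M. \<forall>i\<le>n. X i \<omega> = x i \<and> S i \<omega> > s i} =
    path_prob n x * (\<Prod>i\<le>n. exp (- (h (x i) * max (s i) 0)))"
proof -
  have "{\<omega>\<in>space M. \<forall>i\<le>n. X i \<omega> = x i \<and> S i \<omega> > s i} =
      {\<omega>\<in>space M. \<forall>i\<le>n. X i \<omega> = x i \<and> S i \<omega> > max (s i) 0}"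
    using S_pos by auto
  also have "prob \<dots> = path_prob n x * (\<Prod>i\<le>n. exp (- (h (x i) * max (s i) 0)))"
  proof -
    have "\<forall>n x s. (\<forall>i\<le>n. s i \<ge> 0) \<longrightarrow>
        measure M {\<omega> \<in> space M. \<forall>i\<le>n. X i \<omega> = x i \<and> S i \<omega> > s i} =
          (if x 0 = x0 then 1 else 0) *
          (\<Prod>i<n. bd_trans lam mu (x i) (x (Suc i))) *
          (\<Prod>i\<le>n. exp (- ((lam (x i) + mu (x i)) * s i)))"
      using chain unfolding jump_chain_holding_times_def by blast
    from this[rule_format, of n "\<lambda>i. max (s i) 0" x] show ?thesis
      by (simp add: path_prob_def h_def)
  qed
  finally show ?thesis .
qed

text \<open>Uniqueness of measures: upper orthants form an intersection-stable generator, and both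
  finite measures agree on them. The left side is not normalised; its mass is the probability of the
  cylinder.\<close>

lemma joint_law:
  "distr (density M (indicator (cyl n x))) (\<Pi>\<^sub>M i\<in>{..n}. borel) (\<lambda>\<omega>. \<lambda>i\<in>{..n}. S i \<omega>) =
    scale_measure (ennreal (path_prob n x)) (\<Pi>\<^sub>M i\<in>{..n}. exp_dist (h (x i)))" (is "?L = ?R")
proof -
  let ?E = "range (\<lambda>s. {f\<in>\<Pi>\<^sub>E i\<in>{..n}. UNIV. \<forall>i\<in>{..n}. (s i :: real) < f i})"
  interpret P: product_sigma_finite "\<lambda>i. exp_dist (h (x i))"
    using prob_space_exponential_density[OF h_pos]
    by (intro product_sigma_finite.intro prob_space_imp_sigma_finite)
  have setsR: "sets ?R = sets (\<Pi>\<^sub>M i\<in>{..n}. (borel :: real measure))"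
    by (simp, intro sets_PiM_cong) auto
  have box: "emeasure ?L {f\<in>\<Pi>\<^sub>E i\<in>{..n}. UNIV. \<forall>i\<in>{..n}. s i < f i} =
     emeasure ?R {f\<in>\<Pi>\<^sub>E i\<in>{..n}. UNIV. \<forall>i\<in>{..n}. s i < f i}" for s
  proof -
    have m: "{f\<in>\<Pi>\<^sub>E i\<in>{..n}. UNIV. \<forall>i\<in>{..n}. s i < f i} \<in> sets (\<Pi>\<^sub>M i\<in>{..n}. (borel :: real measure))"
      by (subst sets_PiM_borel_greaterThan) auto
    have "emeasure ?L {f\<in>\<Pi>\<^sub>E i\<in>{..n}. UNIV. \<forall>i\<in>{..n}. s i < f i} =
      emeasure (density M (indicator (cyl n x))) ((\<lambda>\<omega>. \<lambda>i\<in>{..n}. S i \<omega>) -` {f\<in>\<Pi>\<^sub>E i\<in>{..n}. UNIV. \<forall>i\<in>{..n}. s i < f i} \<inter> space M)"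
      using m by (subst emeasure_distr) auto
    also have "(\<lambda>\<omega>. \<lambda>i\<in>{..n}. S i \<omega>) -` {f\<in>\<Pi>\<^sub>E i\<in>{..n}. UNIV. \<forall>i\<in>{..n}. s i < f i} \<inter> space M =
       {\<omega>\<in>space M. \<forall>i\<le>n. s i < S i \<omega>}"
      by auto
    also have "emeasure (density M (indicator (cyl n x))) {\<omega>\<in>space M. \<forall>i\<le>n. s i < S i \<omega>} =
        emeasure M (cyl n x \<inter> {\<omega>\<in>space M. \<forall>i\<le>n. s i < S i \<omega>})"
      by (subst emeasure_density) (auto simp flip: nn_integral_indicator intro!: nn_integral_cong split: split_indicator)
    also have "cyl n x \<inter> {\<omega>\<in>space M. \<forall>i\<le>n. s i < S i \<omega>} = {\<omega>\<in>space M. \<forall>i\<le>n. X i \<omega> = x i \<and> S i \<omega> > s i}"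
      unfolding cyl_def by auto
    also have "emeasure M \<dots> = ennreal (path_prob n x * (\<Prod>i\<le>n. exp (- (h (x i) * max (s i) 0))))"
      by (simp only: emeasure_eq_measure prob_cyl_holding)
    also have "\<dots> = ennreal (path_prob n x) * (\<Prod>i\<in>{..n}. emeasure (exp_dist (h (x i))) {s i<..})"
      by (simp add: emeasure_exp_dist_greaterThan h_pos ennreal_mult path_prob_nonneg prod_nonneg prod_ennreal)
    also have "(\<Prod>i\<in>{..n}. emeasure (exp_dist (h (x i))) {s i<..}) =
        emeasure (\<Pi>\<^sub>M i\<in>{..n}. exp_dist (h (x i))) (\<Pi>\<^sub>E i\<in>{..n}. {s i<..})"
      by (subst P.emeasure_PiM) auto
    also have "(\<Pi>\<^sub>E i\<in>{..n}. {s i<..}) = {f\<in>\<Pi>\<^sub>E i\<in>{..n}. UNIV. \<forall>i\<in>{..n}. s i < f i}"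
      by (auto simp: PiE_iff extensional_def)
    finally show ?thesis unfolding emeasure_scale_measure .
  qed
  show ?thesis
  proof (rule measure_eqI_generator_eq[where E = ?E and \<Omega> = "\<Pi>\<^sub>E i\<in>{..n}. UNIV"
        and A = "\<lambda>k. {f\<in>\<Pi>\<^sub>E i\<in>{..n}. UNIV. \<forall>i\<in>{..n}. - real k < f i}"])
    show "Int_stable ?E"
    proof (rule Int_stableI_image)
      fix s t :: "nat \<Rightarrow> real"
      show "\<exists>u\<in>UNIV. {f\<in>\<Pi>\<^sub>E i\<in>{..n}. UNIV. \<forall>i\<in>{..n}. s i < f i} \<inter> {f\<in>\<Pi>\<^sub>E i\<in>{..n}. UNIV. \<forall>i\<in>{..n}. t i < f i} =
        {f\<in>\<Pi>\<^sub>E i\<in>{..n}. UNIV. \<forall>i\<in>{..n}. u i < f i}"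
        by (rule bexI[of _ "\<lambda>i. max (s i) (t i)"]) auto
    qed
    show "?E \<subseteq> Pow (\<Pi>\<^sub>E i\<in>{..n}. UNIV)" by auto
    show "emeasure ?L B = emeasure ?R B" if "B \<in> ?E" for B using that box by auto
    show "sets ?L = sigma_sets (\<Pi>\<^sub>E i\<in>{..n}. UNIV) ?E"
      by (simp add: sets_PiM_borel_greaterThan)
    show "sets ?R = sigma_sets (\<Pi>\<^sub>E i\<in>{..n}. UNIV) ?E"
      by (simp only: setsR) (simp add: sets_PiM_borel_greaterThan)
    show "range (\<lambda>k. {f\<in>\<Pi>\<^sub>E i\<in>{..n}. UNIV. \<forall>i\<in>{..n}. - real k < f i}) \<subseteq> ?E" by auto
    show "(\<Union>k. {f\<in>\<Pi>\<^sub>E i\<in>{..n}. UNIV. \<forall>i\<in>{..n}. - real k < f i}) = (\<Pi>\<^sub>E i\<in>{..n}. UNIV)"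
    proof -
      have "\<exists>k::nat. \<forall>i\<in>{..n}. - real k < f i" for f :: "nat \<Rightarrow> real"
      proof -
        obtain k :: nat where k: "(\<Sum>i\<le>n. \<bar>f i\<bar>) < real k" using reals_Archimedean2 by blast
        have "\<bar>f i\<bar> \<le> (\<Sum>i\<le>n. \<bar>f i\<bar>)" if "i \<le> n" for i
          using that by (intro member_le_sum) auto
        then show ?thesis using k by (intro exI[of _ k]) force
      qed
      then show ?thesis by auto
    qed
    show "emeasure ?L {f\<in>\<Pi>\<^sub>E i\<in>{..n}. UNIV. \<forall>i\<in>{..n}. - real k < f i} \<noteq> \<infinity>" for k
    proof -
      have fin: "finite_measure (density M (indicator (cyl n x)))"
        by (rule finite_measureI) (auto simp: emeasure_density)
      then have "finite_measure ?L"
        by (rule finite_measure.finite_measure_distr) auto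
      then show ?thesis by (simp add: finite_measure.emeasure_finite)
    qed
  qed
qed

lemma nn_integral_cyl:
  assumes F [measurable]: "F \<in> borel_measurable (\<Pi>\<^sub>M i\<in>{..n}. (borel :: real measure))"
  shows "(\<integral>\<^sup>+\<omega>. indicator (cyl n x) \<omega> * F (\<lambda>i\<in>{..n}. S i \<omega>) \<partial>M) =
    ennreal (path_prob n x) * (\<integral>\<^sup>+s. F s \<partial>(\<Pi>\<^sub>M i\<in>{..n}. exp_dist (h (x i))))"
proof -
  have "(\<integral>\<^sup>+\<omega>. indicator (cyl n x) \<omega> * F (\<lambda>i\<in>{..n}. S i \<omega>) \<partial>M) =
    (\<integral>\<^sup>+\<omega>. F (\<lambda>i\<in>{..n}. S i \<omega>) \<partial>density M (indicator (cyl n x)))"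
    by (subst nn_integral_density) auto
  also have "\<dots> = (\<integral>\<^sup>+s. F s \<partial>distr (density M (indicator (cyl n x))) (\<Pi>\<^sub>M i\<in>{..n}. borel) (\<lambda>\<omega>. \<lambda>i\<in>{..n}. S i \<omega>))"
    by (subst nn_integral_distr) auto
  also have "\<dots> = ennreal (path_prob n x) * (\<integral>\<^sup>+s. F s \<partial>(\<Pi>\<^sub>M i\<in>{..n}. exp_dist (h (x i))))"
    unfolding joint_law
  proof (subst nn_integral_scale_measure)
    have "sets (\<Pi>\<^sub>M i\<in>{..n}. exp_dist (h (x i))) = sets (\<Pi>\<^sub>M i\<in>{..n}. (borel :: real measure))"
      by (intro sets_PiM_cong) auto
    then show "F \<in> borel_measurable (\<Pi>\<^sub>M i\<in>{..n}. exp_dist (h (x i)))"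
      using F by (simp cong: measurable_cong_sets)
  qed simp
  finally show ?thesis .
qed

end

section \<open>The exponential supermartingale\<close>

text \<open>Multiplying the exponential density of rate \<open>r\<close> by
  \<open>exp ((r - w) * y)\<close> gives r/w times the density of rate \<open>w\<close>, so the
  integral is a rescaled distribution function.\<close>

lemma nn_integral_exp_dist_tilt:
  assumes r: "r > 0" and w: "w > 0"
  shows "(\<integral>\<^sup>+y. ennreal (exp ((r - w) * y)) * indicator {..t} y \<partial>exp_dist r) =
    ennreal (if t < 0 then 0 else r / w * (1 - exp (- (w * t))))"
proof -
  have "(\<integral>\<^sup>+y. ennreal (exp ((r - w) * y)) * indicator {..t} y \<partial>exp_dist r) =
    (\<integral>\<^sup>+y. ennreal (exponential_density r y) * (ennreal (exp ((r - w) * y)) * indicator {..t} y) \<partial>lborel)"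
    by (subst nn_integral_density) auto
  also have "\<dots> = (\<integral>\<^sup>+y. ennreal (r / w) * (ennreal (exponential_density w y) * indicator {..t} y) \<partial>lborel)"
  proof (rule nn_integral_cong)
    fix y :: real
    have "exponential_density r y * exp ((r - w) * y) = r / w * exponential_density w y"
      using w by (simp add: exponential_density_def algebra_simps flip: exp_add)
    then show "ennreal (exponential_density r y) * (ennreal (exp ((r - w) * y)) * indicator {..t} y) =
      ennreal (r / w) * (ennreal (exponential_density w y) * indicator {..t} y)"
      using r w by (simp add: mult.assoc[symmetric] exponential_density_nonneg flip: ennreal_mult)
  qed
  also have "\<dots> = ennreal (r / w) * (\<integral>\<^sup>+y. indicator {..t} y \<partial>exp_dist w)"
    by (subst nn_integral_cmult) (auto simp: nn_integral_density simp del: nn_integral_indicator)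
  also have "(\<integral>\<^sup>+y. indicator {..t} y \<partial>exp_dist w) = ennreal (erlang_CDF 0 w t)"
    using w by (simp add: emeasure_erlang_density)
  also have "ennreal (r / w) * ennreal (erlang_CDF 0 w t) = ennreal (r / w * erlang_CDF 0 w t)"
    using r w by (simp flip: ennreal_mult)
  finally show ?thesis by (simp add: erlang_CDF_0)
qed

section \<open>Integrating out one holding time and one jump at a time\<close>

context jump_chain
begin

abbreviation holding_law :: "nat \<Rightarrow> (nat \<Rightarrow> nat) \<Rightarrow> (nat \<Rightarrow> real) measure" where
  "holding_law n x \<equiv> \<Pi>\<^sub>M i\<in>{..<n}. exp_dist (h (x i))"

lemma sets_holding_law [measurable_cong]:
  "sets (holding_law n x) = sets (\<Pi>\<^sub>M i\<in>{..<n}. (borel :: real measure))"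
  by (intro sets_PiM_cong) auto

lemma product_exp_dist: "product_sigma_finite (\<lambda>i. exp_dist (h (x i)))"
  using prob_space_exponential_density[OF h_pos]
  by (intro product_sigma_finite.intro prob_space_imp_sigma_finite)

lemma nn_integral_holding_law_Suc:
  assumes F: "F \<in> borel_measurable (\<Pi>\<^sub>M i\<in>{..<Suc n}. (borel :: real measure))"
  shows "(\<integral>\<^sup>+s. F s \<partial>holding_law (Suc n) x) =
    (\<integral>\<^sup>+s. (\<integral>\<^sup>+y. F (s(n := y)) \<partial>exp_dist (h (x n))) \<partial>holding_law n x)"
proof -
  interpret P: product_sigma_finite "\<lambda>i. exp_dist (h (x i))" by (rule product_exp_dist)
  have "F \<in> borel_measurable (holding_law (Suc n) x)"
    using F by (simp cong: measurable_cong_sets add: sets_holding_law)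
  then show ?thesis
    unfolding lessThan_Suc by (intro P.product_nn_integral_insert) auto
qed

lemma nn_integral_cyl_Suc:
  assumes F [measurable]: "F \<in> borel_measurable (\<Pi>\<^sub>M i\<in>{..<Suc n}. (borel :: real measure))"
  shows "(\<integral>\<^sup>+\<omega>. indicator (cyl n x) \<omega> * F (\<lambda>i\<in>{..<Suc n}. S i \<omega>) \<partial>M) =
    ennreal (path_prob n x) * (\<integral>\<^sup>+s. (\<integral>\<^sup>+y. F (s(n := y)) \<partial>exp_dist (h (x n))) \<partial>holding_law n x)"
  using nn_integral_cyl[of F n x] F
  unfolding lessThan_Suc_atMost[symmetric] by (simp add: nn_integral_holding_law_Suc)

lemma prob_cyl: "prob (cyl n x) = path_prob n x"
proof -
  have "cyl n x = {\<omega>\<in>space M. \<forall>i\<le>n. X i \<omega> = x i \<and> S i \<omega> > 0}"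
    using S_pos unfolding cyl_def by auto
  then show ?thesis using prob_cyl_holding[of n x "\<lambda>_. 0"] by simp
qed

text \<open>At \<open>i = 0\<close> the truncated \<open>i - 1\<close> is 0 itself, a transition of
  probability 0, and the upward step has probability 1 because \<open>mu 0 = 0\<close>.\<close>

lemma sum_bd_trans: "(\<Sum>y\<in>{Suc i, i - 1}. bd_trans lam mu i y) = 1"
  using h_pos[of i] mu_0 unfolding bd_trans_def h_def
  by (cases i) (auto simp flip: add_divide_distrib)

lemma path_prob_Suc_upd:
  "path_prob (Suc n) (x(Suc n := y)) = path_prob n x * bd_trans lam mu (x n) y"
  unfolding path_prob_def by (simp add: prod.lessThan_Suc)

text \<open>The law forbids other transitions only up to null sets; the two successor cylinders are
  disjoint and together carry the full mass of the cylinder.\<close>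

lemma AE_cyl_split:
  "AE \<omega> in M. (indicator (cyl n x) \<omega> :: ennreal) =
     (\<Sum>y\<in>{Suc (x n), x n - 1}. indicator (cyl (Suc n) (x(Suc n := y))) \<omega>)"
proof -
  let ?C = "\<lambda>y. cyl (Suc n) (x(Suc n := y))"
  have C: "?C y = {\<omega>\<in>cyl n x. X (Suc n) \<omega> = y}" for y
    unfolding cyl_def by (auto simp: le_Suc_eq)
  have "prob (cyl n x - (?C (Suc (x n)) \<union> ?C (x n - 1))) = prob (cyl n x) - prob (?C (Suc (x n)) \<union> ?C (x n - 1))"
    by (rule finite_measure_Diff) (auto simp: C)
  also have "prob (?C (Suc (x n)) \<union> ?C (x n - 1)) = prob (?C (Suc (x n))) + prob (?C (x n - 1))"
    by (rule finite_measure_Union) (auto simp: C)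
  also have "\<dots> = prob (cyl n x)"
    using sum_bd_trans[of "x n"] by (simp add: prob_cyl path_prob_Suc_upd flip: distrib_left)
  finally have "prob (cyl n x - (?C (Suc (x n)) \<union> ?C (x n - 1))) = 0" by (simp only: diff_self)
  then have "AE \<omega> in M. \<omega> \<notin> cyl n x - (?C (Suc (x n)) \<union> ?C (x n - 1))"
    by (subst prob_eq_0[symmetric]) auto
  then show ?thesis
    by eventually_elim (auto simp: C split: split_indicator)
qed

end

text \<open>\<open>eigen\<close> says that \<open>g\<close> is annihilated by the generator plus the
  potential \<open>h - w\<close>. The value \<open>g (0 - 1)\<close> is multiplied by
  \<open>mu 0 = 0\<close>.\<close>

locale tilted_jump_chain = jump_chain +
  fixes g w :: "nat \<Rightarrow> real" and T :: real
  assumes g_pos: "\<And>x. g x > 0" and w_pos: "\<And>x. w x > 0"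
    and eigen: "\<And>x. lam x * g (Suc x) + mu x * g (x - 1) = w x * g x"
    and T_nonneg: "T \<ge> 0"
begin

definition c :: "nat \<Rightarrow> real" where "c x = h x - w x"

text \<open>The exponential functional at time \<open>T\<close>, restricted to the event that
  exactly \<open>n\<close> jumps have occurred. These events are disjoint, so the sum over
  \<open>n\<close> is the full functional without explosion and 0 after it. Values in
  \<open>ennreal\<close> avoid questions of integrability.\<close>

definition Z :: "nat \<Rightarrow> 'a \<Rightarrow> ennreal" where
  "Z n \<omega> = (if (\<Sum>k<n. S k \<omega>) \<le> T \<and> T < (\<Sum>k<Suc n. S k \<omega>)
     then ennreal (g (X n \<omega>) * exp ((\<Sum>k<n. c (X k \<omega>) * S k \<omega>) + c (X n \<omega>) * (T - (\<Sum>k<n. S k \<omega>)))) else 0)"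

text \<open>Multiplied by \<open>path_prob n x * g (x n)\<close>, this is the expectation of the
  functional at the \<open>n\<close>-th jump time, restricted to the cylinder of \<open>x\<close>
  and to that jump happening by \<open>T\<close>.\<close>

definition U :: "nat \<Rightarrow> (nat \<Rightarrow> nat) \<Rightarrow> ennreal" where
  "U n x = (\<integral>\<^sup>+s. ennreal (exp (\<Sum>k<n. c (x k) * s k)) * indicator {..T} (\<Sum>k<n. s k) \<partial>holding_law n x)"

lemma Z_measurable [measurable]: "Z n \<in> borel_measurable M"
  unfolding Z_def by measurable

lemma U_Suc:
  "U (Suc n) x = (\<integral>\<^sup>+s. ennreal (exp (\<Sum>k<n. c (x k) * s k)) * indicator {..T} (\<Sum>k<n. s k) *
     ennreal (h (x n) / w (x n) * (1 - exp (- (w (x n) * (T - (\<Sum>k<n. s k)))))) \<partial>holding_law n x)"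
proof -
  have "U (Suc n) x = (\<integral>\<^sup>+s. (\<integral>\<^sup>+y. ennreal (exp (\<Sum>k<Suc n. c (x k) * (s(n := y)) k)) *
      indicator {..T} (\<Sum>k<Suc n. (s(n := y)) k) \<partial>exp_dist (h (x n))) \<partial>holding_law n x)"
    unfolding U_def by (rule nn_integral_holding_law_Suc) measurable
  also have "\<dots> = (\<integral>\<^sup>+s. ennreal (exp (\<Sum>k<n. c (x k) * s k)) * indicator {..T} (\<Sum>k<n. s k) *
     ennreal (h (x n) / w (x n) * (1 - exp (- (w (x n) * (T - (\<Sum>k<n. s k)))))) \<partial>holding_law n x)"
  proof (rule nn_integral_cong)
    fix s :: "nat \<Rightarrow> real"
    have "(\<integral>\<^sup>+y. ennreal (exp (\<Sum>k<Suc n. c (x k) * (s(n := y)) k)) *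
      indicator {..T} (\<Sum>k<Suc n. (s(n := y)) k) \<partial>exp_dist (h (x n))) =
      (\<integral>\<^sup>+y. ennreal (exp (\<Sum>k<n. c (x k) * s k)) * (ennreal (exp ((h (x n) - w (x n)) * y)) *
        indicator {..T - (\<Sum>k<n. s k)} y) \<partial>exp_dist (h (x n)))"
    proof (rule nn_integral_cong)
      fix y :: real
      have "(\<Sum>k<Suc n. c (x k) * (s(n := y)) k) = (\<Sum>k<n. c (x k) * s k) + (h (x n) - w (x n)) * y"
        by (simp add: c_def[of "x n"])
      moreover have "(\<Sum>k<Suc n. (s(n := y)) k) = (\<Sum>k<n. s k) + y"
        by simp
      ultimately show "ennreal (exp (\<Sum>k<Suc n. c (x k) * (s(n := y)) k)) *
        indicator {..T} (\<Sum>k<Suc n. (s(n := y)) k) =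
        ennreal (exp (\<Sum>k<n. c (x k) * s k)) * (ennreal (exp ((h (x n) - w (x n)) * y)) *
        indicator {..T - (\<Sum>k<n. s k)} y)"
        by (simp only:) (auto simp: exp_add ennreal_mult split: split_indicator)
    qed
    also have "\<dots> = ennreal (exp (\<Sum>k<n. c (x k) * s k)) *
       ennreal (if T - (\<Sum>k<n. s k) < 0 then 0 else h (x n) / w (x n) * (1 - exp (- (w (x n) * (T - (\<Sum>k<n. s k))))))"
      by (subst nn_integral_cmult) (auto simp: nn_integral_exp_dist_tilt h_pos w_pos)
    also have "\<dots> = ennreal (exp (\<Sum>k<n. c (x k) * s k)) * indicator {..T} (\<Sum>k<n. s k) *
     ennreal (h (x n) / w (x n) * (1 - exp (- (w (x n) * (T - (\<Sum>k<n. s k))))))"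
      by (auto split: split_indicator)
    finally show "(\<integral>\<^sup>+y. ennreal (exp (\<Sum>k<Suc n. c (x k) * (s(n := y)) k)) *
      indicator {..T} (\<Sum>k<Suc n. (s(n := y)) k) \<partial>exp_dist (h (x n))) = \<dots>" .
  qed
  finally show ?thesis .
qed

text \<open>The last holding time must outlast the remaining time, with probability exp(-h (T -
  \<sigma>)) for \<sigma> the time of the \<open>n\<close>-th jump; multiplied by exp(c (T -
  \<sigma>)) this leaves exp(-w (T - \<sigma>)).\<close>

lemma nn_integral_cyl_Z:
  "(\<integral>\<^sup>+\<omega>. indicator (cyl n x) \<omega> * Z n \<omega> \<partial>M) = ennreal (path_prob n x) *
    (\<integral>\<^sup>+s. ennreal (exp (\<Sum>k<n. c (x k) * s k)) * indicator {..T} (\<Sum>k<n. s k) *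
     ennreal (g (x n) * exp (- (w (x n) * (T - (\<Sum>k<n. s k))))) \<partial>holding_law n x)"
proof -
  define F where "F = (\<lambda>s :: nat \<Rightarrow> real. indicator {..T} (\<Sum>k<n. s k) * indicator {T<..} (\<Sum>k<Suc n. s k) *
     ennreal (g (x n) * exp ((\<Sum>k<n. c (x k) * s k) + c (x n) * (T - (\<Sum>k<n. s k)))))"
  have F [measurable]: "F \<in> borel_measurable (\<Pi>\<^sub>M i\<in>{..<Suc n}. (borel :: real measure))"
    unfolding F_def by measurable
  have "(\<integral>\<^sup>+\<omega>. indicator (cyl n x) \<omega> * Z n \<omega> \<partial>M) =
      (\<integral>\<^sup>+\<omega>. indicator (cyl n x) \<omega> * F (\<lambda>i\<in>{..<Suc n}. S i \<omega>) \<partial>M)"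
    by (intro nn_integral_cong) (auto simp: cyl_def Z_def F_def split: split_indicator)
  also have "\<dots> = ennreal (path_prob n x) * (\<integral>\<^sup>+s. (\<integral>\<^sup>+y. F (s(n := y)) \<partial>exp_dist (h (x n))) \<partial>holding_law n x)"
    by (rule nn_integral_cyl_Suc) fact
  also have "(\<integral>\<^sup>+s. (\<integral>\<^sup>+y. F (s(n := y)) \<partial>exp_dist (h (x n))) \<partial>holding_law n x) =
    (\<integral>\<^sup>+s. ennreal (exp (\<Sum>k<n. c (x k) * s k)) * indicator {..T} (\<Sum>k<n. s k) *
     ennreal (g (x n) * exp (- (w (x n) * (T - (\<Sum>k<n. s k))))) \<partial>holding_law n x)"
  proof (rule nn_integral_cong)
    fix s :: "nat \<Rightarrow> real"
    let ?\<sigma> = "\<Sum>k<n. s k"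
    let ?e = "\<Sum>k<n. c (x k) * s k"
    have "(\<integral>\<^sup>+y. F (s(n := y)) \<partial>exp_dist (h (x n))) =
      (\<integral>\<^sup>+y. (indicator {..T} ?\<sigma> * ennreal (g (x n) * exp (?e + c (x n) * (T - ?\<sigma>)))) *
         indicator {T - ?\<sigma><..} y \<partial>exp_dist (h (x n)))"
      by (intro nn_integral_cong) (auto simp: F_def split: split_indicator)
    also have "\<dots> = (indicator {..T} ?\<sigma> * ennreal (g (x n) * exp (?e + c (x n) * (T - ?\<sigma>)))) *
         ennreal (exp (- (h (x n) * max (T - ?\<sigma>) 0)))"
      by (subst nn_integral_cmult) (auto simp: emeasure_exp_dist_greaterThan h_pos)
    also have "\<dots> = ennreal (exp ?e) * indicator {..T} ?\<sigma> *
       ennreal (g (x n) * exp (- (w (x n) * (T - ?\<sigma>))))"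
    proof (cases "?\<sigma> \<le> T")
      case True
      have "g (x n) * exp (?e + c (x n) * (T - ?\<sigma>)) * exp (- (h (x n) * (T - ?\<sigma>))) =
        exp ?e * (g (x n) * exp (- (w (x n) * (T - ?\<sigma>))))"
        unfolding c_def by (simp add: algebra_simps flip: exp_add)
      then show ?thesis
        using True g_pos[of "x n"] by (simp add: less_imp_le flip: ennreal_mult)
    qed simp
    finally show "(\<integral>\<^sup>+y. F (s(n := y)) \<partial>exp_dist (h (x n))) = \<dots>" .
  qed
  finally show ?thesis .
qed

text \<open>One-step balance: for \<sigma> the time of the \<open>n\<close>-th jump, the mass splits
  into the share exp(-w (T - \<sigma>)) that waits beyond \<open>T\<close> and the complementary
  share that jumps before. The factor h/w from the tilted holding time cancels the factor w/h from
  averaging \<open>g\<close> over the next state.\<close>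

lemma nn_integral_Z_add_U_Suc:
  "(\<integral>\<^sup>+\<omega>. indicator (cyl n x) \<omega> * Z n \<omega> \<partial>M) +
    (\<Sum>y\<in>{Suc (x n), x n - 1}. ennreal (path_prob n x * bd_trans lam mu (x n) y * g y) * U (Suc n) x)
   = ennreal (path_prob n x * g (x n)) * U n x"
proof -
  \<comment> \<open>This is \<open>eigen\<close> divided by the total rate; at state 0 the downward
    term drops out.\<close>
  have sum_g: "(\<Sum>y\<in>{Suc (x n), x n - 1}. bd_trans lam mu (x n) y * g y) = g (x n) * w (x n) / h (x n)"
    using h_pos[of "x n"] mu_0 eigen[of "x n"] unfolding bd_trans_def h_def
    by (cases "x n") (auto simp: mult.commute eq_divide_eq simp flip: add_divide_distrib)
  have "(\<Sum>y\<in>{Suc (x n), x n - 1}. ennreal (path_prob n x * bd_trans lam mu (x n) y * g y) * U (Suc n) x) =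
    (\<Sum>y\<in>{Suc (x n), x n - 1}. ennreal (path_prob n x * bd_trans lam mu (x n) y * g y)) * U (Suc n) x"
    by (simp only: sum_distrib_right)
  also have "(\<Sum>y\<in>{Suc (x n), x n - 1}. ennreal (path_prob n x * bd_trans lam mu (x n) y * g y)) =
     ennreal (\<Sum>y\<in>{Suc (x n), x n - 1}. path_prob n x * bd_trans lam mu (x n) y * g y)"
    by (intro sum_ennreal mult_nonneg_nonneg path_prob_nonneg bd_trans_nonneg less_imp_le[OF g_pos])
  also have "(\<Sum>y\<in>{Suc (x n), x n - 1}. path_prob n x * bd_trans lam mu (x n) y * g y) =
     path_prob n x * (g (x n) * w (x n) / h (x n))"
    by (simp only: sum_g[symmetric] sum_distrib_left mult.assoc)
  also have "ennreal (path_prob n x * (g (x n) * w (x n) / h (x n))) = ennreal (path_prob n x) * ennreal (g (x n) * w (x n) / h (x n))"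
    by (rule ennreal_mult) (use g_pos w_pos h_pos in \<open>auto intro!: path_prob_nonneg mult_nonneg_nonneg divide_nonneg_pos less_imp_le\<close>)
  finally have "(\<integral>\<^sup>+\<omega>. indicator (cyl n x) \<omega> * Z n \<omega> \<partial>M) +
    (\<Sum>y\<in>{Suc (x n), x n - 1}. ennreal (path_prob n x * bd_trans lam mu (x n) y * g y) * U (Suc n) x)
    = ennreal (path_prob n x) * ((\<integral>\<^sup>+s. ennreal (exp (\<Sum>k<n. c (x k) * s k)) * indicator {..T} (\<Sum>k<n. s k) *
     ennreal (g (x n) * exp (- (w (x n) * (T - (\<Sum>k<n. s k))))) \<partial>holding_law n x) +
     ennreal (g (x n) * w (x n) / h (x n)) * U (Suc n) x)" (is "_ = _ * (?I + ?J)")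
    by (simp only: nn_integral_cyl_Z distrib_left mult.assoc)
  also have "?J = (\<integral>\<^sup>+s. ennreal (g (x n) * w (x n) / h (x n)) * (ennreal (exp (\<Sum>k<n. c (x k) * s k)) * indicator {..T} (\<Sum>k<n. s k) *
     ennreal (h (x n) / w (x n) * (1 - exp (- (w (x n) * (T - (\<Sum>k<n. s k))))))) \<partial>holding_law n x)"
    unfolding U_Suc by (subst nn_integral_cmult) (auto simp: sets_holding_law cong: measurable_cong_sets)
  also have "?I + \<dots> = (\<integral>\<^sup>+s. (ennreal (exp (\<Sum>k<n. c (x k) * s k)) * indicator {..T} (\<Sum>k<n. s k) *
     ennreal (g (x n) * exp (- (w (x n) * (T - (\<Sum>k<n. s k)))))) +
     ennreal (g (x n) * w (x n) / h (x n)) * (ennreal (exp (\<Sum>k<n. c (x k) * s k)) * indicator {..T} (\<Sum>k<n. s k) *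
     ennreal (h (x n) / w (x n) * (1 - exp (- (w (x n) * (T - (\<Sum>k<n. s k))))))) \<partial>holding_law n x)"
    by (subst nn_integral_add) (auto simp: sets_holding_law cong: measurable_cong_sets)
  also have "\<dots> = (\<integral>\<^sup>+s. ennreal (g (x n)) * (ennreal (exp (\<Sum>k<n. c (x k) * s k)) * indicator {..T} (\<Sum>k<n. s k)) \<partial>holding_law n x)"
  proof (rule nn_integral_cong)
    fix s :: "nat \<Rightarrow> real"
    let ?\<sigma> = "\<Sum>k<n. s k"
    let ?e = "\<Sum>k<n. c (x k) * s k"
    let ?q = "exp (- (w (x n) * (T - ?\<sigma>)))"
    show "ennreal (exp ?e) * indicator {..T} ?\<sigma> * ennreal (g (x n) * ?q) +
        ennreal (g (x n) * w (x n) / h (x n)) * (ennreal (exp ?e) * indicator {..T} ?\<sigma> * ennreal (h (x n) / w (x n) * (1 - ?q))) =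
        ennreal (g (x n)) * (ennreal (exp ?e) * indicator {..T} ?\<sigma>)"
    proof (cases "?\<sigma> \<le> T")
      case True
      have pos: "g (x n) > 0" "w (x n) > 0" "h (x n) > 0" by (simp_all add: g_pos w_pos h_pos)
      have q: "?q \<le> 1" using True pos by simp
      have "exp ?e * (g (x n) * ?q) + g (x n) * w (x n) / h (x n) * (exp ?e * (h (x n) / w (x n) * (1 - ?q))) =
          g (x n) * exp ?e"
        using pos by (simp add: field_simps)
      then have e0: "ennreal (exp ?e * (g (x n) * ?q)) + ennreal (g (x n) * w (x n) / h (x n) * (exp ?e * (h (x n) / w (x n) * (1 - ?q)))) =
          ennreal (g (x n) * exp ?e)"
        using pos q by (subst ennreal_plus[symmetric]) auto
      have e1: "ennreal (exp ?e) * ennreal (g (x n) * ?q) = ennreal (exp ?e * (g (x n) * ?q))"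
        using pos by (intro ennreal_mult[symmetric]) auto
      have e2: "ennreal (exp ?e) * ennreal (h (x n) / w (x n) * (1 - ?q)) =
          ennreal (exp ?e * (h (x n) / w (x n) * (1 - ?q)))"
        using pos q by (intro ennreal_mult[symmetric]) auto
      have e3: "ennreal (g (x n) * w (x n) / h (x n)) * ennreal (exp ?e * (h (x n) / w (x n) * (1 - ?q))) =
          ennreal (g (x n) * w (x n) / h (x n) * (exp ?e * (h (x n) / w (x n) * (1 - ?q))))"
        using pos q by (intro ennreal_mult[symmetric]) auto
      have e4: "ennreal (g (x n)) * ennreal (exp ?e) = ennreal (g (x n) * exp ?e)"
        using pos by (intro ennreal_mult[symmetric]) auto
      have e5: "indicator {..T} ?\<sigma> = (1 :: ennreal)"
        using True by simp
      show ?thesis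
        unfolding e5 mult_1_right e1 e2 e3 e4 by (rule e0)
    qed simp
  qed
  also have "\<dots> = ennreal (g (x n)) * U n x"
    unfolding U_def by (subst nn_integral_cmult) (auto simp: sets_holding_law cong: measurable_cong_sets)
  finally show ?thesis
    using path_prob_nonneg[of n x] g_pos[of "x n"] by (simp add: ennreal_mult less_imp_le mult.assoc)
qed

text \<open>Only the states before index \<open>n\<close> enter, so prescribing the next state
  \<open>x (Suc k)\<close> leaves \<open>U (Suc k)\<close> unchanged.\<close>

lemma U_cong:
  assumes "\<And>i. i < n \<Longrightarrow> x i = y i"
  shows "U n x = U n y"
proof -
  have "holding_law n x = holding_law n y"
    by (rule PiM_cong) (simp_all add: assms)
  moreover have "(\<Sum>k<n. c (x k) * s k) = (\<Sum>k<n. c (y k) * s k)" for s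
    by (rule sum.cong) (simp_all add: assms)
  ultimately show ?thesis
    unfolding U_def by (simp only:)
qed

text \<open>
  \<open>nn_integral_Z_add_U_Suc\<close> telescopes along each path; the induction runs from \<open>N\<close> down to \<open>k\<close> and
  splits a cylinder according to the two possible next states.
\<close>

lemma sum_nn_integral_Z_le:
  assumes "k \<le> N"
  shows "(\<Sum>n=k..N. \<integral>\<^sup>+\<omega>. indicator (cyl k x) \<omega> * Z n \<omega> \<partial>M) \<le> ennreal (path_prob k x * g (x k)) * U k x"
  using assms
proof (induction k arbitrary: x rule: inc_induct)
  case base
  show ?case
    by (rule order_trans[OF _ eq_refl[OF nn_integral_Z_add_U_Suc]]) simp
next
  case (step k)
  let ?Y = "{Suc (x k), x k - 1}"
  have "(\<Sum>n=Suc k..N. \<integral>\<^sup>+\<omega>. indicator (cyl k x) \<omega> * Z n \<omega> \<partial>M) =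
     (\<Sum>n=Suc k..N. \<Sum>y\<in>?Y. \<integral>\<^sup>+\<omega>. indicator (cyl (Suc k) (x(Suc k := y))) \<omega> * Z n \<omega> \<partial>M)"
  proof (rule sum.cong[OF refl])
    fix n
    have "(\<integral>\<^sup>+\<omega>. indicator (cyl k x) \<omega> * Z n \<omega> \<partial>M) =
      (\<integral>\<^sup>+\<omega>. (\<Sum>y\<in>?Y. indicator (cyl (Suc k) (x(Suc k := y))) \<omega> * Z n \<omega>) \<partial>M)"
    proof (rule nn_integral_cong_AE)
      show "AE \<omega> in M. indicator (cyl k x) \<omega> * Z n \<omega> = (\<Sum>y\<in>?Y. indicator (cyl (Suc k) (x(Suc k := y))) \<omega> * Z n \<omega>)"
        using AE_cyl_split[of k x] by eventually_elim (simp only: sum_distrib_right)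
    qed
    also have "\<dots> = (\<Sum>y\<in>?Y. \<integral>\<^sup>+\<omega>. indicator (cyl (Suc k) (x(Suc k := y))) \<omega> * Z n \<omega> \<partial>M)"
      by (rule nn_integral_sum) measurable
    finally show "(\<integral>\<^sup>+\<omega>. indicator (cyl k x) \<omega> * Z n \<omega> \<partial>M) = \<dots>" .
  qed
  also have "\<dots> = (\<Sum>y\<in>?Y. \<Sum>n=Suc k..N. \<integral>\<^sup>+\<omega>. indicator (cyl (Suc k) (x(Suc k := y))) \<omega> * Z n \<omega> \<partial>M)"
    by (rule sum.swap)
  also have "\<dots> \<le> (\<Sum>y\<in>?Y. ennreal (path_prob k x * bd_trans lam mu (x k) y * g y) * U (Suc k) x)"
  proof (rule sum_mono)
    fix y
    have U: "U (Suc k) (x(Suc k := y)) = U (Suc k) x" by (rule U_cong) auto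
    have eq: "path_prob (Suc k) (x(Suc k := y)) * g ((x(Suc k := y)) (Suc k)) = path_prob k x * bd_trans lam mu (x k) y * g y"
      by (simp add: path_prob_Suc_upd)
    have "(\<Sum>n=Suc k..N. \<integral>\<^sup>+\<omega>. indicator (cyl (Suc k) (x(Suc k := y))) \<omega> * Z n \<omega> \<partial>M) \<le>
       ennreal (path_prob (Suc k) (x(Suc k := y)) * g ((x(Suc k := y)) (Suc k))) * U (Suc k) (x(Suc k := y))"
      by (rule step.IH)
    also have "\<dots> = ennreal (path_prob k x * bd_trans lam mu (x k) y * g y) * U (Suc k) x"
      by (intro arg_cong2[where f = "(*)"] arg_cong[where f = ennreal] eq U)
    finally show "(\<Sum>n=Suc k..N. \<integral>\<^sup>+\<omega>. indicator (cyl (Suc k) (x(Suc k := y))) \<omega> * Z n \<omega> \<partial>M) \<le>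
       ennreal (path_prob k x * bd_trans lam mu (x k) y * g y) * U (Suc k) x" .
  qed
  finally have tail: "(\<Sum>n=Suc k..N. \<integral>\<^sup>+\<omega>. indicator (cyl k x) \<omega> * Z n \<omega> \<partial>M) \<le>
      (\<Sum>y\<in>?Y. ennreal (path_prob k x * bd_trans lam mu (x k) y * g y) * U (Suc k) x)" .
  have head: "(\<Sum>n=k..N. \<integral>\<^sup>+\<omega>. indicator (cyl k x) \<omega> * Z n \<omega> \<partial>M) =
     (\<integral>\<^sup>+\<omega>. indicator (cyl k x) \<omega> * Z k \<omega> \<partial>M) + (\<Sum>n=Suc k..N. \<integral>\<^sup>+\<omega>. indicator (cyl k x) \<omega> * Z n \<omega> \<partial>M)"
    using step.hyps by (subst sum.atLeast_Suc_atMost) auto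
  show ?case
    by (subst head, subst nn_integral_Z_add_U_Suc[of k x, symmetric]) (rule add_left_mono[OF tail])
qed

text \<open>Every finite partial sum is bounded by the telescoped value at the start, where
  \<open>U\<close> is an integral over no holding times and equals 1. The discarded remainder
  contains the mass lost by explosion, whence an inequality.\<close>

lemma nn_integral_suminf_Z_le: "(\<integral>\<^sup>+\<omega>. (\<Sum>n. Z n \<omega>) \<partial>M) \<le> ennreal (g x0)"
proof -
  have full: "AE \<omega> in M. \<omega> \<in> cyl 0 (\<lambda>_. x0)"
    by (subst prob_eq_1[symmetric]) (auto simp: prob_cyl path_prob_def)
  have U0: "U 0 x = 1" for x
    unfolding U_def using T_nonneg by (simp add: nn_integral_count_space PiM_empty)
  have "(\<Sum>n<N. \<integral>\<^sup>+\<omega>. Z n \<omega> \<partial>M) \<le> ennreal (g x0)" for N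
  proof -
    have "(\<Sum>n<N. \<integral>\<^sup>+\<omega>. Z n \<omega> \<partial>M) \<le> (\<Sum>n=0..N. \<integral>\<^sup>+\<omega>. Z n \<omega> \<partial>M)"
      by (rule sum_mono2) auto
    also have "\<dots> = (\<Sum>n=0..N. \<integral>\<^sup>+\<omega>. indicator (cyl 0 (\<lambda>_. x0)) \<omega> * Z n \<omega> \<partial>M)"
      using full by (intro sum.cong nn_integral_cong_AE) auto
    also have "\<dots> \<le> ennreal (path_prob 0 (\<lambda>_. x0) * g x0) * U 0 (\<lambda>_. x0)"
      by (rule sum_nn_integral_Z_le) simp
    finally show ?thesis by (simp add: U0 path_prob_def)
  qed
  then have "(\<Sum>n. \<integral>\<^sup>+\<omega>. Z n \<omega> \<partial>M) \<le> ennreal (g x0)"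
    by (subst suminf_eq_SUP) (rule SUP_least)
  then show ?thesis by (subst nn_integral_suminf) auto
qed

text \<open>Markov's inequality for the sum of the \<open>Z n\<close>, which dominates each
  summand.\<close>

lemma prob_le_of_Z_ge:
  assumes B: "B > 0" and E: "E \<in> sets M" and Z: "\<And>\<omega>. \<omega> \<in> E \<Longrightarrow> \<exists>n. Z n \<omega> \<ge> ennreal B"
  shows "prob E \<le> g x0 / B"
proof -
  have "ennreal B * emeasure M E = (\<integral>\<^sup>+\<omega>. ennreal B * indicator E \<omega> \<partial>M)"
    using E by (simp add: nn_integral_cmult_indicator)
  also have "\<dots> \<le> (\<integral>\<^sup>+\<omega>. (\<Sum>n. Z n \<omega>) \<partial>M)"
  proof (rule nn_integral_mono)
    fix \<omega>
    show "ennreal B * indicator E \<omega> \<le> (\<Sum>n. Z n \<omega>)"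
    proof (cases "\<omega> \<in> E")
      case True
      then obtain n where "Z n \<omega> \<ge> ennreal B" using Z by blast
      also have "Z n \<omega> \<le> (\<Sum>n. Z n \<omega>)" 
        using sum_le_suminf[of "\<lambda>n. Z n \<omega>" "{n}"] by simp
      finally show ?thesis using True by simp
    qed simp
  qed
  also note nn_integral_suminf_Z_le
  finally have "ennreal (B * prob E) \<le> ennreal (g x0)"
    using B by (simp add: emeasure_eq_measure ennreal_mult)
  then have "B * prob E \<le> g x0"
    using g_pos[of x0] by (simp add: ennreal_le_iff)
  then show ?thesis using B by (simp add: pos_le_divide_eq mult.commute)
qed

end

section \<open>Lattice paths\<close>

text \<open>The bound is assumed only to the left of \<open>b\<close>; changing the integrand at
  that one point does not affect the integral.\<close>

lemma integral_le_const_Ico: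
  fixes F :: "real \<Rightarrow> real"
  assumes F: "continuous_on {a..b} F" and ab: "a \<le> b" and \<kappa>: "\<And>u. a \<le> u \<Longrightarrow> u < b \<Longrightarrow> F u \<le> \<kappa>"
  shows "integral {a..b} F \<le> \<kappa> * (b - a)"
proof -
  have int: "F integrable_on {a..b}" by (rule integrable_continuous_real[OF F])
  have "integral {a..b} F = integral {a..b} (\<lambda>u. if u = b then \<kappa> else F u)"
    by (rule integral_spike[of "{b}"]) auto
  also have "\<dots> \<le> integral {a..b} (\<lambda>u. \<kappa>)"
  proof (rule integral_le)
    show "(\<lambda>u. if u = b then \<kappa> else F u) integrable_on {a..b}"
      by (rule integrable_spike[OF int, of "{b}"]) auto
  qed (use \<kappa> in auto)
  finally show ?thesis using ab by (simp add: mult.commute)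
qed

lemma integral_le_step_sum:
  fixes F :: "real \<Rightarrow> real" and s \<kappa> :: "nat \<Rightarrow> real"
  assumes F: "continuous_on {0..1} F" and T: "T > 0" and s: "\<And>k. s k \<ge> 0"
    and n: "(\<Sum>i<n. s i) \<le> T" "T \<le> (\<Sum>i<Suc n. s i)"
    and \<kappa>: "\<And>k u. k \<le> n \<Longrightarrow> (\<Sum>i<k. s i) \<le> u \<Longrightarrow> u < (\<Sum>i<Suc k. s i) \<Longrightarrow> u \<le> T \<Longrightarrow> F (u / T) \<le> \<kappa> k"
  shows "T * integral {0..1} F \<le> (\<Sum>k<n. \<kappa> k * s k) + \<kappa> n * (T - (\<Sum>i<n. s i))"
proof -
  define \<tau> where "\<tau> = (\<lambda>k. \<Sum>i<k. s i)"
  have \<tau>_mono: "\<tau> j \<le> \<tau> k" if "j \<le> k" for j k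
    unfolding \<tau>_def using that s by (intro sum_mono2) auto
  have \<tau>_nonneg: "0 \<le> \<tau> k" for k unfolding \<tau>_def using s by (intro sum_nonneg) auto
  have piece: "T * integral {0..b / T} F \<le> T * integral {0..a / T} F + q * (b - a)"
    if ab: "0 \<le> a" "a \<le> b" "b \<le> T" and q: "\<And>u. a \<le> u \<Longrightarrow> u < b \<Longrightarrow> F (u / T) \<le> q" for a b q
  proof -
    have I: "0 \<le> a / T" "a / T \<le> b / T" "b / T \<le> 1" using ab T by (auto simp: field_simps)
    have "integral {0..a / T} F + integral {a / T..b / T} F = integral {0..b / T} F"
      using I by (intro Henstock_Kurzweil_Integration.integral_combine integrable_continuous_real continuous_on_subset[OF F]) auto
    moreover have "integral {a / T..b / T} F \<le> q * (b / T - a / T)"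
    proof (rule integral_le_const_Ico)
      fix u assume "a / T \<le> u" "u < b / T"
      then show "F u \<le> q" using q[of "u * T"] T by (simp add: field_simps)
    qed (use I in \<open>auto intro: continuous_on_subset[OF F]\<close>)
    then have "T * integral {a / T..b / T} F \<le> T * (q * (b / T - a / T))" using T by simp
    moreover have "T * (q * (b / T - a / T)) = q * (b - a)" using T by (simp add: field_simps)
    ultimately show ?thesis by (metis add_left_mono distrib_left)
  qed
  have "T * integral {0..\<tau> k / T} F \<le> (\<Sum>i<k. \<kappa> i * s i)" if "k \<le> n" for k
    using that
  proof (induction k)
    case 0
    then show ?case by (simp add: \<tau>_def)
  next
    case (Suc k)
    have "\<tau> (Suc k) \<le> T" using \<tau>_mono[OF Suc.prems] n(1) by (simp add: \<tau>_def)
    then have "T * integral {0..\<tau> (Suc k) / T} F \<le> T * integral {0..\<tau> k / T} F + \<kappa> k * (\<tau> (Suc k) - \<tau> k)"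
      using Suc.prems \<tau>_mono[of k "Suc k"] \<tau>_nonneg
      by (intro piece) (auto simp: \<tau>_def intro!: \<kappa>)
    with Suc show ?case by (simp add: \<tau>_def)
  qed
  from this[of n] have "T * integral {0..\<tau> n / T} F \<le> (\<Sum>i<n. \<kappa> i * s i)" by simp
  moreover have "T * integral {0..T / T} F \<le> T * integral {0..\<tau> n / T} F + \<kappa> n * (T - \<tau> n)"
    using n \<tau>_nonneg by (intro piece) (auto simp: \<tau>_def intro!: \<kappa>)
  ultimately show ?thesis using T by (simp add: \<tau>_def)
qed

text \<open>The path takes the rounded grid value of \<open>\<rho> * f\<close> at the right end of
  each of \<open>K\<close> cells: at the start of a cell it jumps there monotonically without
  waiting, and then stays for the whole cell. Holding times 0 are allowed, as they only serve as
  lower ends of time windows. Each cell needs at most \<rho> B jumps.\<close>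

lemma lattice_path_exists:
  fixes f :: "real \<Rightarrow> real"
  assumes f: "continuous_on {0..1} f" and f0: "f 0 = 0" and f_nonneg: "\<And>t. 0 \<le> t \<Longrightarrow> t \<le> 1 \<Longrightarrow> f t \<ge> 0"
    and \<eta>: "\<eta> > 0"
  shows "\<exists>C>0. \<forall>\<^sub>F \<rho> in at_top. \<forall>T>0. \<exists>n (x :: nat \<Rightarrow> nat) s. x 0 = 0 \<and> real n \<le> C * \<rho> \<and>
     (\<forall>i<n. x (Suc i) = Suc (x i) \<or> x i = Suc (x (Suc i))) \<and> (\<forall>i. 0 \<le> s i) \<and> (\<Sum>i<Suc n. s i) = T \<and>
     (\<forall>i\<le>n. \<forall>u. (\<Sum>k<i. s k) \<le> u \<and> u \<le> (\<Sum>k<Suc i. s k) \<longrightarrow> \<bar>real (x i) / \<rho> - f (u / T)\<bar> \<le> \<eta>)"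
proof -
  have "uniformly_continuous_on {0..1} f"
    by (rule compact_uniformly_continuous[OF f]) auto
  then obtain \<delta> where \<delta>: "\<delta> > 0" and
    uc: "\<And>a b. a \<in> {0..1} \<Longrightarrow> b \<in> {0..1} \<Longrightarrow> \<bar>a - b\<bar> < \<delta> \<Longrightarrow> \<bar>f a - f b\<bar> < \<eta> / 3"
    using \<eta> unfolding uniformly_continuous_on_def dist_real_def
    by (metis zero_less_divide_iff zero_less_numeral)
  \<comment> \<open>\<open>f\<close> oscillates by less than a third of \<eta> over one grid
    cell.\<close>
  obtain K :: nat where K: "K > 0" "1 / real K < \<delta>"
    using \<delta> by (metis nat_approx_posE of_nat_0_less_iff zero_less_Suc)
  have "bounded (f ` {0..1})"
    by (intro compact_imp_bounded compact_continuous_image f) auto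
  then obtain B where B: "B > 0" "\<And>t. t \<in> {0..1} \<Longrightarrow> f t \<le> B"
    unfolding bounded_pos by (metis abs_le_iff image_eqI real_norm_def)
  have "\<forall>\<^sub>F \<rho> in at_top. \<forall>T>0. \<exists>n (x :: nat \<Rightarrow> nat) s. x 0 = 0 \<and> real n \<le> real K * B * \<rho> \<and>
     (\<forall>i<n. x (Suc i) = Suc (x i) \<or> x i = Suc (x (Suc i))) \<and> (\<forall>i. 0 \<le> s i) \<and> (\<Sum>i<Suc n. s i) = T \<and>
     (\<forall>i\<le>n. \<forall>u. (\<Sum>k<i. s k) \<le> u \<and> u \<le> (\<Sum>k<Suc i. s k) \<longrightarrow> \<bar>real (x i) / \<rho> - f (u / T)\<bar> \<le> \<eta>)"
    using eventually_ge_at_top[of "3 / \<eta>"] eventually_gt_at_top[of 0]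
  proof eventually_elim
    case (elim \<rho>)
    show ?case
    proof (intro allI impI)
      fix T :: real assume T: "T > 0"
      \<comment> \<open>Rounding down costs less than one lattice unit, which is at most a third of
        \<eta> after scaling; \<open>a 0 = 0\<close> because \<open>f 0 = 0\<close>.\<close>
      define a where "a = (\<lambda>j::nat. nat \<lfloor>\<rho> * f (real j / real K)\<rfloor>)"
      have jK: "real j / real K \<in> {0..1}" if "j \<le> K" for j using that K by auto
      have a_le: "real (a j) \<le> \<rho> * f (real j / real K)" and a_ge: "real (a j) \<ge> \<rho> * f (real j / real K) - 1" if "j \<le> K" for j
      proof -
        have "\<rho> * f (real j / real K) \<ge> 0" using jK[OF that] elim f_nonneg by simp
        then show "real (a j) \<le> \<rho> * f (real j / real K)" "real (a j) \<ge> \<rho> * f (real j / real K) - 1"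
          unfolding a_def by linarith+
      qed
      have a_B: "real (a j) \<le> \<rho> * B" if "j \<le> K" for j
        using a_le[OF that] mult_left_mono[OF B(2)[OF jK[OF that]], of \<rho>] elim by linarith
      \<comment> \<open>All lattice values between two neighbouring grid levels stay in the tube
        during the whole cell, so both the waiting state and the states passed on the way to it are
        covered.\<close>
      have W: "\<bar>real w / \<rho> - f (u / T)\<bar> \<le> \<eta>"
        if j: "Suc j \<le> K" and u: "real j * T / real K \<le> u" "u \<le> real (Suc j) * T / real K"
          and w: "min (a j) (a (Suc j)) \<le> w" "w \<le> max (a j) (a (Suc j))" for j u w
      proof -
        have ut: "real j / real K \<le> u / T" "u / T \<le> real (Suc j) / real K"
          using u T K by (auto simp: field_simps)
        have uT: "u / T \<in> {0..1}"
        proof -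
          have "real (Suc j) / real K \<le> 1" using jK[OF j] by simp
          moreover have "0 \<le> real j / real K" by simp
          ultimately show ?thesis using ut by (simp only: atLeastAtMost_iff) linarith
        qed
        have gap: "real (Suc j) / real K = real j / real K + 1 / real K" by (simp add: add_divide_distrib)
        have "\<bar>u / T - real j / real K\<bar> < \<delta>" "\<bar>u / T - real (Suc j) / real K\<bar> < \<delta>"
          using ut K(2) gap by linarith+
        then have c: "\<bar>f (u / T) - f (real j / real K)\<bar> < \<eta> / 3" "\<bar>f (u / T) - f (real (Suc j) / real K)\<bar> < \<eta> / 3"
          using uc[OF uT] jK j by auto
        have \<rho>\<eta>: "1 \<le> \<rho> * (\<eta> / 3)" using elim \<eta> by (simp add: field_simps)
        have "real w \<le> \<rho> * (f (u / T) + \<eta> / 3)"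
        proof -
          have "\<rho> * f (real j / real K) \<le> \<rho> * (f (u / T) + \<eta> / 3)" "\<rho> * f (real (Suc j) / real K) \<le> \<rho> * (f (u / T) + \<eta> / 3)"
            using c elim by (intro mult_left_mono; linarith)+
          then have "real (a j) \<le> \<rho> * (f (u / T) + \<eta> / 3)" "real (a (Suc j)) \<le> \<rho> * (f (u / T) + \<eta> / 3)"
            using a_le[of j] a_le[of "Suc j"] j by linarith+
          with w(2) show ?thesis by (auto simp: max_def split: if_splits)
        qed
        moreover have "real w \<ge> \<rho> * (f (u / T) - 2 * \<eta> / 3)"
        proof -
          have "\<rho> * (f (u / T) - \<eta> / 3) \<le> \<rho> * f (real j / real K)" "\<rho> * (f (u / T) - \<eta> / 3) \<le> \<rho> * f (real (Suc j) / real K)"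
            using c elim by (intro mult_left_mono; linarith)+
          then have "\<rho> * (f (u / T) - \<eta> / 3) - \<rho> * (\<eta> / 3) \<le> real (a j)" "\<rho> * (f (u / T) - \<eta> / 3) - \<rho> * (\<eta> / 3) \<le> real (a (Suc j))"
            using a_ge[of j] a_ge[of "Suc j"] j \<rho>\<eta> by linarith+
          with w(1) show ?thesis by (auto simp: min_def algebra_simps split: if_splits)
        qed
        ultimately have "real w / \<rho> \<le> f (u / T) + \<eta> / 3" "real w / \<rho> \<ge> f (u / T) - 2 * \<eta> / 3"
          using elim by (simp_all add: pos_divide_le_eq pos_le_divide_eq mult.commute)
        then show ?thesis using \<eta> by (simp add: abs_le_iff)
      qed
      \<comment> \<open>The holding times beyond \<open>n\<close> are kept at 0, so that appending
        states without waiting leaves the partial sums unchanged.\<close>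
      have P: "\<exists>n (x :: nat \<Rightarrow> nat) s. x 0 = 0 \<and> real n \<le> real j * (\<rho> * B) \<and>
         (\<forall>i<n. x (Suc i) = Suc (x i) \<or> x i = Suc (x (Suc i))) \<and> (\<forall>i. 0 \<le> s i) \<and> (\<forall>i>n. s i = 0) \<and>
         x n = a j \<and> (\<Sum>i<Suc n. s i) = real j * T / real K \<and>
         (\<forall>i\<le>n. \<forall>u. (\<Sum>k<i. s k) \<le> u \<and> u \<le> (\<Sum>k<Suc i. s k) \<longrightarrow> \<bar>real (x i) / \<rho> - f (u / T)\<bar> \<le> \<eta>)"
        if "j \<le> K" for j
        using that
      proof (induction j)
        case 0
        show ?case
          by (intro exI[of _ 0] exI[of _ "\<lambda>_. 0"]) (use \<eta> f0 in \<open>auto simp: a_def\<close>)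
      next
        case (Suc j)
        then obtain n x s where x0: "x 0 = (0::nat)" and n: "real n \<le> real j * (\<rho> * B)"
          and adj: "\<And>i. i < n \<Longrightarrow> x (Suc i) = Suc (x i) \<or> x i = Suc (x (Suc i))"
          and s: "\<And>i. (0::real) \<le> s i" "\<And>i. i > n \<Longrightarrow> s i = 0"
          and xn: "x n = a j" and sum_s: "(\<Sum>i<Suc n. s i) = real j * T / real K"
          and tube: "\<And>i u. i \<le> n \<Longrightarrow> (\<Sum>k<i. s k) \<le> u \<Longrightarrow> u \<le> (\<Sum>k<Suc i. s k) \<Longrightarrow> \<bar>real (x i) / \<rho> - f (u / T)\<bar> \<le> \<eta>"
          by (metis Suc_leD)
        define d where "d = (if a j \<le> a (Suc j) then a (Suc j) - a j else a j - a (Suc j))"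
        define n' where "n' = n + d"
        define x' where "x' = (\<lambda>i. if i \<le> n then x i else if a j \<le> a (Suc j) then a j + (i - n) else a j - (i - n))"
        \<comment> \<open>The whole cell length goes to the last state; if no jump is made, the
          previous state waits longer.\<close>
        define s' where "s' = s(n' := s n' + T / real K)"
        have sum_beyond: "(\<Sum>k<i. s k) = real j * T / real K" if "i > n" for i
        proof -
          have "(\<Sum>k<i. s k) = (\<Sum>k<Suc n. s k)"
            using that s(2) by (intro sum.mono_neutral_right) auto
          with sum_s show ?thesis by simp
        qed
        have sum': "(\<Sum>k<i. s' k) = (\<Sum>k<i. s k)" if "i \<le> n'" for i
          unfolding s'_def using that by (intro sum.cong) auto
        have sum_top: "(\<Sum>k<Suc n'. s' k) = real (Suc j) * T / real K"
        proof -
          have "(\<Sum>k<Suc n'. s' k) = (\<Sum>k<n'. s k) + s' n'" using sum'[of n'] by simp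
          also have "\<dots> = (\<Sum>k<Suc n'. s k) + T / real K" by (simp add: s'_def)
          also have "(\<Sum>k<Suc n'. s k) = real j * T / real K" by (rule sum_beyond) (simp add: n'_def)
          finally show ?thesis by (simp add: add_divide_distrib algebra_simps)
        qed
        have between: "min (a j) (a (Suc j)) \<le> x' i" "x' i \<le> max (a j) (a (Suc j))" if "n \<le> i" "i \<le> n'" for i
          using that xn unfolding x'_def n'_def d_def by (auto simp: min_def max_def split: if_splits)
        show ?case
        proof (intro exI[of _ n'] exI[of _ x'] exI[of _ s'] conjI allI impI)
          show "x' 0 = 0" by (simp add: x'_def x0)
          have "real d \<le> \<rho> * B"
            using a_B[of j] a_B[of "Suc j"] Suc.prems unfolding d_def by (auto split: if_splits)
          then show "real n' \<le> real (Suc j) * (\<rho> * B)" using n by (simp add: n'_def algebra_simps)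
          show "x' (Suc i) = Suc (x' i) \<or> x' i = Suc (x' (Suc i))" if "i < n'" for i
          proof (cases "i < n")
            case True
            then show ?thesis using adj[of i] by (simp add: x'_def)
          next
            case False
            then consider "i = n" | "i > n" by linarith
            then show ?thesis
            proof cases
              case 1
              show ?thesis using that xn unfolding x'_def n'_def d_def 1 by (auto split: if_splits)
            next
              case 2
              then show ?thesis using that unfolding x'_def n'_def d_def by (auto split: if_splits)
            qed
          qed
          show "0 \<le> s' i" for i using s(1)[of i] s(1)[of n'] T K by (simp add: s'_def)
          show "s' i = 0" if "n' < i" for i using that s(2)[of i] by (simp add: s'_def n'_def)
          show "x' n' = a (Suc j)" using xn unfolding x'_def n'_def d_def by auto
          show "(\<Sum>i<Suc n'. s' i) = real (Suc j) * T / real K" by (rule sum_top)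
          fix i u assume i: "i \<le> n'" and u: "(\<Sum>k<i. s' k) \<le> u \<and> u \<le> (\<Sum>k<Suc i. s' k)"
          have u1: "(\<Sum>k<i. s k) \<le> u" using u sum'[OF i] by simp
          have u2: "u \<le> (\<Sum>k<Suc i. s k)" if "i < n'" using u sum'[of "Suc i"] that by (simp only: Suc_leI) 
          show "\<bar>real (x' i) / \<rho> - f (u / T)\<bar> \<le> \<eta>"
          proof (cases "i \<le> n \<and> u \<le> (\<Sum>k<Suc i. s k)")
            case True
            then show ?thesis using tube[of i u] u1 by (simp add: x'_def)
          next
            case False
            \<comment> \<open>What the induction hypothesis leaves open is an appended state, or the
              old last state at a time after the old total.\<close>
            have in': "n \<le> i" using False u2 n'_def by fastforce
            have uj: "real j * T / real K \<le> u"
            proof (cases "n < i")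
              case True
              then show ?thesis using sum_beyond u1 by simp
            next
              case False': False
              then have "i = n" using in' by simp
              then show ?thesis using False sum_s by simp
            qed
            have uj': "u \<le> real (Suc j) * T / real K"
            proof (cases "i < n'")
              case True
              have "(\<Sum>k<Suc i. s k) = real j * T / real K" by (rule sum_beyond) (use in' in simp)
              then have "u \<le> real j * T / real K" using u2 True by simp
              also have "\<dots> \<le> real (Suc j) * T / real K" using T K by (simp add: field_simps)
              finally show ?thesis .
            next
              case False
              then show ?thesis using u i sum_top by simp
            qed
            show ?thesis by (rule W[OF Suc.prems uj uj' between[OF in' i]])
          qed
        qed
      qed
      from P[of K] K show "\<exists>n (x :: nat \<Rightarrow> nat) s. x 0 = 0 \<and> real n \<le> real K * B * \<rho> \<and>
        (\<forall>i<n. x (Suc i) = Suc (x i) \<or> x i = Suc (x (Suc i))) \<and> (\<forall>i. 0 \<le> s i) \<and> (\<Sum>i<Suc n. s i) = T \<and>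
        (\<forall>i\<le>n. \<forall>u. (\<Sum>k<i. s k) \<le> u \<and> u \<le> (\<Sum>k<Suc i. s k) \<longrightarrow> \<bar>real (x i) / \<rho> - f (u / T)\<bar> \<le> \<eta>)"
        by (simp only: order_refl nonzero_mult_div_cancel_left of_nat_0_eq_iff mult.assoc mult.commute[of \<rho> B]) (metis K(1) less_irrefl)
    qed
  qed
  then show ?thesis using K(1) B(1) by (intro exI[of _ "real K * B"]) auto
qed

lemma holding_interval:
  fixes s :: "nat \<Rightarrow> real"
  assumes "0 \<le> u" "u < (\<Sum>i<N. s i)"
  shows "\<exists>k<N. (\<Sum>i<k. s i) \<le> u \<and> u < (\<Sum>i<Suc k. s i)"
  using assms
proof (induction N)
  case (Suc N)
  show ?case
  proof (cases "u < (\<Sum>i<N. s i)")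
    case True
    then show ?thesis using Suc by (metis less_Suc_eq)
  next
    case False
    then show ?thesis using Suc by (intro exI[of _ N]) auto
  qed
qed simp

text \<open>The left-open version is meant for left limits, where a jump time belongs to the
  interval that it ends.\<close>

lemma holding_interval_left:
  fixes s :: "nat \<Rightarrow> real"
  assumes "0 < u" "u \<le> (\<Sum>i<N. s i)"
  shows "\<exists>k<N. (\<Sum>i<k. s i) < u \<and> u \<le> (\<Sum>i<Suc k. s i)"
  using assms
proof (induction N)
  case (Suc N)
  show ?case
  proof (cases "u \<le> (\<Sum>i<N. s i)")
    case True
    then show ?thesis using Suc by (metis less_Suc_eq)
  next
    case False
    then show ?thesis using Suc by (intro exI[of _ N]) auto
  qed
qed simp

text \<open>Absence of explosion, in the form of \<open>N\<close>, places every time in an interval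
  of constancy, so the function is constant just to the right of each point and just to its
  left.\<close>

lemma step_path_D01:
  fixes s v :: "nat \<Rightarrow> real"
  assumes T: "T > 0" and N: "T < (\<Sum>i<N. s i)"
    and g: "\<And>t k. 0 \<le> t \<Longrightarrow> t \<le> 1 \<Longrightarrow> (\<Sum>i<k. s i) \<le> t * T \<Longrightarrow> t * T < (\<Sum>i<Suc k. s i) \<Longrightarrow> g t = v k"
  shows "g \<in> D01"
  unfolding D01_def
proof (intro CollectI conjI ballI)
  fix t :: real assume t: "t \<in> {0..<1}"
  have "t * T \<le> 1 * T" using t T by (intro mult_right_mono) auto
  then have "t * T < (\<Sum>i<N. s i)" using N by linarith
  then obtain k where k: "(\<Sum>i<k. s i) \<le> t * T" "t * T < (\<Sum>i<Suc k. s i)"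
    using holding_interval[of "t * T" s N] t T by auto
  have "\<forall>\<^sub>F x in at_right t. x < min 1 ((\<Sum>i<Suc k. s i) / T) \<and> x > t"
    using t k T by (intro eventually_conj eventually_at_right_less)
      (auto simp: eventually_at_right[of t "min 1 ((\<Sum>i<Suc k. s i) / T)"] field_simps intro!: exI[of _ "min 1 ((\<Sum>i<Suc k. s i) / T)"])
  then have "\<forall>\<^sub>F x in at_right t. g x = g t"
  proof eventually_elim
    case (elim x)
    have "(\<Sum>i<k. s i) \<le> x * T" using k(1) elim mult_right_mono[of t x T] T by linarith
    moreover have "x * T < (\<Sum>i<Suc k. s i)" using elim T by (simp add: pos_less_divide_eq)
    ultimately have "g x = v k" using g[of x k] elim t by auto
    moreover have "g t = v k" using g[of t k] k t by auto
    ultimately show ?case by simp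
  qed
  then show "(g \<longlongrightarrow> g t) (at_right t)" by (rule tendsto_eventually)
next
  fix t :: real assume t: "t \<in> {0<..1}"
  have "t * T \<le> 1 * T" using t T by (intro mult_right_mono) auto
  then have "t * T \<le> (\<Sum>i<N. s i)" using N by linarith
  then obtain k where k: "(\<Sum>i<k. s i) < t * T" "t * T \<le> (\<Sum>i<Suc k. s i)"
    using holding_interval_left[of "t * T" s N] t T by auto
  have "max 0 ((\<Sum>i<k. s i) / T) < t" using t k T by (simp add: pos_divide_less_eq)
  then have "\<forall>\<^sub>F x in at_left t. x \<in> {max 0 ((\<Sum>i<k. s i) / T)<..<t}"
    by (rule eventually_at_left_real)
  then have "\<forall>\<^sub>F x in at_left t. g x = v k"
  proof eventually_elim
    case (elim x)
    have "(\<Sum>i<k. s i) \<le> x * T" using elim T by (auto simp: pos_divide_less_eq)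
    moreover have "x * T < (\<Sum>i<Suc k. s i)" 
    proof -
      have "x * T < t * T" using elim T by (intro mult_strict_right_mono) auto
      with k(2) show ?thesis by linarith
    qed
    ultimately show ?case using g[of x k] elim t by auto
  qed
  then show "\<exists>L. (g \<longlongrightarrow> L) (at_left t)" using tendsto_eventually by blast
qed

section \<open>The process as a random step path\<close>

locale jump_process = jump_chain +
  fixes \<xi> :: "real \<Rightarrow> 'a \<Rightarrow> nat option"
  assumes process_iff: "\<And>\<omega> t x. \<omega> \<in> space M \<Longrightarrow> t \<ge> 0 \<Longrightarrow>
    \<xi> t \<omega> = Some x \<longleftrightarrow> (\<exists>n. (\<Sum>k<n. S k \<omega>) \<le> t \<and> t < (\<Sum>k<Suc n. S k \<omega>) \<and> X n \<omega> = x)"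
begin

text \<open>The first condition is absence of explosion. The intermediate \<open>q\<close> is
  essential: a supremum below \<epsilon> is stronger than a strict bound at each time.\<close>

lemma path_event_iff:
  assumes T: "T > 0" and \<phi>: "\<phi> T > 0" and f: "continuous_on {0..1} f" and \<omega>: "\<omega> \<in> space M"
  shows "\<omega> \<in> path_event M (scaled_process \<xi> \<phi> T) (unif_nbhd \<epsilon> f) \<longleftrightarrow>
    (\<exists>N. T < (\<Sum>i<N. S i \<omega>)) \<and>
    (\<exists>q<\<epsilon>. \<forall>t\<in>{0..1}. \<forall>k. (\<Sum>i<k. S i \<omega>) \<le> t * T \<and> t * T < (\<Sum>i<Suc k. S i \<omega>) \<longrightarrow> \<bar>f t - real (X k \<omega>) / \<phi> T\<bar> \<le> q)"
    (is "?L \<longleftrightarrow> ?N \<and> ?Q")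
proof
  assume ?L
  then obtain g where g: "g \<in> D01" "unif_dist f g < \<epsilon>"
    and gt: "\<And>t. t \<in> {0..1} \<Longrightarrow> scaled_process \<xi> \<phi> T t \<omega> = Some (g t)"
    unfolding path_event_def unif_nbhd_def by auto
  have val: "g t = real (X k \<omega>) / \<phi> T"
    if "t \<in> {0..1}" "(\<Sum>i<k. S i \<omega>) \<le> t * T" "t * T < (\<Sum>i<Suc k. S i \<omega>)" for t k
  proof -
    have "\<xi> (t * T) \<omega> = Some (X k \<omega>)"
      using that T by (subst process_iff[OF \<omega>]) auto
    then show ?thesis using gt[OF that(1)] by (simp add: scaled_process_def)
  qed
  obtain x where "\<xi> T \<omega> = Some x"
    using gt[of 1] by (auto simp: scaled_process_def)
  then obtain n where "T < (\<Sum>k<Suc n. S k \<omega>)"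
    using process_iff[OF \<omega>, of T x] T by auto
  then obtain N where N: "T < (\<Sum>i<N. S i \<omega>)" by blast
  have "bounded (f ` {0..1})"
    by (intro compact_imp_bounded compact_continuous_image f) auto
  then obtain B where B: "\<And>t. t \<in> {0..1} \<Longrightarrow> \<bar>f t\<bar> \<le> B"
    unfolding bounded_pos by (metis image_eqI real_norm_def)
  \<comment> \<open>The real-valued \<open>SUP\<close> bounds its members only for bounded sets;
    here only the first \<open>N\<close> states occur up to time \<open>T\<close>.\<close>
  have bdd: "bdd_above ((\<lambda>t. \<bar>f t - g t\<bar>) ` {0..1})"
  proof (rule bdd_aboveI2)
    fix t :: real assume t: "t \<in> {0..1}"
    have "t * T \<le> 1 * T" using t T by (intro mult_right_mono) auto
    then have "t * T < (\<Sum>i<N. S i \<omega>)" using N by linarith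
    then obtain k where k: "k < N" "(\<Sum>i<k. S i \<omega>) \<le> t * T" "t * T < (\<Sum>i<Suc k. S i \<omega>)"
      using holding_interval[of "t * T" "\<lambda>i. S i \<omega>" N] t T by auto
    have "g t = real (X k \<omega>) / \<phi> T" by (rule val[OF t k(2,3)])
    moreover have "real (X k \<omega>) / \<phi> T \<le> (\<Sum>k<N. real (X k \<omega>) / \<phi> T)"
      using k(1) \<phi> by (intro member_le_sum) auto
    moreover have "real (X k \<omega>) / \<phi> T \<ge> 0" using \<phi> by simp
    ultimately show "\<bar>f t - g t\<bar> \<le> B + (\<Sum>k<N. real (X k \<omega>) / \<phi> T)"
      using B[OF t] by linarith
  qed
  have ?Q
  proof (intro exI[of _ "unif_dist f g"] conjI g(2) ballI allI impI)
    fix t k assume t: "t \<in> {0..1::real}" and k: "(\<Sum>i<k. S i \<omega>) \<le> t * T \<and> t * T < (\<Sum>i<Suc k. S i \<omega>)"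
    have "\<bar>f t - g t\<bar> \<le> unif_dist f g"
      unfolding unif_dist_def by (rule cSUP_upper[OF t bdd])
    then show "\<bar>f t - real (X k \<omega>) / \<phi> T\<bar> \<le> unif_dist f g"
      using val[OF t conjunct1[OF k] conjunct2[OF k]] by simp
  qed
  with N show "?N \<and> ?Q" by blast
next
  assume "?N \<and> ?Q"
  then obtain N q where N: "T < (\<Sum>i<N. S i \<omega>)" and q: "q < \<epsilon>"
    and Q: "\<And>t k. t \<in> {0..1} \<Longrightarrow> (\<Sum>i<k. S i \<omega>) \<le> t * T \<Longrightarrow> t * T < (\<Sum>i<Suc k. S i \<omega>) \<Longrightarrow> \<bar>f t - real (X k \<omega>) / \<phi> T\<bar> \<le> q"
    by auto
  \<comment> \<open>The value 0 is a default for exploded paths; on the unit interval it never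
    occurs, since \<open>N\<close> excludes explosion by time \<open>T\<close>.\<close>
  define g where "g = (\<lambda>t. case \<xi> (t * T) \<omega> of Some x \<Rightarrow> real x / \<phi> T | None \<Rightarrow> 0)"
  have xi: "\<xi> (t * T) \<omega> = Some (X k \<omega>)"
    if "0 \<le> t" "(\<Sum>i<k. S i \<omega>) \<le> t * T" "t * T < (\<Sum>i<Suc k. S i \<omega>)" for t k
    using that T by (subst process_iff[OF \<omega>]) auto
  have val: "g t = real (X k \<omega>) / \<phi> T"
    if "0 \<le> t" "(\<Sum>i<k. S i \<omega>) \<le> t * T" "t * T < (\<Sum>i<Suc k. S i \<omega>)" for t k
    using xi[OF that] by (simp add: g_def)
  have ex: "\<exists>k. (\<Sum>i<k. S i \<omega>) \<le> t * T \<and> t * T < (\<Sum>i<Suc k. S i \<omega>)" if t: "t \<in> {0..1}" for t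
  proof -
    have "t * T \<le> 1 * T" using t T by (intro mult_right_mono) auto
    then have "t * T < (\<Sum>i<N. S i \<omega>)" using N by linarith
    then show ?thesis
      using holding_interval[of "t * T" "\<lambda>i. S i \<omega>" N] t T by auto
  qed
  have "g \<in> D01"
    by (rule step_path_D01[OF T N, where v = "\<lambda>k. real (X k \<omega>) / \<phi> T"]) (rule val)
  moreover have "unif_dist f g \<le> q"
    unfolding unif_dist_def
  proof (rule cSUP_least)
    fix t :: real assume t: "t \<in> {0..1}"
    obtain k where k: "(\<Sum>i<k. S i \<omega>) \<le> t * T" "t * T < (\<Sum>i<Suc k. S i \<omega>)" using ex[OF t] by blast
    show "\<bar>f t - g t\<bar> \<le> q" using Q[OF t k] val[OF _ k] t by simp
  qed simp
  moreover have "scaled_process \<xi> \<phi> T t \<omega> = Some (g t)" if t: "t \<in> {0..1}" for t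
  proof -
    obtain k where k: "(\<Sum>i<k. S i \<omega>) \<le> t * T" "t * T < (\<Sum>i<Suc k. S i \<omega>)" using ex[OF t] by blast
    show ?thesis using xi[OF _ k] val[OF _ k] t by (simp add: scaled_process_def)
  qed
  ultimately show ?L
    using q \<omega> unfolding path_event_def unif_nbhd_def by (auto intro!: bexI[of _ g])
qed

text \<open>By right-continuity of the path it suffices to test rational times.\<close>

lemma path_event_sets:
  assumes T: "T > 0" and \<phi>: "\<phi> T > 0" and f: "continuous_on {0..1} f"
  shows "path_event M (scaled_process \<xi> \<phi> T) (unif_nbhd \<epsilon> f) \<in> sets M"
proof -
  let ?P = "\<lambda>\<omega>. (\<exists>N. T < (\<Sum>i<N. S i \<omega>)) \<and>
    (\<exists>q::rat. of_rat q < \<epsilon> \<and> (\<forall>t::rat. 0 \<le> t \<and> t \<le> 1 \<longrightarrow>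
      (\<forall>k. (\<Sum>i<k. S i \<omega>) \<le> of_rat t * T \<and> of_rat t * T < (\<Sum>i<Suc k. S i \<omega>) \<longrightarrow>
         \<bar>f (of_rat t) - real (X k \<omega>) / \<phi> T\<bar> \<le> of_rat q)))"
  have "path_event M (scaled_process \<xi> \<phi> T) (unif_nbhd \<epsilon> f) = {\<omega>\<in>space M. ?P \<omega>}"
  proof (intro set_eqI iffI)
    fix \<omega> assume L: "\<omega> \<in> path_event M (scaled_process \<xi> \<phi> T) (unif_nbhd \<epsilon> f)"
    then have \<omega>: "\<omega> \<in> space M" by (simp add: path_event_def)
    from L obtain N q where N: "T < (\<Sum>i<N. S i \<omega>)" and q: "q < \<epsilon>"
      and Q: "\<And>t k. t \<in> {0..1} \<Longrightarrow> (\<Sum>i<k. S i \<omega>) \<le> t * T \<Longrightarrow> t * T < (\<Sum>i<Suc k. S i \<omega>) \<Longrightarrow> \<bar>f t - real (X k \<omega>) / \<phi> T\<bar> \<le> q"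
      unfolding path_event_iff[where \<phi> = \<phi>, OF T \<phi> f \<omega>] by blast
    obtain r :: rat where r: "q < of_rat r" "of_rat r < \<epsilon>" using q of_rat_dense by blast
    have "\<bar>f (of_rat t) - real (X k \<omega>) / \<phi> T\<bar> \<le> of_rat r"
      if "0 \<le> t" "t \<le> 1" "(\<Sum>i<k. S i \<omega>) \<le> of_rat t * T" "of_rat t * T < (\<Sum>i<Suc k. S i \<omega>)" for t k
      using Q[of "of_rat t" k] that r by auto
    with N r \<omega> show "\<omega> \<in> {\<omega>\<in>space M. ?P \<omega>}" by blast
  next
    fix \<omega> assume "\<omega> \<in> {\<omega>\<in>space M. ?P \<omega>}"
    then obtain N r where \<omega>: "\<omega> \<in> space M" and N: "T < (\<Sum>i<N. S i \<omega>)" and r: "of_rat r < \<epsilon>"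
      and R: "\<And>t k. 0 \<le> t \<Longrightarrow> t \<le> 1 \<Longrightarrow> (\<Sum>i<k. S i \<omega>) \<le> of_rat t * T \<Longrightarrow> of_rat t * T < (\<Sum>i<Suc k. S i \<omega>) \<Longrightarrow>
         \<bar>f (of_rat t) - real (X k \<omega>) / \<phi> T\<bar> \<le> of_rat r"
      by blast
    have "\<bar>f t - real (X k \<omega>) / \<phi> T\<bar> \<le> of_rat r"
      if t: "t \<in> {0..1}" and k: "(\<Sum>i<k. S i \<omega>) \<le> t * T" "t * T < (\<Sum>i<Suc k. S i \<omega>)" for t k
    \<comment> \<open>The endpoint has no test times to its right within the unit interval, but it
      is itself rational.\<close>
    proof (cases "t = 1")
      case True
      then show ?thesis using R[of 1 k] k by simp
    next
      case False
      show ?thesis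
      proof (rule ccontr)
        assume "\<not> \<bar>f t - real (X k \<omega>) / \<phi> T\<bar> \<le> of_rat r"
        then have gap: "\<bar>f t - real (X k \<omega>) / \<phi> T\<bar> - of_rat r > 0" (is "?g > 0") by simp
        then obtain d where d: "d > 0" "\<And>t'. t' \<in> {0..1} \<Longrightarrow> \<bar>t' - t\<bar> < d \<Longrightarrow> \<bar>f t' - f t\<bar> < ?g"
          using f t unfolding continuous_on_iff dist_real_def by metis
        have "t < min (t + d) (min 1 ((\<Sum>i<Suc k. S i \<omega>) / T))"
          using d t False k T by (simp add: pos_less_divide_eq)
        then obtain p :: rat where p: "t < of_rat p" "of_rat p < min (t + d) (min 1 ((\<Sum>i<Suc k. S i \<omega>) / T))"
          using of_rat_dense by blast
        have p01: "0 \<le> (of_rat p :: real)" "(of_rat p :: real) \<le> 1"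
          using p t unfolding min_less_iff_conj atLeastAtMost_iff by linarith+
        then have p': "0 \<le> p" "p \<le> 1" by simp_all
        have "t * T \<le> of_rat p * T" using p T by (intro mult_right_mono) auto
        then have "(\<Sum>i<k. S i \<omega>) \<le> of_rat p * T" using k by linarith
        moreover have "of_rat p * T < (\<Sum>i<Suc k. S i \<omega>)" using p T by (simp add: pos_less_divide_eq)
        ultimately have "\<bar>f (of_rat p) - real (X k \<omega>) / \<phi> T\<bar> \<le> of_rat r" by (rule R[OF p'])
        moreover have "\<bar>f (of_rat p) - f t\<bar> < ?g" using p p01 by (intro d(2)) auto
        ultimately show False by linarith
      qed
    qed
    then show "\<omega> \<in> path_event M (scaled_process \<xi> \<phi> T) (unif_nbhd \<epsilon> f)"
      unfolding path_event_iff[where \<phi> = \<phi>, OF T \<phi> f \<omega>] using N r by blast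
  qed
  also have "\<dots> \<in> sets M" by measurable
  finally show ?thesis .
qed

end

section \<open>Holding times confined to windows along a fixed path\<close>

context jump_chain
begin

lemma prob_cyl_box:
  assumes s: "\<And>i. i \<le> n \<Longrightarrow> s i \<ge> 0" and d: "d > 0"
  shows "prob {\<omega>\<in>cyl n x. \<forall>i\<le>n. s i < S i \<omega> \<and> S i \<omega> \<le> s i + d} =
    path_prob n x * (\<Prod>i\<le>n. exp (- (h (x i) * s i)) * (1 - exp (- (h (x i) * d))))"
proof -
  interpret P: product_sigma_finite "\<lambda>i. exp_dist (h (x i))" by (rule product_exp_dist)
  have E: "emeasure (exp_dist r) {a<..a + d} = ennreal (exp (- (r * a)) * (1 - exp (- (r * d))))"
    if r: "r > 0" and a: "a \<ge> 0" for r a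
  proof -
    have "{a<..a + d} = {a<..} - {a + d<..}" by auto
    then have "emeasure (exp_dist r) {a<..a + d} = emeasure (exp_dist r) {a<..} - emeasure (exp_dist r) {a + d<..}"
      using d by (simp add: emeasure_Diff emeasure_exp_dist_greaterThan[OF r])
    also have "\<dots> = ennreal (exp (- (r * a)) - exp (- (r * (a + d))))"
      using a d by (simp add: emeasure_exp_dist_greaterThan[OF r] ennreal_minus)
    also have "exp (- (r * a)) - exp (- (r * (a + d))) = exp (- (r * a)) * (1 - exp (- (r * d)))"
      by (simp add: algebra_simps flip: exp_add)
    finally show ?thesis .
  qed
  have e1: "exp (- (h (x i) * d)) \<le> 1" for i using d h_pos[of "x i"] by simp
  let ?A = "{\<omega>\<in>cyl n x. \<forall>i\<le>n. s i < S i \<omega> \<and> S i \<omega> \<le> s i + d}"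
  \<comment> \<open>Written as a product of one-dimensional indicators, so that the integral over
    the product measure factorises.\<close>
  define F where "F = (\<lambda>f :: nat \<Rightarrow> real. \<Prod>i\<le>n. indicator {s i<..s i + d} (f i) :: ennreal)"
  have [measurable]: "F \<in> borel_measurable (\<Pi>\<^sub>M i\<in>{..n}. (borel :: real measure))"
    unfolding F_def by measurable
  have A: "?A = {\<omega>\<in>space M. (\<forall>i\<le>n. X i \<omega> = x i) \<and> (\<forall>i\<le>n. s i < S i \<omega> \<and> S i \<omega> \<le> s i + d)}"
    unfolding cyl_def by auto
  have "?A \<in> sets M" unfolding A by measurable
  then have "emeasure M ?A = (\<integral>\<^sup>+\<omega>. indicator ?A \<omega> \<partial>M)" by simp
  also have "\<dots> = (\<integral>\<^sup>+\<omega>. indicator (cyl n x) \<omega> * F (\<lambda>i\<in>{..n}. S i \<omega>) \<partial>M)"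
  proof (rule nn_integral_cong)
    fix \<omega>
    show "indicator ?A \<omega> = (indicator (cyl n x) \<omega> * F (\<lambda>i\<in>{..n}. S i \<omega>) :: ennreal)"
    proof (cases "\<forall>i\<le>n. s i < S i \<omega> \<and> S i \<omega> \<le> s i + d")
      case True
      then show ?thesis by (auto simp: F_def split: split_indicator)
    next
      case False
      then obtain i where "i \<le> n" "\<not> (s i < S i \<omega> \<and> S i \<omega> \<le> s i + d)" by blast
      then have "F (\<lambda>i\<in>{..n}. S i \<omega>) = 0" unfolding F_def by (intro prod_zero bexI[of _ i]) auto
      then show ?thesis using False by (auto split: split_indicator)
    qed
  qed
  also have "\<dots> = ennreal (path_prob n x) * (\<integral>\<^sup>+f. F f \<partial>(\<Pi>\<^sub>M i\<in>{..n}. exp_dist (h (x i))))"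
    by (rule nn_integral_cyl) measurable
  also have "(\<integral>\<^sup>+f. F f \<partial>(\<Pi>\<^sub>M i\<in>{..n}. exp_dist (h (x i)))) = (\<Prod>i\<le>n. emeasure (exp_dist (h (x i))) {s i<..s i + d})"
    unfolding F_def by (subst P.product_nn_integral_prod) auto
  also have "\<dots> = (\<Prod>i\<le>n. ennreal (exp (- (h (x i) * s i)) * (1 - exp (- (h (x i) * d)))))"
    using s by (intro prod.cong refl E h_pos) auto
  also have "\<dots> = ennreal (\<Prod>i\<le>n. exp (- (h (x i) * s i)) * (1 - exp (- (h (x i) * d))))"
    using e1 by (intro prod_ennreal) auto
  also have "ennreal (path_prob n x) * \<dots> = ennreal (path_prob n x * (\<Prod>i\<le>n. exp (- (h (x i) * s i)) * (1 - exp (- (h (x i) * d)))))"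
    using e1 by (intro ennreal_mult[symmetric] path_prob_nonneg prod_nonneg) auto
  finally show ?thesis
    using e1 path_prob_nonneg by (simp add: measure_def prod_nonneg)
qed

end

section \<open>The local large deviation principle\<close>

context birth_death_rates
begin

text \<open>
  This weight makes the tilted birth rate \<open>lam x * weight (x + 1) / weight x\<close> and the tilted death
  rate \<open>mu (x + 1) * weight x / weight (x + 1)\<close> both equal to the geometric mean of
  \<open>lam x\<close> and \<open>mu (x + 1)\<close>.
\<close>

definition weight :: "nat \<Rightarrow> real" where
  "weight x = (\<Prod>i<x. sqrt (mu (Suc i) / lam i))"

lemma weight_pos: "weight x > 0"
  unfolding weight_def using lam_pos mu_pos by (intro prod_pos) auto

text \<open>Each product on the left is one of the two roots in \<open>tilt\<close> times
  \<open>weight x\<close>; at 0 the downward product and its root both vanish.\<close>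

lemma weight_eigen: "lam x * weight (Suc x) + mu x * weight (x - 1) = tilt x * weight x"
proof -
  have step: "lam i * sqrt (mu (Suc i) / lam i) = sqrt (lam i * mu (Suc i))"
    "mu (Suc i) = sqrt (lam i * mu (Suc i)) * sqrt (mu (Suc i) / lam i)" for i
  proof -
    have pos: "lam i > 0" "mu (Suc i) > 0" using lam_pos mu_pos by auto
    obtain p q where p: "p > 0" "lam i = p * p" and q: "q > 0" "mu (Suc i) = q * q"
      using pos by (metis real_sqrt_gt_zero real_sqrt_mult_self abs_of_pos)
    have "sqrt (mu (Suc i) / lam i) = q / p" "sqrt (lam i * mu (Suc i)) = p * q"
      using p q by (simp_all add: real_sqrt_divide real_sqrt_mult)
    then show "lam i * sqrt (mu (Suc i) / lam i) = sqrt (lam i * mu (Suc i))"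
      "mu (Suc i) = sqrt (lam i * mu (Suc i)) * sqrt (mu (Suc i) / lam i)"
      using p q by simp_all
  qed
  have up: "lam x * weight (Suc x) = sqrt (lam x * mu (Suc x)) * weight x"
    using step(1)[of x] by (simp add: weight_def mult.assoc[symmetric] mult.commute)
  have down: "mu x * weight (x - 1) = sqrt (lam (x - 1) * mu x) * weight x"
  proof (cases x)
    case 0
    then show ?thesis by (simp add: mu_0)
  next
    case (Suc i)
    have "mu (Suc i) * weight i = sqrt (lam i * mu (Suc i)) * sqrt (mu (Suc i) / lam i) * weight i"
      using step(2)[of i] by simp
    then show ?thesis by (simp add: Suc weight_def mult_ac)
  qed
  show ?thesis unfolding up down tilt_def by (simp add: algebra_simps)
qed

text \<open>A product of at most C \<rho> factors, each at least \<rho> to the power -k, is at least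
  exp(-k C \<rho> ln \<rho>).\<close>

lemma weight_ge:
  assumes \<rho>: "\<rho> > 1" and r: "\<And>i. real i \<le> C * \<rho> \<Longrightarrow> 1 / \<rho> ^ k \<le> sqrt (mu (Suc i) / lam i)"
    and x: "real x \<le> C * \<rho>"
  shows "weight x \<ge> exp (- (real k * C * (\<rho> * ln \<rho>)))"
proof -
  have "real k * ln \<rho> * real x \<le> real k * ln \<rho> * (C * \<rho>)"
    using x \<rho> by (intro mult_left_mono) auto
  then have "exp (- (real k * C * (\<rho> * ln \<rho>))) \<le> exp (- (real k * ln \<rho> * real x))"
    by (simp add: algebra_simps)
  also have "\<dots> = (\<Prod>i<x. 1 / \<rho> ^ k)"
  proof -
    have "1 / \<rho> ^ k = exp (- (real k * ln \<rho>))"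
      using \<rho> by (simp add: exp_minus exp_of_nat_mult inverse_eq_divide)
    then show ?thesis by (simp add: exp_of_nat_mult[symmetric] mult.commute)
  qed
  also have "\<dots> \<le> weight x"
    unfolding weight_def using \<rho> x by (intro prod_mono conjI r) auto
  finally show ?thesis .
qed

end

locale birth_death_ldp =
  birth_death_rates lam mu l m y z Y Z V + jump_process M lam mu 0 X S \<xi>
  for M :: "'a measure" and lam mu :: "nat \<Rightarrow> real" and X S \<xi> l m y z Y Z V +
  fixes \<phi> :: "real \<Rightarrow> real"
  assumes phi_pos: "\<And>T. T > 0 \<Longrightarrow> \<phi> T > 0"
    and phi_lim: "filterlim \<phi> at_top at_top"
    and phi_growth: "((\<lambda>T. \<phi> T * ln (\<phi> T) / (T * V (\<phi> T))) \<longlongrightarrow> 0) at_top"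
begin

lemma eventually_phi: "\<forall>\<^sub>F \<rho> in at_top. P \<rho> \<Longrightarrow> \<forall>\<^sub>F T in at_top. P (\<phi> T)"
  by (rule eventually_compose_filterlim[OF _ phi_lim])

lemma phi_growth_le:
  assumes d: "d > 0" and A: "A \<ge> 0"
  shows "\<forall>\<^sub>F T in at_top. A * (\<phi> T * ln (\<phi> T)) \<le> d * (T * V (\<phi> T))"
proof -
  \<comment> \<open>The denominator is \<open>A + 1\<close> because \<open>A\<close> may be
    0.\<close>
  have "\<forall>\<^sub>F T in at_top. \<phi> T * ln (\<phi> T) / (T * V (\<phi> T)) < d / (A + 1)"
    using d A by (intro order_tendstoD(2)[OF phi_growth]) auto
  then show ?thesis
    using eventually_gt_at_top[of 0] eventually_phi[OF eventually_ge_at_top[of 1]]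
  proof eventually_elim
    case (elim T)
    have pos: "T * V (\<phi> T) > 0" using elim V_pos[OF phi_pos] by simp
    then have "\<phi> T * ln (\<phi> T) < d / (A + 1) * (T * V (\<phi> T))"
      using elim(1) by (simp only: pos_divide_less_eq)
    then have "(A + 1) * (\<phi> T * ln (\<phi> T)) \<le> (A + 1) * (d / (A + 1) * (T * V (\<phi> T)))"
      using A by (intro mult_left_mono) auto
    also have "\<dots> = d * (T * V (\<phi> T))" using A by simp
    finally have "(A + 1) * (\<phi> T * ln (\<phi> T)) \<le> d * (T * V (\<phi> T))" .
    moreover have "\<phi> T * ln (\<phi> T) \<ge> 0" using elim by simp
    ultimately show ?case by (simp add: distrib_right)
  qed
qed

lemma positive_path_facts:
  assumes "f \<in> positive_paths"
  shows "continuous_on {0..1} f" "f 0 = 0" "\<And>t. 0 \<le> t \<Longrightarrow> t \<le> 1 \<Longrightarrow> f t \<ge> 0"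
    "continuous_on {0..1} (\<lambda>t. f t powr max l m)" "\<exists>B>0. \<forall>t. 0 \<le> t \<longrightarrow> t \<le> 1 \<longrightarrow> f t \<le> B"
proof -
  show f: "continuous_on {0..1} f" "f 0 = 0" using assms by (auto simp: positive_paths_def)
  show nn: "f t \<ge> 0" if "0 \<le> t" "t \<le> 1" for t
    using assms that by (cases "t = 0") (auto simp: positive_paths_def less_imp_le)
  show "continuous_on {0..1} (\<lambda>t. f t powr max l m)"
    using nn max_exponent_pos by (intro continuous_on_powr' f continuous_on_const) auto
  have "bounded (f ` {0..1})"
    by (intro compact_imp_bounded compact_continuous_image f) auto
  then show "\<exists>B>0. \<forall>t. 0 \<le> t \<longrightarrow> t \<le> 1 \<longrightarrow> f t \<le> B"
    unfolding bounded_pos by (metis abs_le_iff atLeastAtMost_iff image_eqI real_norm_def)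
qed

lemma powr_uniformly_continuous:
  assumes d: "d > 0"
  shows "\<exists>e>0. \<forall>a\<in>{0..C}. \<forall>b\<in>{0..C}. \<bar>a - b\<bar> < e \<longrightarrow> \<bar>a powr max l m - b powr max l m\<bar> < d"
proof -
  have "continuous_on {0..C} (\<lambda>a. a powr max l m)"
    using max_exponent_pos by (intro continuous_on_powr' continuous_intros) auto
  then have "uniformly_continuous_on {0..C} (\<lambda>a. a powr max l m)"
    by (rule compact_uniformly_continuous) auto
  then show ?thesis
    using d unfolding uniformly_continuous_on_def dist_real_def by (metis abs_minus_commute)
qed

lemma integral_affine:
  fixes F :: "real \<Rightarrow> real"
  assumes "continuous_on {0..1} F"
  shows "integral {0..1} (\<lambda>t. A * (F t + B)) = A * (integral {0..1} F + B)"
  using has_integral_mult_right[OF has_integral_add[OF integrable_integral[OF integrable_continuous_real[OF assms]]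
      has_integral_const_real[of B 0 1]], of A]
  by (intro integral_unique) simp

section \<open>Upper bound: the supermartingale on the tube around f\<close>

text \<open>The error \<delta> is split into four parts \<open>d\<close>: moving from the path to
  \<open>f\<close> inside the power, the asymptotics of the total rate, the tilt, and the weight of
  the terminal state. The first three sit inside the integral.\<close>

lemma upper_bound:
  assumes f: "f \<in> positive_paths" and \<delta>: "\<delta> > 0"
  shows "\<exists>\<epsilon>0>0. \<forall>\<epsilon>. 0 < \<epsilon> \<longrightarrow> \<epsilon> \<le> \<epsilon>0 \<longrightarrow> (\<forall>\<^sub>F T in at_top.
     prob (path_event M (scaled_process \<xi> \<phi> T) (unif_nbhd \<epsilon> f)) \<le>
     exp (- (T * V (\<phi> T)) * (integral {0..1} (\<lambda>t. f t powr max l m) - \<delta>)))"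
proof -
  note ff = positive_path_facts[OF f]
  define d where "d = \<delta> / 4"
  have d: "d > 0" using \<delta> by (simp add: d_def)
  obtain B where B: "B > 0" "\<And>t. 0 \<le> t \<Longrightarrow> t \<le> 1 \<Longrightarrow> f t \<le> B" using ff(5) by blast
  \<comment> \<open>A path within distance 1 of \<open>f\<close> stays below this level, which is
    why \<epsilon> is kept at most 1.\<close>
  define C where "C = B + 1"
  have C: "C > 0" using B by (simp add: C_def)
  obtain e where e: "e > 0" and uc: "\<And>a b. a \<in> {0..C} \<Longrightarrow> b \<in> {0..C} \<Longrightarrow> \<bar>a - b\<bar> < e \<Longrightarrow> \<bar>a powr max l m - b powr max l m\<bar> < d"
    using powr_uniformly_continuous[OF d, of C] by blast
  obtain k where k: "\<forall>\<^sub>F \<rho> in at_top. \<forall>x. real x \<le> C * \<rho> \<longrightarrow> 1 / \<rho> ^ k \<le> sqrt (mu (Suc x) / lam x)"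
    using poly_below_le_scale[OF poly_below_ratio] by blast
  define I where "I = integral {0..1} (\<lambda>t. f t powr max l m)"
  have growth: "\<forall>\<^sub>F T in at_top. real k * C * (\<phi> T * ln (\<phi> T)) \<le> d * (T * V (\<phi> T))"
    using C by (intro phi_growth_le d) simp
  show ?thesis
  proof (intro exI[of _ "min 1 e"] conjI allI impI)
    show "min 1 e > 0" using e by simp
    fix \<epsilon> assume \<epsilon>: "0 < \<epsilon>" "\<epsilon> \<le> min 1 e"
    show "\<forall>\<^sub>F T in at_top. prob (path_event M (scaled_process \<xi> \<phi> T) (unif_nbhd \<epsilon> f)) \<le>
       exp (- (T * V (\<phi> T)) * (integral {0..1} (\<lambda>t. f t powr max l m) - \<delta>))"
      using eventually_gt_at_top[of 0] eventually_phi[OF eventually_gt_at_top[of 1]]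
        eventually_phi[OF total_uniform[OF C d]] eventually_phi[OF tilt_negligible[OF C d]] eventually_phi[OF k] growth
    proof eventually_elim
      case (elim T)
      define \<rho> where "\<rho> = \<phi> T"
      have T: "T > 0" and \<rho>: "\<rho> > 1" using elim by (auto simp: \<rho>_def)
      have V: "V \<rho> > 0" using V_pos \<rho> by simp
      interpret tilted: tilted_jump_chain M lam mu 0 X S weight tilt T
        by unfold_locales (use weight_pos tilt_pos weight_eigen T in auto)
      let ?E = "path_event M (scaled_process \<xi> \<phi> T) (unif_nbhd \<epsilon> f)"
      have "prob ?E \<le> weight 0 / exp (T * V \<rho> * (I - \<delta>))"
      proof (rule tilted.prob_le_of_Z_ge)
        show "?E \<in> sets M"
          using \<rho> by (intro path_event_sets T ff(1)) (simp add: \<rho>_def)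
        fix \<omega> assume \<omega>E: "\<omega> \<in> ?E"
        then have \<omega>: "\<omega> \<in> space M" by (simp add: path_event_def)
        have \<phi>T: "\<phi> T > 0" using T by (rule phi_pos)
        from \<omega>E obtain N q where N: "T < (\<Sum>i<N. S i \<omega>)" and q: "q < \<epsilon>"
          and Q: "\<And>t k. t \<in> {0..1} \<Longrightarrow> (\<Sum>i<k. S i \<omega>) \<le> t * T \<Longrightarrow> t * T < (\<Sum>i<Suc k. S i \<omega>) \<Longrightarrow> \<bar>f t - real (X k \<omega>) / \<rho>\<bar> \<le> q"
          unfolding path_event_iff[where \<phi> = \<phi>, OF T \<phi>T ff(1) \<omega>] \<rho>_def by blast
        obtain n where n: "(\<Sum>i<n. S i \<omega>) \<le> T" "T < (\<Sum>i<Suc n. S i \<omega>)"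
          using holding_interval[of T "\<lambda>i. S i \<omega>" N] N T by auto
        have tube: "\<bar>f (u / T) - real (X k \<omega>) / \<rho>\<bar> < \<epsilon>" "real (X k \<omega>) \<le> C * \<rho>" "0 \<le> u / T" "u / T \<le> 1"
          if u: "(\<Sum>i<k. S i \<omega>) \<le> u" "u < (\<Sum>i<Suc k. S i \<omega>)" "u \<le> T" for k u
        proof -
          have "(\<Sum>i<k. S i \<omega>) \<ge> 0" using S_pos[OF \<omega>] by (intro sum_nonneg) (auto simp: less_imp_le)
          then show u01: "0 \<le> u / T" "u / T \<le> 1" using u T by auto
          have "\<bar>f (u / T) - real (X k \<omega>) / \<rho>\<bar> \<le> q" using u01 u T by (intro Q) auto
          then show *: "\<bar>f (u / T) - real (X k \<omega>) / \<rho>\<bar> < \<epsilon>" using q by linarith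
          then have "real (X k \<omega>) / \<rho> \<le> C" using B(2)[OF u01] \<epsilon> unfolding C_def by linarith
          then show "real (X k \<omega>) \<le> C * \<rho>" using \<rho> by (simp add: pos_divide_le_eq)
        qed
        \<comment> \<open>The right side is the exponent of \<open>tilted.Z n\<close> on this event:
          full holding times before the last jump, and the truncated one after it.\<close>
        have "T * integral {0..1} (\<lambda>t. V \<rho> * (f t powr max l m + - (3 * d))) \<le>
          (\<Sum>k<n. tilted.c (X k \<omega>) * S k \<omega>) + tilted.c (X n \<omega>) * (T - (\<Sum>i<n. S i \<omega>))"
        proof (rule integral_le_step_sum)
          show "continuous_on {0..1} (\<lambda>t. V \<rho> * (f t powr max l m + - (3 * d)))"
            by (intro continuous_intros ff(4))
          show "S k \<omega> \<ge> 0" for k using S_pos[OF \<omega>] by (simp add: less_imp_le)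
          fix k u assume "k \<le> n" and u: "(\<Sum>i<k. S i \<omega>) \<le> u" "u < (\<Sum>i<Suc k. S i \<omega>)" "u \<le> T"
          note t = tube[OF u]
          let ?x = "X k \<omega>"
          have "\<bar>f (u / T) powr max l m - (real ?x / \<rho>) powr max l m\<bar> < d"
          proof (rule uc)
            show "f (u / T) \<in> {0..C}" using ff(3) B(2) t by (force simp: C_def)
            show "real ?x / \<rho> \<in> {0..C}" using t \<rho> by (simp add: pos_divide_le_eq)
            show "\<bar>f (u / T) - real ?x / \<rho>\<bar> < e" using t \<epsilon> by linarith
          qed
          then have "V \<rho> * (f (u / T) powr max l m) \<le> V \<rho> * ((real ?x / \<rho>) powr max l m + d)"
            using V by (intro mult_left_mono) auto
          moreover have "\<bar>lam ?x + mu ?x - V \<rho> * (real ?x / \<rho>) powr max l m\<bar> \<le> d * V \<rho>"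
            using elim t(2) unfolding \<rho>_def by blast
          moreover have "tilt ?x \<le> d * V \<rho>" using elim t(2) unfolding \<rho>_def by blast
          ultimately show "V \<rho> * (f (u / T) powr max l m + - (3 * d)) \<le> tilted.c ?x"
            unfolding tilted.c_def h_def by (simp add: algebra_simps abs_le_iff)
        qed (use T n in auto)
        then have sum_ge: "T * (V \<rho> * (I - 3 * d)) \<le>
          (\<Sum>k<n. tilted.c (X k \<omega>) * S k \<omega>) + tilted.c (X n \<omega>) * (T - (\<Sum>i<n. S i \<omega>))"
          unfolding integral_affine[OF ff(4)] I_def by simp
        have "exp (- (d * (T * V \<rho>))) \<le> exp (- (real k * C * (\<rho> * ln \<rho>)))"
          using elim C unfolding \<rho>_def by simp
        also have "\<dots> \<le> weight (X n \<omega>)"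
          by (rule weight_ge[OF \<rho>]) (use elim tube(2)[OF n(1) n(2)] \<rho>_def in auto)
        finally have "exp (- (d * (T * V \<rho>))) * exp (T * (V \<rho> * (I - 3 * d))) \<le>
          weight (X n \<omega>) * exp ((\<Sum>k<n. tilted.c (X k \<omega>) * S k \<omega>) + tilted.c (X n \<omega>) * (T - (\<Sum>i<n. S i \<omega>)))"
          using sum_ge weight_pos by (intro mult_mono) (auto simp: less_imp_le)
        moreover have "exp (- (d * (T * V \<rho>))) * exp (T * (V \<rho> * (I - 3 * d))) = exp (T * V \<rho> * (I - \<delta>))"
          unfolding d_def by (simp add: algebra_simps flip: exp_add)
        ultimately have "ennreal (exp (T * V \<rho> * (I - \<delta>))) \<le> tilted.Z n \<omega>"
          unfolding tilted.Z_def using n by (simp add: ennreal_leI)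
        then show "\<exists>n. ennreal (exp (T * V \<rho> * (I - \<delta>))) \<le> tilted.Z n \<omega>" by blast
      qed simp
      then show ?case
        by (simp add: weight_def \<rho>_def I_def exp_minus divide_inverse)
    qed
  qed
qed

section \<open>Lower bound: following one lattice path\<close>

lemma path_prob_ge:
  assumes x0: "x 0 = 0" and adj: "\<And>i. i < n \<Longrightarrow> x (Suc i) = Suc (x i) \<or> x i = Suc (x (Suc i))"
    and up: "\<And>i. i \<le> n \<Longrightarrow> r \<le> lam (x i) / (lam (x i) + mu (x i))"
    and down: "\<And>i. i \<le> n \<Longrightarrow> r \<le> mu (Suc (x i)) / (lam (Suc (x i)) + mu (Suc (x i)))"
    and r: "r \<ge> 0"
  shows "r ^ n \<le> path_prob n x"
proof -
  have "r ^ n = (\<Prod>i<n. r)" by simp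
  also have "\<dots> \<le> (\<Prod>i<n. bd_trans lam mu (x i) (x (Suc i)))"
  proof (rule prod_mono)
    fix i assume i: "i \<in> {..<n}"
    show "0 \<le> r \<and> r \<le> bd_trans lam mu (x i) (x (Suc i))"
      using adj[of i]
    proof
      assume "x (Suc i) = Suc (x i)"
      then show ?thesis using up[of i] i r by (simp add: bd_trans_def)
    next
      assume "x i = Suc (x (Suc i))"
      \<comment> \<open>The downward probability is indexed by its target, the state at index
        \<open>Suc i\<close>; this is why \<open>down\<close> is assumed up to \<open>n\<close>
        inclusive.\<close>
      then show ?thesis using down[of "Suc i"] i r by (simp add: bd_trans_def)
    qed (use i in auto)
  qed
  finally show ?thesis by (simp add: path_prob_def x0)
qed

lemma one_minus_exp_neg_ge: "q / 2 \<le> 1 - exp (- q)" if "0 \<le> q" "q \<le> 1" for q :: real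
proof -
  have "exp (- q) \<le> 1 / (1 + q)"
    using exp_ge_add_one_self[of q] that by (simp add: exp_minus field_simps)
  moreover have "q / 2 \<le> 1 - 1 / (1 + q)"
  proof -
    have "1 - 1 / (1 + q) = q / (1 + q)" using that by (simp add: field_simps)
    moreover have "q / 2 \<le> q / (1 + q)" using that by (intro divide_left_mono) auto
    ultimately show ?thesis by simp
  qed
  ultimately show ?thesis by linarith
qed

text \<open>A jump costs the factor \<rho> to the power -k for its direction, and each holding time
  the power -(2k + 3) for hitting its window; together these give 3k + 3. The remaining sum is the
  cost of waiting.\<close>

lemma prob_lattice_path_ge:
  assumes \<rho>: "\<rho> \<ge> 3" and T: "T > 0" and TV: "\<rho> * ln \<rho> \<le> T * V \<rho>" and Vk: "V \<rho> \<le> \<rho> ^ k"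
    and x0: "x 0 = 0" and adj: "\<And>i. i < n \<Longrightarrow> x (Suc i) = Suc (x i) \<or> x i = Suc (x (Suc i))"
    and up: "\<And>i. i \<le> n \<Longrightarrow> 1 / \<rho> ^ k \<le> lam (x i) / (lam (x i) + mu (x i))"
    and down: "\<And>i. i \<le> n \<Longrightarrow> 1 / \<rho> ^ k \<le> mu (Suc (x i)) / (lam (Suc (x i)) + mu (Suc (x i)))"
    and tot: "\<And>i. i \<le> n \<Longrightarrow> 1 / \<rho> ^ k \<le> lam (x i) + mu (x i)"
    and s: "\<And>i. s i \<ge> 0"
  shows "exp (- ((3 * real k + 3) * real (Suc n) * ln \<rho> + (\<Sum>i\<le>n. (lam (x i) + mu (x i)) * s i))) \<le>
    prob {\<omega>\<in>cyl n x. \<forall>i\<le>n. s i < S i \<omega> \<and> S i \<omega> \<le> s i + T / \<rho>\<^sup>2}"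
proof -
  have V: "V \<rho> > 0" using V_pos \<rho> by simp
  \<comment> \<open>A lower bound for rate times window length: k from the rate, k from
    \<open>T\<close>, and 2 from the window \<open>T / \<rho>\<^sup>2\<close>.\<close>
  define q where "q = 1 / \<rho> ^ (2 * k + 2)"
  have one_le: "1 \<le> \<rho> ^ j" for j using \<rho> by (intro one_le_power) auto
  have q: "0 < q" "q \<le> 1" using \<rho> one_le[of "2 * k + 2"] unfolding q_def by (simp_all add: pos_divide_le_eq del: power_add power_Suc)
  \<comment> \<open>No lower bound on \<open>T\<close> is assumed; it follows from \<open>TV\<close>
    and the polynomial bound for \<open>V\<close>. The condition \<rho> \<ge> 3 makes
    \<open>ln \<rho>\<close> at least 1.\<close>
  have T_ge: "1 / \<rho> ^ k \<le> T"
  proof -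
    have "1 \<le> ln \<rho>" using \<rho> exp_le by (subst ln_ge_iff) auto
    then have "1 * 1 \<le> \<rho> * ln \<rho>" using \<rho> by (intro mult_mono) auto
    also have "\<dots> \<le> T * \<rho> ^ k" using TV mult_left_mono[OF Vk, of T] T by linarith
    finally show ?thesis using \<rho> by (simp add: pos_divide_le_eq)
  qed
  have factor: "1 / \<rho> ^ (2 * k + 3) \<le> 1 - exp (- (h (x i) * (T / \<rho>\<^sup>2)))" if "i \<le> n" for i
  proof -
    have "q = (1 / \<rho> ^ k) * ((1 / \<rho> ^ k) / \<rho>\<^sup>2)"
      by (simp add: q_def power_add mult_2 power2_eq_square)
    also have "\<dots> \<le> h (x i) * (T / \<rho>\<^sup>2)"
      using tot[OF that] T_ge \<rho> h_pos[of "x i"] unfolding h_def[symmetric]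
      by (intro mult_mono divide_right_mono) auto
    finally have "exp (- (h (x i) * (T / \<rho>\<^sup>2))) \<le> exp (- q)" by simp
    moreover have "q / 2 \<le> 1 - exp (- q)" using q by (intro one_minus_exp_neg_ge) auto
    moreover have "1 / \<rho> ^ (2 * k + 3) \<le> q / 2"
    proof -
      have "1 / \<rho> ^ (2 * k + 3) = q / \<rho>" by (simp add: q_def numeral_3_eq_3)
      also have "\<dots> \<le> q / 2" using q \<rho> by (intro divide_left_mono) auto
      finally show ?thesis .
    qed
    ultimately show ?thesis by linarith
  qed
  have E: "exp (- ((3 * real k + 3) * real (Suc n) * ln \<rho>)) = (1 / \<rho> ^ k) ^ Suc n * (1 / \<rho> ^ (2 * k + 3)) ^ Suc n"
  proof -
    have "(1 / \<rho> ^ k) ^ Suc n * (1 / \<rho> ^ (2 * k + 3)) ^ Suc n = (1 / \<rho> ^ (3 * k + 3)) ^ Suc n"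
      by (simp only: power_mult_distrib[symmetric] times_divide_times_eq power_add[symmetric]) simp
    also have "1 / \<rho> ^ (3 * k + 3) = exp (- (real (3 * k + 3) * ln \<rho>))"
      using \<rho> by (simp only: exp_minus exp_of_nat_mult exp_ln inverse_eq_divide)
    also have "\<dots> ^ Suc n = exp (real (Suc n) * (- (real (3 * k + 3) * ln \<rho>)))"
      by (simp only: exp_of_nat_mult)
    also have "real (Suc n) * (- (real (3 * k + 3) * ln \<rho>)) = - ((3 * real k + 3) * real (Suc n) * ln \<rho>)"
      by (simp add: algebra_simps)
    finally show ?thesis by simp
  qed
  have "exp (- ((3 * real k + 3) * real (Suc n) * ln \<rho> + (\<Sum>i\<le>n. (lam (x i) + mu (x i)) * s i))) =
     exp (- ((3 * real k + 3) * real (Suc n) * ln \<rho>)) * exp (- (\<Sum>i\<le>n. h (x i) * s i))"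
    unfolding h_def by (simp flip: exp_add)
  \<comment> \<open>There are \<open>n\<close> jumps but \<open>Suc n\<close> holding times; the
    surplus factor in \<open>E\<close> is at most 1 and is dropped.\<close>
  also have "\<dots> \<le> ((1 / \<rho> ^ k) ^ n * (1 / \<rho> ^ (2 * k + 3)) ^ Suc n) * exp (- (\<Sum>i\<le>n. h (x i) * s i))"
    unfolding E using \<rho> one_le[of k] by (intro mult_right_mono power_decreasing) (auto simp: pos_divide_le_eq)
  also have "\<dots> = (1 / \<rho> ^ k) ^ n * (\<Prod>i\<le>n. exp (- (h (x i) * s i)) * (1 / \<rho> ^ (2 * k + 3)))"
  proof -
    have "exp (- (\<Sum>i\<le>n. h (x i) * s i)) = (\<Prod>i\<le>n. exp (- (h (x i) * s i)))"
      by (simp add: exp_sum[symmetric] sum_negf)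
    then show ?thesis
      by (simp only: prod.distrib prod_constant card_atMost mult_ac)
  qed
  also have "\<dots> \<le> path_prob n x * (\<Prod>i\<le>n. exp (- (h (x i) * s i)) * (1 - exp (- (h (x i) * (T / \<rho>\<^sup>2)))))"
  proof (intro mult_mono prod_mono conjI)
    show "(1 / \<rho> ^ k) ^ n \<le> path_prob n x"
      using \<rho> by (intro path_prob_ge x0 adj up down) auto
  qed (use \<rho> factor path_prob_nonneg in \<open>auto intro!: prod_nonneg\<close>)
  also have "\<dots> = prob {\<omega>\<in>cyl n x. \<forall>i\<le>n. s i < S i \<omega> \<and> S i \<omega> \<le> s i + T / \<rho>\<^sup>2}"
    using s T \<rho> by (intro prob_cyl_box[symmetric]) auto
  finally show ?thesis .
qed

text \<open>The random path visits the lattice states in order, with jump times delayed by at most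
  (n + 1) d in total, which is less than r T. The lattice path and this time shift each cost at most
  \<eta>, whence the radius 2 \<eta>.\<close>

lemma cyl_box_subset_path_event:
  assumes f: "continuous_on {0..1} f" and T: "T > 0" and \<eta>: "2 * \<eta> < \<epsilon>"
    and uc: "\<And>a b. a \<in> {0..1} \<Longrightarrow> b \<in> {0..1} \<Longrightarrow> \<bar>a - b\<bar> < r \<Longrightarrow> \<bar>f a - f b\<bar> < \<eta>"
    and d: "d \<ge> 0" "real (Suc n) * d < r * T"
    and s: "\<And>i. s i \<ge> 0" and sT: "(\<Sum>i<Suc n. s i) = T"
    and tube: "\<And>i u. i \<le> n \<Longrightarrow> (\<Sum>k<i. s k) \<le> u \<Longrightarrow> u \<le> (\<Sum>k<Suc i. s k) \<Longrightarrow> \<bar>real (x i) / \<phi> T - f (u / T)\<bar> \<le> \<eta>"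
  shows "{\<omega>\<in>cyl n x. \<forall>i\<le>n. s i < S i \<omega> \<and> S i \<omega> \<le> s i + d} \<subseteq> path_event M (scaled_process \<xi> \<phi> T) (unif_nbhd \<epsilon> f)"
proof
  fix \<omega> assume L: "\<omega> \<in> {\<omega>\<in>cyl n x. \<forall>i\<le>n. s i < S i \<omega> \<and> S i \<omega> \<le> s i + d}"
  then have \<omega>: "\<omega> \<in> space M" and X: "\<And>i. i \<le> n \<Longrightarrow> X i \<omega> = x i"
    and S: "\<And>i. i \<le> n \<Longrightarrow> s i < S i \<omega>" "\<And>i. i \<le> n \<Longrightarrow> S i \<omega> \<le> s i + d"
    by (auto simp: cyl_def)
  have \<phi>T: "\<phi> T > 0" using T by (rule phi_pos)
  \<comment> \<open>The windows are open at their lower ends, so the holding times sum to strictly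
    more than \<open>T\<close>: the random path is still in one of the listed states at time
    \<open>T\<close>.\<close>
  have N: "T < (\<Sum>i<Suc n. S i \<omega>)"
    unfolding sT[symmetric] using S(1) by (intro sum_strict_mono) auto
  have lo: "(\<Sum>i<k. s i) \<le> (\<Sum>i<k. S i \<omega>)" if "k \<le> Suc n" for k
    using that S(1) by (intro sum_mono) (auto simp: less_imp_le)
  have hi: "(\<Sum>i<k. S i \<omega>) \<le> (\<Sum>i<k. s i) + real (Suc n) * d" if "k \<le> Suc n" for k
  proof -
    have "(\<Sum>i<k. S i \<omega>) \<le> (\<Sum>i<k. s i + d)" using that S(2) by (intro sum_mono) auto
    also have "\<dots> = (\<Sum>i<k. s i) + real k * d" by (simp add: sum.distrib)
    also have "\<dots> \<le> (\<Sum>i<k. s i) + real (Suc n) * d" using that d by (intro add_left_mono mult_right_mono) auto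
    finally show ?thesis .
  qed
  show "\<omega> \<in> path_event M (scaled_process \<xi> \<phi> T) (unif_nbhd \<epsilon> f)"
    unfolding path_event_iff[where \<phi> = \<phi>, OF T \<phi>T f \<omega>]
  proof (intro conjI exI[of _ "Suc n"] exI[of _ "2 * \<eta>"] N \<eta> ballI allI impI)
    fix t k assume t: "t \<in> {0..1::real}" and k: "(\<Sum>i<k. S i \<omega>) \<le> t * T \<and> t * T < (\<Sum>i<Suc k. S i \<omega>)"
    define u where "u = t * T"
    have uT: "u \<le> T" "u \<ge> 0" "u / T = t" using t T by (auto simp: u_def mult_left_le_one_le)
    have kn: "k \<le> n"
    proof (rule ccontr)
      assume "\<not> k \<le> n"
      then have "(\<Sum>i<Suc n. S i \<omega>) \<le> (\<Sum>i<k. S i \<omega>)"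
        using S_pos[OF \<omega>] by (intro sum_mono2) (auto simp: less_imp_le)
      with k N uT show False unfolding u_def by linarith
    qed
    \<comment> \<open>A time at which the lattice path occupies \<open>x k\<close>: the current
      time, pulled back to the end of the undelayed interval if it lies beyond.\<close>
    define u' where "u' = min u (\<Sum>i<Suc k. s i)"
    have "(\<Sum>i<k. s i) \<le> u" using lo[of k] kn k unfolding u_def by simp
    moreover have "(\<Sum>i<k. s i) \<le> (\<Sum>i<Suc k. s i)" using s[of k] by simp
    ultimately have u': "(\<Sum>i<k. s i) \<le> u'" "u' \<le> (\<Sum>i<Suc k. s i)" by (auto simp: u'_def)
    have s0: "(\<Sum>i<k. s i) \<ge> 0" using s by (intro sum_nonneg) auto
    have u'01: "u' / T \<in> {0..1}" using u' s0 uT T by (auto simp: u'_def)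
    have "u < (\<Sum>i<Suc k. s i) + real (Suc n) * d" using hi[of "Suc k"] kn k unfolding u_def by linarith
    then have "u - u' \<le> real (Suc n) * d" "u' \<le> u" using d by (auto simp: u'_def min_def)
    then have "\<bar>u - u'\<bar> < r * T" using d by linarith
    then have "\<bar>u / T - u' / T\<bar> < r"
      using T by (simp add: diff_divide_distrib[symmetric] pos_divide_less_eq)
    then have "\<bar>f t - f (u' / T)\<bar> < \<eta>" using uc[OF t u'01] uT by simp
    moreover have "\<bar>real (x k) / \<phi> T - f (u' / T)\<bar> \<le> \<eta>" by (rule tube[OF kn u'])
    ultimately show "\<bar>f t - real (X k \<omega>) / \<phi> T\<bar> \<le> 2 * \<eta>" using X[OF kn] by simp
  qed
qed

text \<open>The error \<delta> is split into three parts \<open>d\<close>: uniform continuity of the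
  power, the asymptotics of the total rate, and the probability of the jumps. There is no upper
  restriction on \<epsilon>, since a narrower tube can always be followed.\<close>

lemma lower_bound:
  assumes f: "f \<in> positive_paths" and \<epsilon>: "\<epsilon> > 0" and \<delta>: "\<delta> > 0"
  shows "\<forall>\<^sub>F T in at_top. exp (- (T * V (\<phi> T)) * (integral {0..1} (\<lambda>t. f t powr max l m) + \<delta>)) \<le>
     prob (path_event M (scaled_process \<xi> \<phi> T) (unif_nbhd \<epsilon> f))"
proof -
  note ff = positive_path_facts[OF f]
  define I where "I = integral {0..1} (\<lambda>t. f t powr max l m)"
  define d where "d = \<delta> / 3"
  have d: "d > 0" using \<delta> by (simp add: d_def)
  obtain B where B: "B > 0" "\<And>t. 0 \<le> t \<Longrightarrow> t \<le> 1 \<Longrightarrow> f t \<le> B" using ff(5) by blast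
  define C where "C = B + 1"
  have C: "C > 0" using B by (simp add: C_def)
  obtain e where e: "e > 0" and pc: "\<And>a b. a \<in> {0..C} \<Longrightarrow> b \<in> {0..C} \<Longrightarrow> \<bar>a - b\<bar> < e \<Longrightarrow> \<bar>a powr max l m - b powr max l m\<bar> < d"
    using powr_uniformly_continuous[OF d, of C] by blast
  \<comment> \<open>The bound by \<epsilon> leaves room for twice \<eta>, the one by
    \<open>e\<close> allows comparing powers, and 1 keeps the lattice states below C \<rho>.\<close>
  define \<eta> where "\<eta> = min (\<epsilon> / 4) (min (e / 2) 1)"
  have \<eta>: "\<eta> > 0" "2 * \<eta> < \<epsilon>" "\<eta> < e" "\<eta> \<le> 1" using \<epsilon> e by (auto simp: \<eta>_def min_def)
  have "uniformly_continuous_on {0..1} f"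
    by (rule compact_uniformly_continuous[OF ff(1)]) auto
  then obtain r where r: "r > 0" and
    uc: "\<And>a b. a \<in> {0..1} \<Longrightarrow> b \<in> {0..1} \<Longrightarrow> \<bar>a - b\<bar> < r \<Longrightarrow> \<bar>f a - f b\<bar> < \<eta>"
    using \<eta>(1) unfolding uniformly_continuous_on_def dist_real_def by (metis abs_minus_commute)
  obtain C1 where C1: "C1 > 0" and
    paths: "\<forall>\<^sub>F \<rho> in at_top. \<forall>T>0. \<exists>n (x :: nat \<Rightarrow> nat) s. x 0 = 0 \<and> real n \<le> C1 * \<rho> \<and>
     (\<forall>i<n. x (Suc i) = Suc (x i) \<or> x i = Suc (x (Suc i))) \<and> (\<forall>i. 0 \<le> s i) \<and> (\<Sum>i<Suc n. s i) = T \<and>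
     (\<forall>i\<le>n. \<forall>u. (\<Sum>k<i. s k) \<le> u \<and> u \<le> (\<Sum>k<Suc i. s k) \<longrightarrow> \<bar>real (x i) / \<rho> - f (u / T)\<bar> \<le> \<eta>)"
    using lattice_path_exists[OF ff(1,2,3) \<eta>(1)] by blast
  obtain k1 where k1: "\<And>k. k1 \<le> k \<Longrightarrow> \<forall>\<^sub>F \<rho> in at_top. \<forall>x. real x \<le> C * \<rho> \<longrightarrow> 1 / \<rho> ^ k \<le> lam x / (lam x + mu x)"
    using poly_below_le_scale[OF poly_below_up] by blast
  obtain k2 where k2: "\<And>k. k2 \<le> k \<Longrightarrow> \<forall>\<^sub>F \<rho> in at_top. \<forall>x. real x \<le> C * \<rho> \<longrightarrow> 1 / \<rho> ^ k \<le> mu (Suc x) / (lam (Suc x) + mu (Suc x))"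
    using poly_below_le_scale[OF poly_below_down] by blast
  obtain k3 where k3: "\<And>k. k3 \<le> k \<Longrightarrow> \<forall>\<^sub>F \<rho> in at_top. \<forall>x. real x \<le> C * \<rho> \<longrightarrow> 1 / \<rho> ^ k \<le> lam x + mu x"
    using poly_below_le_scale[OF poly_total(2)] by blast
  obtain k4 where k4: "\<And>k. k4 \<le> k \<Longrightarrow> \<forall>\<^sub>F \<rho> in at_top. V \<rho> \<le> \<rho> ^ k"
    using V_le_power by blast
  define k where "k = max (max k1 k2) (max k3 k4)"
  have kk: "k1 \<le> k" "k2 \<le> k" "k3 \<le> k" "k4 \<le> k" by (auto simp: k_def)
  define A where "A = (3 * real k + 3) * (C1 + 1)"
  have A: "A \<ge> 0" using C1 by (simp add: A_def)
  have growth: "\<forall>\<^sub>F T in at_top. 1 * (\<phi> T * ln (\<phi> T)) \<le> 1 * (T * V (\<phi> T))"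
    by (rule phi_growth_le) auto
  have "\<forall>\<^sub>F T in at_top. exp (- (T * V (\<phi> T)) * (I + \<delta>)) \<le>
     prob (path_event M (scaled_process \<xi> \<phi> T) (unif_nbhd \<epsilon> f))"
    using eventually_gt_at_top[of 0] eventually_phi[OF eventually_ge_at_top[of 3]]
      \<comment> \<open>For such \<phi> the total delay, at most (C1 + 1) T / \<phi>, stays below r
        T.\<close>
      eventually_phi[OF eventually_gt_at_top[of "(C1 + 1) / r"]] eventually_phi[OF paths]
      eventually_phi[OF total_uniform[OF C d]] eventually_phi[OF k1[OF kk(1)]] eventually_phi[OF k2[OF kk(2)]]
      eventually_phi[OF k3[OF kk(3)]] eventually_phi[OF k4[OF kk(4)]] growth phi_growth_le[OF d A]
  proof eventually_elim
    case (elim T)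
    define \<rho> where "\<rho> = \<phi> T"
    note elim = elim[folded \<rho>_def]
    have T: "T > 0" and \<rho>: "\<rho> \<ge> 3" using elim by auto
    have V: "V \<rho> > 0" using V_pos \<rho> by simp
    obtain n x s where x0: "x 0 = (0::nat)" and n: "real n \<le> C1 * \<rho>"
      and adj: "\<And>i. i < n \<Longrightarrow> x (Suc i) = Suc (x i) \<or> x i = Suc (x (Suc i))"
      and s: "\<And>i. 0 \<le> s i" and sT: "(\<Sum>i<Suc n. s i) = T"
      and tube: "\<And>i u. i \<le> n \<Longrightarrow> (\<Sum>k<i. s k) \<le> u \<Longrightarrow> u \<le> (\<Sum>k<Suc i. s k) \<Longrightarrow> \<bar>real (x i) / \<rho> - f (u / T)\<bar> \<le> \<eta>"
      using elim(4) T by metis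
    have n1: "real (Suc n) \<le> (C1 + 1) * \<rho>" using n \<rho> by (simp add: algebra_simps)
    have s01: "0 \<le> u / T" "u / T \<le> 1" if "i \<le> n" "(\<Sum>k<i. s k) \<le> u" "u \<le> (\<Sum>k<Suc i. s k)" for i u
    proof -
      have "(\<Sum>k<i. s k) \<ge> 0" using s by (intro sum_nonneg) auto
      moreover have "(\<Sum>k<Suc i. s k) \<le> (\<Sum>k<Suc n. s k)"
        using that s by (intro sum_mono2) auto
      ultimately have "0 \<le> u" "u \<le> T" using that sT by linarith+
      then show "0 \<le> u / T" "u / T \<le> 1" using T by auto
    qed
    have x_le: "real (x i) / \<rho> \<le> C" if "i \<le> n" for i
    proof -
      let ?u = "\<Sum>k<i. s k"
      have u: "?u \<le> ?u" "?u \<le> (\<Sum>k<Suc i. s k)" using s by auto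
      have "f (?u / T) \<le> B" using s01[OF that u] by (rule B(2))
      then show ?thesis using tube[OF that u] \<eta>(4) unfolding C_def by linarith
    qed
    have x_le': "real (x i) \<le> C * \<rho>" if "i \<le> n" for i
      using x_le[OF that] \<rho> by (simp add: pos_divide_le_eq)
    let ?L = "{\<omega>\<in>cyl n x. \<forall>i\<le>n. s i < S i \<omega> \<and> S i \<omega> \<le> s i + T / \<rho>\<^sup>2}"
    have "T * integral {0..1} (\<lambda>t. - V \<rho> * (f t powr max l m + 2 * d)) \<le>
      (\<Sum>i<n. - (lam (x i) + mu (x i)) * s i) + - (lam (x n) + mu (x n)) * (T - (\<Sum>i<n. s i))"
    proof (rule integral_le_step_sum)
      show "continuous_on {0..1} (\<lambda>t. - V \<rho> * (f t powr max l m + 2 * d))"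
        by (intro continuous_intros ff(4))
      show "(\<Sum>i<n. s i) \<le> T" using sT s[of n] by simp
      fix i u assume i: "i \<le> n" and u: "(\<Sum>k<i. s k) \<le> u" "u < (\<Sum>k<Suc i. s k)"
      have u2: "u \<le> (\<Sum>k<Suc i. s k)" using u by simp
      note u01 = s01[OF i u(1) u2]
      have "\<bar>f (u / T) powr max l m - (real (x i) / \<rho>) powr max l m\<bar> < d"
      proof (rule pc)
        show "f (u / T) \<in> {0..C}" using ff(3)[OF u01] B(2)[OF u01] by (simp add: C_def)
        show "real (x i) / \<rho> \<in> {0..C}" using x_le[OF i] \<rho> by simp
        show "\<bar>f (u / T) - real (x i) / \<rho>\<bar> < e" using tube[OF i u(1) u2] \<eta> by linarith
      qed
      then have "V \<rho> * ((real (x i) / \<rho>) powr max l m) \<le> V \<rho> * (f (u / T) powr max l m + d)"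
        using V by (intro mult_left_mono) auto
      moreover have "\<bar>lam (x i) + mu (x i) - V \<rho> * (real (x i) / \<rho>) powr max l m\<bar> \<le> d * V \<rho>"
        using elim(5) x_le'[OF i] by blast
      ultimately show "- V \<rho> * (f (u / T) powr max l m + 2 * d) \<le> - (lam (x i) + mu (x i))"
        by (simp add: algebra_simps abs_le_iff)
    qed (use T s sT in auto)
    moreover have "T - (\<Sum>i<n. s i) = s n" using sT by simp
    ultimately have "T * (- V \<rho> * (I + 2 * d)) \<le> (\<Sum>i<Suc n. - (lam (x i) + mu (x i)) * s i)"
      unfolding integral_affine[OF ff(4)] I_def by simp
    also have "\<dots> = - (\<Sum>i\<le>n. (lam (x i) + mu (x i)) * s i)"
      by (simp only: lessThan_Suc_atMost mult_minus_left sum_negf)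
    finally have hold: "(\<Sum>i\<le>n. (lam (x i) + mu (x i)) * s i) \<le> T * V \<rho> * (I + 2 * d)"
      by (simp add: algebra_simps)
    have "(3 * real k + 3) * real (Suc n) * ln \<rho> \<le> (3 * real k + 3) * ((C1 + 1) * \<rho>) * ln \<rho>"
      using n1 \<rho> by (intro mult_right_mono mult_left_mono) auto
    also have "\<dots> = A * (\<rho> * ln \<rho>)" by (simp add: A_def)
    also have "\<dots> \<le> d * (T * V \<rho>)" by (rule elim(11))
    finally have "(3 * real k + 3) * real (Suc n) * ln \<rho> + (\<Sum>i\<le>n. (lam (x i) + mu (x i)) * s i) \<le> T * V \<rho> * (I + \<delta>)"
      using hold unfolding d_def by (simp add: algebra_simps)
    then have "exp (- (T * V \<rho>) * (I + \<delta>)) \<le>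
        exp (- ((3 * real k + 3) * real (Suc n) * ln \<rho> + (\<Sum>i\<le>n. (lam (x i) + mu (x i)) * s i)))"
      by simp
    also have "\<dots> \<le> prob ?L"
      using elim(6-10) x_le' by (intro prob_lattice_path_ge \<rho> T x0 adj s) auto
    also have "\<dots> \<le> prob (path_event M (scaled_process \<xi> \<phi> T) (unif_nbhd \<epsilon> f))"
    proof (rule finite_measure_mono)
      show "path_event M (scaled_process \<xi> \<phi> T) (unif_nbhd \<epsilon> f) \<in> sets M"
        by (intro path_event_sets T ff(1) phi_pos)
      show "?L \<subseteq> path_event M (scaled_process \<xi> \<phi> T) (unif_nbhd \<epsilon> f)"
      proof (rule cyl_box_subset_path_event[OF ff(1) T \<eta>(2) uc])
        show "real (Suc n) * (T / \<rho>\<^sup>2) < r * T"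
        proof -
          have "real (Suc n) * (T / \<rho>\<^sup>2) \<le> (C1 + 1) * \<rho> * (T / \<rho>\<^sup>2)"
            using n1 T by (intro mult_right_mono) auto
          also have "\<dots> = (C1 + 1) / \<rho> * T" using \<rho> by (simp add: power2_eq_square)
          also have "\<dots> < r * T"
          proof (rule mult_strict_right_mono[OF _ T])
            show "(C1 + 1) / \<rho> < r" using elim(3) r \<rho> by (simp add: field_simps)
          qed
          finally show ?thesis .
        qed
      qed (use T \<rho> s sT tube \<rho>_def in auto)
    qed
    finally show ?case by (simp add: \<rho>_def)
  qed
  then show ?thesis by (simp add: I_def)
qed

section \<open>Passage to the limit as \<epsilon> tends to 0\<close>

text \<open>The exponential bounds place the lower limit above -I - \<delta> for every \<epsilon>
  and the upper limit below -I + \<delta> for small \<epsilon>; since the former is at most the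
  latter, both are squeezed.\<close>

lemma local_ldp_scaled_process:
  "local_ldp M (scaled_process \<xi> \<phi>) positive_paths (\<lambda>T. T * V (\<phi> T)) (\<lambda>f. integral {0..1} (\<lambda>t. f t powr (max l m)))"
  unfolding local_ldp_def
proof (intro ballI)
  fix f assume f: "f \<in> positive_paths"
  define I where "I = integral {0..1} (\<lambda>t. f t powr (max l m))"
  define p where "p = (\<lambda>\<epsilon> T. prob (path_event M (scaled_process \<xi> \<phi> T) (unif_nbhd \<epsilon> f)))"
  define R where "R = (\<lambda>\<epsilon> T. ln_prob (p \<epsilon> T) / ereal (T * V (\<phi> T)))"
  have \<psi>: "T * V (\<phi> T) > 0" if "T > 0" for T using that V_pos[OF phi_pos] by simp
  have R_eq: "R \<epsilon> T = ereal (ln (p \<epsilon> T) / (T * V (\<phi> T)))" if "T > 0" "p \<epsilon> T > 0" for \<epsilon> T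
  proof -
    have div: "ereal a / ereal b = ereal (a / b)" if "b > 0" for a b :: real using that by simp
    show ?thesis using \<psi>[OF that(1)] that(2) unfolding R_def ln_prob_def by (subst div[symmetric]) auto
  qed
  have squeeze: "(G \<longlongrightarrow> ereal a) (at_right 0)"
    if "\<And>\<delta>. \<delta> > 0 \<Longrightarrow> \<forall>\<^sub>F \<epsilon> in at_right 0. ereal (a - \<delta>) \<le> G \<epsilon> \<and> G \<epsilon> \<le> ereal (a + \<delta>)" for G :: "real \<Rightarrow> ereal" and a
  proof (rule order_tendstoI)
    fix b assume "b < ereal a"
    then obtain c where c: "b < ereal c" "c < a" using ereal_dense2 by force
    have "\<forall>\<^sub>F \<epsilon> in at_right 0. ereal (a - (a - c)) \<le> G \<epsilon> \<and> G \<epsilon> \<le> ereal (a + (a - c))"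
      by (rule that) (use c in simp)
    then show "\<forall>\<^sub>F \<epsilon> in at_right 0. b < G \<epsilon>"
      using c by (auto elim!: eventually_mono)
  next
    fix b assume "ereal a < b"
    then obtain c where c: "ereal c < b" "a < c" using ereal_dense2 by force
    have "\<forall>\<^sub>F \<epsilon> in at_right 0. ereal (a - (c - a)) \<le> G \<epsilon> \<and> G \<epsilon> \<le> ereal (a + (c - a))"
      by (rule that) (use c in simp)
    then show "\<forall>\<^sub>F \<epsilon> in at_right 0. G \<epsilon> < b"
      using c by (auto elim!: eventually_mono)
  qed
  have lower: "\<forall>\<^sub>F T in at_top. ereal (- I - \<delta>) \<le> R \<epsilon> T" if "\<delta> > 0" "\<epsilon> > 0" for \<delta> \<epsilon>
    using lower_bound[OF f that(2,1)] eventually_gt_at_top[of 0]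
  proof eventually_elim
    case (elim T)
    have "p \<epsilon> T \<ge> exp (- (T * V (\<phi> T)) * (I + \<delta>))" using elim by (simp add: p_def I_def)
    moreover from this have "p \<epsilon> T > 0" by (rule less_le_trans[OF exp_gt_zero])
    ultimately have "- (T * V (\<phi> T)) * (I + \<delta>) \<le> ln (p \<epsilon> T)" by (simp add: ln_ge_iff)
    then have "(- I - \<delta>) * (T * V (\<phi> T)) \<le> ln (p \<epsilon> T)" by (simp add: algebra_simps)
    then have "- I - \<delta> \<le> ln (p \<epsilon> T) / (T * V (\<phi> T))"
      using \<psi>[OF elim(2)] by (simp only: pos_le_divide_eq)
    then show ?case
      using \<open>p \<epsilon> T > 0\<close> elim(2) by (simp add: R_eq)
  qed
  have upper: "\<exists>\<epsilon>0>0. \<forall>\<epsilon>. 0 < \<epsilon> \<longrightarrow> \<epsilon> \<le> \<epsilon>0 \<longrightarrow> (\<forall>\<^sub>F T in at_top. R \<epsilon> T \<le> ereal (- I + \<delta>))" if \<delta>: "\<delta> > 0" for \<delta>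
  proof -
    obtain \<epsilon>0 where \<epsilon>0: "\<epsilon>0 > 0" and up: "\<And>\<epsilon>. 0 < \<epsilon> \<Longrightarrow> \<epsilon> \<le> \<epsilon>0 \<Longrightarrow>
        \<forall>\<^sub>F T in at_top. p \<epsilon> T \<le> exp (- (T * V (\<phi> T)) * (I - \<delta>))"
      using upper_bound[OF f \<delta>] unfolding p_def I_def by blast
    have "\<forall>\<^sub>F T in at_top. R \<epsilon> T \<le> ereal (- I + \<delta>)" if "0 < \<epsilon>" "\<epsilon> \<le> \<epsilon>0" for \<epsilon>
      using up[OF that] eventually_gt_at_top[of 0]
    proof eventually_elim
      case (elim T)
      show ?case
      \<comment> \<open>A null event has logarithm minus infinity, and division by the positive
        normaliser keeps that value, so the upper estimate is trivial.\<close>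
      proof (cases "p \<epsilon> T = 0")
        case True
        then show ?thesis using \<psi>[OF elim(2)] by (simp add: R_def ln_prob_def)
      next
        case False
        then have pos: "p \<epsilon> T > 0" by (simp add: p_def less_le)
        then have "ln (p \<epsilon> T) \<le> ln (exp (- (T * V (\<phi> T)) * (I - \<delta>)))"
          using elim(1) by (subst ln_le_cancel_iff) auto
        then have "ln (p \<epsilon> T) \<le> (- I + \<delta>) * (T * V (\<phi> T))" by (simp add: algebra_simps)
        then have "ln (p \<epsilon> T) / (T * V (\<phi> T)) \<le> - I + \<delta>"
          using \<psi>[OF elim(2)] by (simp only: pos_divide_le_eq)
        then show ?thesis using pos elim(2) by (simp add: R_eq)
      qed
    qed
    then show ?thesis using \<epsilon>0 by blast
  qed
  have both: "\<forall>\<^sub>F \<epsilon> in at_right 0. ereal (- I - \<delta>) \<le> Liminf at_top (R \<epsilon>) \<and> Limsup at_top (R \<epsilon>) \<le> ereal (- I + \<delta>)"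
    if \<delta>: "\<delta> > 0" for \<delta>
  proof -
    obtain \<epsilon>0 where \<epsilon>0: "\<epsilon>0 > 0" and up: "\<And>\<epsilon>. 0 < \<epsilon> \<Longrightarrow> \<epsilon> \<le> \<epsilon>0 \<Longrightarrow> \<forall>\<^sub>F T in at_top. R \<epsilon> T \<le> ereal (- I + \<delta>)"
      using upper[OF \<delta>] by blast
    have "\<forall>\<^sub>F \<epsilon> in at_right 0. \<epsilon> \<in> {0<..<\<epsilon>0}"
      by (rule eventually_at_right_real[OF \<epsilon>0])
    then show ?thesis
    proof eventually_elim
      case (elim \<epsilon>)
      then show ?case
        using lower[OF \<delta>, of \<epsilon>] up[of \<epsilon>] by (auto intro!: Liminf_bounded Limsup_bounded)
    qed
  qed
  have LL: "Liminf at_top (R \<epsilon>) \<le> Limsup at_top (R \<epsilon>)" for \<epsilon>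
    by (rule Liminf_le_Limsup) simp
  have "((\<lambda>\<epsilon>. Limsup at_top (R \<epsilon>)) \<longlongrightarrow> ereal (- I)) (at_right 0)"
  proof (rule squeeze)
    fix \<delta> :: real assume "\<delta> > 0"
    from both[OF this] show "\<forall>\<^sub>F \<epsilon> in at_right 0. ereal (- I - \<delta>) \<le> Limsup at_top (R \<epsilon>) \<and> Limsup at_top (R \<epsilon>) \<le> ereal (- I + \<delta>)"
      by eventually_elim (use LL order_trans in blast)
  qed
  moreover have "((\<lambda>\<epsilon>. Liminf at_top (R \<epsilon>)) \<longlongrightarrow> ereal (- I)) (at_right 0)"
  proof (rule squeeze)
    fix \<delta> :: real assume "\<delta> > 0"
    from both[OF this] show "\<forall>\<^sub>F \<epsilon> in at_right 0. ereal (- I - \<delta>) \<le> Liminf at_top (R \<epsilon>) \<and> Liminf at_top (R \<epsilon>) \<le> ereal (- I + \<delta>)"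
      by eventually_elim (use LL order_trans in blast)
  qed
  ultimately show "((\<lambda>\<epsilon>. Limsup at_top (\<lambda>T. ln_prob (prob (path_event M (scaled_process \<xi> \<phi> T) (unif_nbhd \<epsilon> f))) / ereal (T * V (\<phi> T))))
      \<longlongrightarrow> ereal (- integral {0..1} (\<lambda>t. f t powr (max l m)))) (at_right 0) \<and>
    ((\<lambda>\<epsilon>. Liminf at_top (\<lambda>T. ln_prob (prob (path_event M (scaled_process \<xi> \<phi> T) (unif_nbhd \<epsilon> f))) / ereal (T * V (\<phi> T))))
      \<longlongrightarrow> ereal (- integral {0..1} (\<lambda>t. f t powr (max l m)))) (at_right 0)"
    unfolding R_def p_def I_def by blast
qed

end

theorem theorem2p1:
  fixes M :: "'a measure" and \<xi> :: "real \<Rightarrow> 'a \<Rightarrow> nat option"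
    and lam mu :: "nat \<Rightarrow> real" and l m :: real
    and y z Y Z V \<phi> :: "real \<Rightarrow> real"
  assumes lam_pos: "\<And>x. lam x > 0"
    and mu_pos: "\<And>x. x > 0 \<Longrightarrow> mu x > 0"
    and mu_0: "mu 0 = 0"
    and process: "birth_death_process M lam mu 0 \<xi>"
    and exponents: "l \<ge> 0" "m \<ge> 0" "l \<noteq> m"
    and slow: "slowly_varying y" "slowly_varying z"
    and Y_def: "\<And>x. x > 0 \<Longrightarrow> Y x = y x * x powr l"
    and Z_def: "\<And>x. x > 0 \<Longrightarrow> Z x = z x * x powr m"
    and V_def: "\<And>x. x > 0 \<Longrightarrow> V x = max (Y x) (Z x)"
    and lam_lim: "(\<lambda>x::nat. lam x / Y (real x)) \<longlonglongrightarrow> 1"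
    and mu_lim: "(\<lambda>x::nat. mu x / Z (real x)) \<longlonglongrightarrow> 1"
    and phi_pos: "\<And>T. T > 0 \<Longrightarrow> \<phi> T > 0"
    and phi_lim: "filterlim \<phi> at_top at_top"
    and phi_growth: "((\<lambda>T. \<phi> T * ln (\<phi> T) / (T * V (\<phi> T))) \<longlongrightarrow> 0) at_top"
  shows "local_ldp M (scaled_process \<xi> \<phi>) positive_paths
           (\<lambda>T. T * V (\<phi> T)) (\<lambda>f. integral {0..1} (\<lambda>t. f t powr (max l m)))"
proof -
  interpret prob_space M
    using process by (simp add: birth_death_process_def)
  obtain X S where chain: "jump_chain_holding_times M lam mu 0 X S"
    and \<xi>: "\<And>\<omega> t x. \<omega> \<in> space M \<Longrightarrow> t \<ge> 0 \<Longrightarrow>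
      \<xi> t \<omega> = Some x \<longleftrightarrow> (\<exists>n. (\<Sum>k<n. S k \<omega>) \<le> t \<and> t < (\<Sum>k<Suc n. S k \<omega>) \<and> X n \<omega> = x)"
    using process unfolding birth_death_process_def by blast
  interpret birth_death_ldp M lam mu X S \<xi> l m y z Y Z V \<phi>
    by unfold_locales
      (fact lam_pos mu_pos mu_0 exponents slow Y_def Z_def V_def lam_lim mu_lim chain \<xi> phi_pos phi_lim phi_growth)+
  show ?thesis by (rule local_ldp_scaled_process)
qed

end
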